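(* Let $S$ be a string of length $N$ compressed into a Linear SLP $G$ of size $n$. One can construct an $O(n)$ space data structure such that, given a finger $f$ for position $i$ or for position $j$, a query $\textsc{Fingerprint}(i,j)$ is answered in time $O(\log\log D)$, where $D=|i-j|$.
   Context: Model of computation: word RAM with word size $\log N$ bits. $S[i,j]$ denotes the substring of $S$ from position $i$ to $j$ inclusive. An SLP is a context-free grammar in Chomsky normal form producing exactly one string, represented as an ordered node-labelled DAG: leaves are labelled by characters, each internal node $v$ has two ordered children $\mathit{left}(v),\mathit{right}(v)$, and $S(v)$ is the sequence of leaf labels met in a left-to-right depth-first traversal from $v$; the root produces $S$; the size is the number of nodes. A Linear SLP is an SLP in which the root may have any number of ordered children $r_1,\dots,r_k$, and every other internal node $v$ has a leaf as $\mathit{right}(v)$; then $S=S(r_1)S(r_2)\cdots S(r_k)$. A finger for position $i$ is a pointer to the child $r_m$ of the root whose produced string $S(r_m)$ contains the position $S[i]$ (in the decomposition $S=S(r_1)\cdots S(r_k)$). The Karp–Rabin fingerprint of a string $x$ is $\phi(x)=\sum_{t=1}^{|x|} x[t]\cdot c^t \bmod p$, with $c$ a random positive integer and $p$ a prime with $2N^{c+4}\le p\le 4N^{c+4}$; $\textsc{Fingerprint}(i,j)$ returns $\phi(S[i,j])$.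
   Formalization: The size n is the number of nodes or, if larger, the number k of children of the root counted with repetitions; with repeated children and only nodes counted, the O(n) space claim is false (a root over two leaves can produce any binary string). *)

theory Defs
  imports Complex_Main "HOL-Computational_Algebra.Primes"
begin

section \<open>Strings and Karp-Rabin fingerprints\<close>

text \<open>Strings are lists of numbers. Positions in a string are counted from 1.\<close>

definition substring :: "nat list \<Rightarrow> nat \<Rightarrow> nat \<Rightarrow> nat list" where
  "substring S i j = take (j - i + 1) (drop (i - 1) S)"

definition fingerprint :: "nat \<Rightarrow> nat \<Rightarrow> nat list \<Rightarrow> nat" where
  "fingerprint c p x = (\<Sum>t = 1..length x. x ! (t - 1) * c ^ t) mod p"


section \<open>Linear SLPs\<close>

datatype node_label = Leaf nat | Node (left: nat) (right: nat)

text \<open>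
  The root is kept apart from the other nodes: \<open>nodes\<close> are the nodes below the root and
  \<open>children\<close> lists the children \<open>r_1, ..., r_k\<close> of the root, possibly with repetitions.
\<close>

record slp =
  nodes :: "nat set"
  label :: "nat \<Rightarrow> node_label"
  children :: "nat list"

definition edges :: "slp \<Rightarrow> (nat \<times> nat) set" where
  "edges G = {(v, u). v \<in> nodes G \<and> (\<exists>l r. label G v = Node l r \<and> (u = l \<or> u = r))}"

definition linear_slp :: "slp \<Rightarrow> bool" where
  "linear_slp G \<longleftrightarrow>
     finite (nodes G) \<and> children G \<noteq> [] \<and> set (children G) \<subseteq> nodes G \<and>
     edges G \<subseteq> nodes G \<times> nodes G \<and> acyclic (edges G) \<and>
     (\<forall>v\<in>nodes G. \<forall>l r. label G v = Node l r \<longrightarrow> (\<exists>a. label G r = Leaf a))"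

inductive produces :: "slp \<Rightarrow> nat \<Rightarrow> nat list \<Rightarrow> bool" for G where
  leaf: "label G v = Leaf a \<Longrightarrow> produces G v [a]"
| node: "label G v = Node l r \<Longrightarrow> produces G l x \<Longrightarrow> produces G r y \<Longrightarrow> produces G v (x @ y)"

definition string_of :: "slp \<Rightarrow> nat \<Rightarrow> nat list" where
  "string_of G v = (THE x. produces G v x)"

definition slp_string :: "slp \<Rightarrow> nat list" where
  "slp_string G = concat (map (string_of G) (children G))"

text \<open>
  The size is the number of nodes, the root included. If a node occurs several times among the
  children of the root, the list of children may be longer than that (and the string may then
  have arbitrarily large information content for a fixed number of nodes); in this case the
  length of the list counts.
\<close>

definition slp_size :: "slp \<Rightarrow> nat" where
  "slp_size G = max (card (nodes G) + 1) (length (children G))"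

text \<open>
  A finger is an index \<open>m\<close> with \<open>1 \<le> m \<le> k\<close>, pointing at the \<open>m\<close>-th child of the root.
\<close>

definition is_finger :: "slp \<Rightarrow> nat \<Rightarrow> nat \<Rightarrow> bool" where
  "is_finger G i m \<longleftrightarrow>
     1 \<le> m \<and> m \<le> length (children G) \<and>
     length (concat (map (string_of G) (take (m - 1) (children G)))) < i \<and>
     i \<le> length (concat (map (string_of G) (take m (children G))))"

lemma produces_unique: "produces G v x \<Longrightarrow> produces G v y \<Longrightarrow> x = y"
proof (induction arbitrary: y rule: produces.induct)
  case (leaf v a)
  from leaf(2,1) show ?case by cases auto
next
  case (node v l r x z)
  from node.prems node.hyps(1) show ?case
    by cases (auto dest!: node.IH)
qed

lemma produces_string_of:
  assumes "linear_slp G" "v \<in> nodes G"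
  shows "produces G v (string_of G v)"
proof -
  have fin: "finite (edges G)"
    using assms(1) by (auto simp: linear_slp_def intro: finite_subset)
  have wf: "wf ((edges G)\<inverse>)"
    using fin assms(1) by (intro finite_acyclic_wf_converse) (auto simp: linear_slp_def)
  have "v \<in> nodes G \<longrightarrow> (\<exists>x. produces G v x)"
  proof (induction v rule: wf_induct_rule[OF wf])
    case (1 v)
    show ?case
    proof (cases "label G v")
      case (Leaf a)
      then show ?thesis by (blast intro: produces.leaf)
    next
      case (Node l r)
      show ?thesis
      proof
        assume "v \<in> nodes G"
        then have e: "(v, l) \<in> edges G" "(v, r) \<in> edges G"
          using Node by (auto simp: edges_def)
        then have "l \<in> nodes G" "r \<in> nodes G"
          using assms(1) by (auto simp: linear_slp_def)
        then show "\<exists>x. produces G v x"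
          using 1 e Node by (blast intro: produces.node)
      qed
    qed
  qed
  then obtain x where "produces G v x" using assms(2) by blast
  then show ?thesis
    unfolding string_of_def by (rule theI) (use \<open>produces G v x\<close> produces_unique in blast)
qed


section \<open>The word RAM\<close>

text \<open>
  A machine with words of \<open>w\<close> bits. Programs name their registers explicitly, so a program
  uses a constant number of them. The memory has a fixed number of cells; reading or writing
  outside of it is an error, i.e. the machine is stuck without having halted.
\<close>

datatype binop = Add | Sub | Mul | Div | Mod | And | Or | Xor | Shl | Shr

datatype instr =
    Const nat nat          \<comment> \<open>\<open>Const d k\<close>: \<open>R_d := k\<close>\<close>
  | Op binop nat nat nat   \<comment> \<open>\<open>Op f d a b\<close>: \<open>R_d := f R_a R_b\<close>\<close>
  | Load nat nat           \<comment> \<open>\<open>Load d a\<close>: \<open>R_d := M[R_a]\<close>\<close>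
  | Store nat nat          \<comment> \<open>\<open>Store a b\<close>: \<open>M[R_a] := R_b\<close>\<close>
  | JumpLess nat nat nat   \<comment> \<open>\<open>JumpLess a b l\<close>: go to instruction \<open>l\<close> if \<open>R_a < R_b\<close>\<close>
  | Jump nat
  | Halt

type_synonym program = "instr list"

record state =
  pc :: nat
  reg :: "nat \<Rightarrow> nat"
  mem :: "nat list"

fun binop_val :: "nat \<Rightarrow> binop \<Rightarrow> nat \<Rightarrow> nat \<Rightarrow> nat" where
  "binop_val w Add x y = (x + y) mod 2 ^ w"
| "binop_val w Sub x y = (x + 2 ^ w - y) mod 2 ^ w"
| "binop_val w Mul x y = (x * y) mod 2 ^ w"
| "binop_val w Div x y = x div y"
| "binop_val w Mod x y = x mod y"
| "binop_val w And x y = semiring_bit_operations_class.and x y"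
| "binop_val w Or x y = semiring_bit_operations_class.or x y"
| "binop_val w Xor x y = semiring_bit_operations_class.xor x y"
| "binop_val w Shl x y = push_bit y x mod 2 ^ w"
| "binop_val w Shr x y = drop_bit y x"

fun exec_instr :: "nat \<Rightarrow> instr \<Rightarrow> state \<Rightarrow> state option" where
  "exec_instr w (Const d k) s = Some (s\<lparr>pc := pc s + 1, reg := (reg s)(d := k mod 2 ^ w)\<rparr>)"
| "exec_instr w (Op f d a b) s =
     Some (s\<lparr>pc := pc s + 1, reg := (reg s)(d := binop_val w f (reg s a) (reg s b))\<rparr>)"
| "exec_instr w (Load d a) s =
     (if reg s a < length (mem s)
      then Some (s\<lparr>pc := pc s + 1, reg := (reg s)(d := mem s ! reg s a)\<rparr>) else None)"
| "exec_instr w (Store a b) s =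
     (if reg s a < length (mem s)
      then Some (s\<lparr>pc := pc s + 1, mem := (mem s)[reg s a := reg s b]\<rparr>) else None)"
| "exec_instr w (JumpLess a b l) s =
     Some (s\<lparr>pc := if reg s a < reg s b then l else pc s + 1\<rparr>)"
| "exec_instr w (Jump l) s = Some (s\<lparr>pc := l\<rparr>)"
| "exec_instr w Halt s = None"

definition step :: "nat \<Rightarrow> program \<Rightarrow> (state \<times> state) set" where
  "step w P = {(s, s'). pc s < length P \<and> exec_instr w (P ! pc s) s = Some s'}"

definition halted :: "program \<Rightarrow> state \<Rightarrow> bool" where
  "halted P s \<longleftrightarrow> pc s < length P \<and> P ! pc s = Halt"

definition initial_state :: "nat list \<Rightarrow> nat list \<Rightarrow> state" where
  "initial_state M args =
     \<lparr>pc = 0, reg = (\<lambda>d. if d < length args then args ! d else 0), mem = M\<rparr>"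

text \<open>
  Started on memory \<open>M\<close> with the arguments in the first registers, the program halts after
  \<open>t\<close> steps with the result in register 0. The memory may be used as scratch space, but must be
  restored at the end, so that the same data structure serves any number of queries.
\<close>

definition answers_query ::
  "nat \<Rightarrow> program \<Rightarrow> nat list \<Rightarrow> nat list \<Rightarrow> nat \<Rightarrow> nat \<Rightarrow> bool" where
  "answers_query w P M args t res \<longleftrightarrow>
     (\<exists>s. (initial_state M args, s) \<in> step w P ^^ t \<and> halted P s \<and> mem s = M \<and> reg s 0 = res)"

text \<open>
  Words of \<open>\<Theta>(log N)\<close> bits; the \<open>+ 1\<close> makes room for all the positions \<open>1, ..., N\<close>.
\<close>

definition word_size :: "nat \<Rightarrow> nat \<Rightarrow> nat" where
  "word_size b N = b * nat \<lceil>log 2 (real N + 1)\<rceil>"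

text \<open>The maximum makes the iterated logarithm well-defined and at least 1 for all \<open>D \<ge> 0\<close>.\<close>

definition loglog :: "real \<Rightarrow> real" where
  "loglog D = log 2 (log 2 (max 4 D))"

end

theory Submission
  imports Defs
begin

text \<open>
  Prefix fingerprints reduce a query to two positions \<open>x\<close>: the fingerprint of \<open>S[i,j]\<close> is the
  difference of those of \<open>S[1,j]\<close> and \<open>S[1,i-1]\<close>, divided by \<open>c ^ (i - 1)\<close>, and \<open>c\<close> is invertible
  modulo \<open>p\<close> unless \<open>N = 1\<close>. For one \<open>x\<close>, the child of the root containing it is found by a
  predecessor search starting at the finger, and the part of \<open>x\<close> inside the child \<open>r\<close> is a prefix
  of \<open>S(r)\<close>, hence an ancestor of \<open>r\<close> in the trie of all prefixes, whose fingerprint is stored.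

  The ancestor of a given depth is found in constant time: jump pointers and ladders above the
  subtrees of logarithmic size, tabulated selection inside them. For the predecessor, take
  \<open>T = 2 ^ l\<close> minimal such that blocks of \<open>2 ^ T\<close> positions are longer than the distance to the
  finger. Level \<open>T\<close> samples every \<open>T ^ 2\<close>-th boundary. The longest common prefix of \<open>x\<close> with a sample
  in its block is found by binary search on the number \<open>\<le> T\<close> of truncated bits in a static
  dictionary; an empty block is resolved by the block of the finger or the finger itself; then the
  \<open>T ^ 2\<close> boundaries behind the sample are searched. This takes \<open>O(l) = O(log log D)\<close> steps, and the
  levels occupy \<open>O(n)\<close> words because \<open>T / T ^ 2\<close> is summable over \<open>T = 2 ^ l\<close>.
\<close>

section \<open>Static dictionaries\<close>

text \<open>The prime of the fingerprints is also the prime of the hash functions: for N >= 2 and c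
  >= 1 it is at least 2 * N ^ 5, which exceeds every dictionary key. Good hash functions are found
  by averaging, so the tables are shown to exist without any randomness.

  The obstacle to linear space is that 0 is a sample at every level, so that the levels cost O(log
  N) words beyond the summable part. This is still O(n): a child produces fewer characters than the
  trie has nodes, so N is at most k * m for k children and m trie nodes, and log N is at most k + m.

  The program is one fixed list of instructions. All that depends on the string, such as the prime
  and the addresses of the tables, is read from memory. The powers needed are tabulated per child
  and per trie node, because computing them would take logarithmic time. A query is not told to
  which end its finger belongs and decides this by comparing with the ends of the child. For N = 1 a
  flag in memory selects a stored answer.\<close>

text \<open>Buckets, ladders, micro trees and rows of jump pointers are families of small tables.
  Each family becomes one array with an offset per member, so that its space is the sum of the
  sizes.\<close>

lemma layout:
  fixes B :: "'a \<Rightarrow> 'b list"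
  assumes "finite X"
  obtains ys off where "length ys = (\<Sum>x\<in>X. length (B x))" "set ys = (\<Union>x\<in>X. set (B x))"
    "\<And>x. x \<in> X \<Longrightarrow> off x + length (B x) \<le> length ys"
    "\<And>x e. x \<in> X \<Longrightarrow> e < length (B x) \<Longrightarrow> ys ! (off x + e) = B x ! e"
  using assms
proof (induction X arbitrary: thesis rule: finite_induct)
  case empty
  show ?case by (rule empty(1)[of "[]"]) auto
next
  case (insert z X)
  obtain ys off where ys: "length ys = (\<Sum>x\<in>X. length (B x))" "set ys = (\<Union>x\<in>X. set (B x))"
    and off: "\<And>x. x \<in> X \<Longrightarrow> off x + length (B x) \<le> length ys"
      "\<And>x e. x \<in> X \<Longrightarrow> e < length (B x) \<Longrightarrow> ys ! (off x + e) = B x ! e"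
    by (rule insert.IH) (rule that)
  show ?case
  proof (rule insert.prems[of "ys @ B z" "off(z := length ys)"])
    show "length (ys @ B z) = (\<Sum>x\<in>insert z X. length (B x))" using insert.hyps ys by simp
    show "set (ys @ B z) = (\<Union>x\<in>insert z X. set (B x))" using ys by auto
    fix x assume x: "x \<in> insert z X"
    show "(off(z := length ys)) x + length (B x) \<le> length (ys @ B z)"
      using off(1)[of x] x by auto
    show "(ys @ B z) ! ((off(z := length ys)) x + e) = B x ! e" if "e < length (B x)" for e
      using off[of x] x that by (auto simp: nth_append)
  qed
qed

section \<open>Multiplicative hashing modulo a prime\<close>

text \<open>Carter-Wegman hashing without the additive shift; the family is universal up to a factor
  of 2.\<close>

definition hash :: "nat \<Rightarrow> nat \<Rightarrow> nat \<Rightarrow> nat \<Rightarrow> nat" where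
  "hash p m a x = a * x mod p mod m"

lemma card_multiples:
  fixes p m :: nat assumes "m \<ge> 1" "p \<ge> 1"
  shows "card {z\<in>{1..<p}. m dvd z} * m \<le> p - 1"
proof -
  have "{z\<in>{1..<p}. m dvd z} \<subseteq> (\<lambda>q. m * q) ` {1..(p - 1) div m}"
  proof
    fix z assume "z \<in> {z\<in>{1..<p}. m dvd z}"
    then obtain q where q: "z = m * q" "1 \<le> z" "z \<le> p - 1" by (auto elim!: dvdE)
    then have "q \<le> (p - 1) div m" using assms by (simp add: less_eq_div_iff_mult_less_eq mult.commute)
    then show "z \<in> (\<lambda>q. m * q) ` {1..(p - 1) div m}" using q by (cases "q = 0") auto
  qed
  then have "card {z\<in>{1..<p}. m dvd z} \<le> card ((\<lambda>q. m * q) ` {1..(p - 1) div m})"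
    by (intro card_mono) auto
  also have "\<dots> \<le> (p - 1) div m" by (rule order_trans[OF card_image_le]) auto
  finally have "card {z\<in>{1..<p}. m dvd z} * m \<le> (p - 1) div m * m" by simp
  also have "\<dots> \<le> p - 1" by simp
  finally show ?thesis .
qed

text \<open>If \<open>x\<close> and \<open>y\<close> collide, the residues of \<open>a * x\<close>
  and \<open>a * y\<close> differ by a multiple of \<open>m\<close>. Depending on the sign of the
  difference, \<open>a * (x - y)\<close> modulo \<open>p\<close> is a multiple of \<open>m\<close>
  or lies a multiple of \<open>m\<close> below \<open>p\<close>. This residue determines
  \<open>a\<close>, so each of the two cases accounts for at most (p - 1) / m multipliers.\<close>

lemma collision_count:
  fixes p m x y :: nat
  assumes p: "prime p" and xy: "x < p" "y < p" "x \<noteq> y" and m: "m \<ge> 1"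
  shows "card {a\<in>{1..<p}. hash p m a x = hash p m a y} * m \<le> 2 * (p - 1)"
proof -
  let ?A = "{a\<in>{1..<p}. hash p m a x = hash p m a y}"
  let ?Z = "{z\<in>{1..<p}. m dvd z}"
  let ?Z' = "{z\<in>{1..<p}. m dvd p - z}"
  define f where "f a = nat ((int a * (int x - int y)) mod int p)" for a
  have p0: "p \<ge> 1" using p prime_ge_1_nat by blast
  have ndvd: "\<not> int p dvd int x - int y"
  proof
    assume "int p dvd int x - int y"
    then have "int p \<le> \<bar>int x - int y\<bar>" using xy by (intro zdvd_imp_le) (auto simp: dvd_abs_iff)
    then show False using xy by linarith
  qed
  have pp: "prime (int p)" using p by simp
  have inj: "inj_on f {1..<p}"
  proof
    fix a b assume ab: "a \<in> {1..<p}" "b \<in> {1..<p}" "f a = f b"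
    then have "(int a * (int x - int y)) mod int p = (int b * (int x - int y)) mod int p"
      using p0 by (simp add: f_def nat_eq_iff)
    then have "int p dvd (int a - int b) * (int x - int y)"
      by (simp add: mod_eq_dvd_iff left_diff_distrib)
    then have d: "int p dvd int a - int b" using ndvd pp by (simp add: prime_dvd_mult_iff)
    show "a = b"
    proof (rule ccontr)
      assume "a \<noteq> b"
      then have "int p \<le> \<bar>int a - int b\<bar>" using d by (intro zdvd_imp_le) (auto simp: dvd_abs_iff)
      then show False using ab by auto
    qed
  qed
  have img: "f ` ?A \<subseteq> ?Z \<union> ?Z'"
  proof
    fix z assume "z \<in> f ` ?A"
    then obtain a where a: "1 \<le> a" "a < p" "hash p m a x = hash p m a y" "z = f a" by auto
    define u where "u = a * x mod p"
    define v where "v = a * y mod p"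
    have uv: "u mod m = v mod m" "u < p" "v < p" using a p0 by (auto simp: hash_def u_def v_def)
    have z: "int z = (int u - int v) mod int p"
      using p0 by (simp add: a f_def u_def v_def zmod_int mod_diff_eq right_diff_distrib)
    have "\<not> int p dvd int a"
      using a by (auto dest: zdvd_imp_le)
    then have "z \<noteq> 0" using ndvd pp p0 unfolding a f_def
      by (simp add: nat_eq_iff prime_dvd_mult_iff mod_eq_0_iff_dvd)
    moreover have "z < p" using z p0 by (smt (verit) pos_mod_bound of_nat_0_less_iff of_nat_less_iff less_le_trans zero_less_one)
    moreover have "m dvd z \<or> m dvd p - z"
    proof (cases "v \<le> u")
      case True
      then have "int z = int u - int v" using z uv by simp
      then have "z = u - v" by linarith
      then show ?thesis using uv True by (simp add: mod_eq_dvd_iff_nat)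
    next
      case False
      have "int z = (int u - int v + int p) mod int p" using z by simp
      also have "\<dots> = int u - int v + int p" using False uv by (intro mod_pos_pos_trivial) auto
      finally have "p - z = v - u" using False uv by linarith
      then show ?thesis using uv False mod_eq_dvd_iff_nat[of u v m] by simp
    qed
    ultimately show "z \<in> ?Z \<union> ?Z'" by auto
  qed
  have Z': "card ?Z' \<le> card ?Z"
  proof (rule card_inj_on_le[where f = "\<lambda>z. p - z"])
    show "inj_on (\<lambda>z. p - z) ?Z'" by (auto simp: inj_on_def)
    show "(\<lambda>z. p - z) ` ?Z' \<subseteq> ?Z" by auto
  qed simp
  have "card ?A = card (f ` ?A)"
    by (rule card_image[symmetric]) (rule inj_on_subset[OF inj], auto)
  also have "\<dots> \<le> card (?Z \<union> ?Z')" by (intro card_mono img) auto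
  also have "\<dots> \<le> card ?Z + card ?Z'" by (rule card_Un_le)
  finally have "card ?A * m \<le> (2 * card ?Z) * m" using Z' by (intro mult_right_mono) auto
  also have "\<dots> \<le> 2 * (p - 1)" using card_multiples[OF m p0] by simp
  finally show ?thesis .
qed

definition collisions :: "nat \<Rightarrow> nat \<Rightarrow> nat \<Rightarrow> nat set \<Rightarrow> (nat \<times> nat) set" where
  "collisions p m a X = {(x, y). x \<in> X \<and> y \<in> X \<and> x \<noteq> y \<and> hash p m a x = hash p m a y}"

text \<open>Averaging: the collisions of all multipliers together are counted pair by pair with
  \<open>collision_count\<close>, and they are too few for every multiplier to exceed the bound.
  Pairs are ordered.\<close>

lemma few_collisions:
  fixes p m :: nat
  assumes p: "prime p" and X: "X \<subseteq> {..<p}" and m: "m \<ge> 1"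
  shows "\<exists>a<p. card (collisions p m a X) * m \<le> 2 * (card X * (card X - 1))"
proof (rule ccontr)
  assume "\<not> ?thesis"
  then have gt: "card (collisions p m a X) * m > 2 * (card X * (card X - 1))" if "a < p" for a
    using that by auto
  have fin: "finite X" using X finite_subset by blast
  have p1: "p > 1" using p prime_gt_1_nat by blast
  define Q where "Q = {(x, y). x \<in> X \<and> y \<in> X \<and> x \<noteq> y}"
  have Q: "Q = X \<times> X - (\<lambda>x. (x, x)) ` X" by (auto simp: Q_def)
  have finQ: "finite Q" unfolding Q using fin by simp
  have "card ((\<lambda>x. (x, x)) ` X) = card X" by (rule card_image) (auto simp: inj_on_def)
  then have "card Q = card X * card X - card X" unfolding Q
    using fin by (subst card_Diff_subset) (auto simp: card_cartesian_product)
  then have cQ: "card Q = card X * (card X - 1)" by (simp add: diff_mult_distrib2)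
  have coll: "card (collisions p m a X) = (\<Sum>q\<in>Q. if hash p m a (fst q) = hash p m a (snd q) then 1 else 0)" for a
  proof -
    have "collisions p m a X = {q\<in>Q. hash p m a (fst q) = hash p m a (snd q)}"
      by (auto simp: collisions_def Q_def)
    then show ?thesis using finQ by (simp add: sum.inter_filter[symmetric])
  qed
  have "(p - 1) * (2 * card Q) < (\<Sum>a\<in>{1..<p}. card (collisions p m a X) * m)"
  proof -
    have "(\<Sum>a\<in>{1..<p}. 2 * card Q) < (\<Sum>a\<in>{1..<p}. card (collisions p m a X) * m)"
      using p1 gt cQ by (intro sum_strict_mono) auto
    then show ?thesis by simp
  qed
  also have "\<dots> = (\<Sum>q\<in>Q. card {a\<in>{1..<p}. hash p m a (fst q) = hash p m a (snd q)} * m)"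
  proof -
    have "(\<Sum>a\<in>{1..<p}. card (collisions p m a X)) =
        (\<Sum>q\<in>Q. \<Sum>a\<in>{1..<p}. if hash p m a (fst q) = hash p m a (snd q) then 1 else 0)"
      unfolding coll by (rule sum.swap)
    also have "\<dots> = (\<Sum>q\<in>Q. card {a\<in>{1..<p}. hash p m a (fst q) = hash p m a (snd q)})"
      by (simp add: sum.inter_filter[symmetric])
    finally show ?thesis by (simp add: sum_distrib_right[symmetric])
  qed
  also have "\<dots> \<le> (\<Sum>q\<in>Q. 2 * (p - 1))"
    using X by (intro sum_mono collision_count p m) (auto simp: Q_def)
  finally show False by (simp add: mult.commute mult.left_commute)
qed

text \<open>In a table of this quadratic size the bound on the number of collisions falls below
  one.\<close>

lemma perfect_hash:
  fixes p m :: nat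
  assumes p: "prime p" and X: "X \<subseteq> {..<p}" and m: "m > 2 * (card X * card X)"
  shows "\<exists>a<p. inj_on (hash p m a) X"
proof -
  obtain a where a: "a < p" "card (collisions p m a X) * m \<le> 2 * (card X * (card X - 1))"
    using few_collisions[OF p X, of m] m by auto
  have "2 * (card X * (card X - 1)) \<le> 2 * (card X * card X)" by simp
  then have "card (collisions p m a X) * m < m" using a m by linarith
  then have "card (collisions p m a X) = 0" by simp
  moreover have "finite (collisions p m a X)"
    by (rule finite_subset[of _ "X \<times> X"]) (use X finite_subset in \<open>auto simp: collisions_def\<close>)
  ultimately have "collisions p m a X = {}" by simp
  then have "inj_on (hash p m a) X" by (auto simp: collisions_def inj_on_def)
  then show ?thesis using a by blast
qed

text \<open>The two-level scheme of Fredman, Komlos and Szemeredi: a first hash function distributes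
  the keys over \<open>card X\<close> buckets, and each bucket has its own collision-free function
  into a table of quadratic size. \<open>as\<close>, \<open>ms\<close> and \<open>bs\<close> hold
  the multiplier, size and offset of each bucket. Keys outside \<open>X\<close> are included because
  their look-up has to stay in range and fail.\<close>

lemma static_dictionary:
  fixes p :: nat
  assumes p: "prime p" and X: "X \<subseteq> {0<..<p}" and X0: "X \<noteq> {}"
  shows "\<exists>a as ms bs ks. a < p \<and> length as = card X \<and> length ms = card X \<and> length bs = card X \<and>
     length ks \<le> 7 * card X \<and> set as \<subseteq> {..<p} \<and> set ms \<subseteq> {..7 * card X} \<and> set bs \<subseteq> {..7 * card X} \<and>
     set ks \<subseteq> insert 0 X \<and>
     (\<forall>x\<in>{0<..<p}. let h = hash p (card X) a x; t = bs ! h + hash p (ms ! h) (as ! h) x in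
        h < card X \<and> t < length ks \<and> (ks ! t = x \<longleftrightarrow> x \<in> X))"
proof -
  define r where "r = card X"
  have fin: "finite X" using X finite_subset by blast
  have r: "r \<ge> 1" using X0 fin by (simp add: r_def Suc_leI card_gt_0_iff)
  have Xp: "X \<subseteq> {..<p}" using X by auto
  obtain a where a: "a < p" "card (collisions p r a X) * r \<le> 2 * (r * (r - 1))"
    using few_collisions[OF p Xp r] r_def by auto
  then have "r * card (collisions p r a X) \<le> r * (2 * (r - 1))" by (simp add: mult_ac)
  then have coll: "card (collisions p r a X) \<le> 2 * (r - 1)" using r by simp
  define bkt where "bkt h = {x\<in>X. hash p r a x = h}" for h
  \<comment> \<open>This is the least size that \<open>perfect_hash\<close> admits. It also gives an
    empty bucket one cell, so that the look-up of an absent key finds something to read.\<close>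
  define m where "m h = 2 * (card (bkt h) * card (bkt h)) + 1" for h
  have "\<exists>b<p. inj_on (hash p (m h) b) (bkt h)" for h
    by (rule perfect_hash[OF p]) (use Xp in \<open>auto simp: bkt_def m_def\<close>)
  then obtain b where b: "\<And>h. b h < p" "\<And>h. inj_on (hash p (m h) (b h)) (bkt h)" by metis
  have finb: "finite (bkt h)" for h using fin by (simp add: bkt_def)
  have hash_less: "hash p k c x < k" if "k \<ge> 1" for k c x using that by (simp add: hash_def)
  \<comment> \<open>The squares count the ordered pairs within buckets: the collisions, at most
    \<open>2 * (r - 1)\<close>, and the \<open>r\<close> diagonal pairs. Hence the total size
    \<open>2 * (3 * r) + r = 7 * r\<close>.\<close>
  have sq: "(\<Sum>h<r. card (bkt h) * card (bkt h)) \<le> 3 * r"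
  proof -
    have "(\<Sum>h<r. card (bkt h) * card (bkt h)) = card (\<Union>h\<in>{..<r}. bkt h \<times> bkt h)"
      using finb by (subst card_UN_disjoint) (auto simp: card_cartesian_product bkt_def)
    also have "\<dots> \<le> card (collisions p r a X \<union> (\<lambda>x. (x, x)) ` X)"
    proof (rule card_mono)
      show "finite (collisions p r a X \<union> (\<lambda>x. (x, x)) ` X)"
        using fin by (auto intro: finite_subset[of _ "X \<times> X"] simp: collisions_def)
    qed (auto simp: bkt_def collisions_def)
    also have "\<dots> \<le> 2 * (r - 1) + r"
      using coll card_image_le[OF fin, of "\<lambda>x. (x, x)"] unfolding r_def
      by (intro order_trans[OF card_Un_le]) linarith
    finally show ?thesis by linarith
  qed
  \<comment> \<open>Free cells contain 0, which matches no look-up because keys are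
    positive.\<close>
  define B where "B h = map (\<lambda>t. if \<exists>x\<in>bkt h. hash p (m h) (b h) x = t
      then THE x. x \<in> bkt h \<and> hash p (m h) (b h) x = t else 0) [0..<m h]" for h
  have Bval: "B h ! hash p (m h) (b h) x = x" if "x \<in> bkt h" for h x
  proof -
    have "hash p (m h) (b h) x < m h" by (rule hash_less) (simp add: m_def)
    moreover have "(THE x'. x' \<in> bkt h \<and> hash p (m h) (b h) x' = hash p (m h) (b h) x) = x"
      using that b(2)[of h] by (intro the_equality) (auto simp: inj_on_def)
    ultimately show ?thesis using that by (auto simp: B_def)
  qed
  have Bin: "set (B h) \<subseteq> insert 0 (bkt h)" for h
  proof
    fix z assume "z \<in> set (B h)"
    then obtain t where t: "t < m h" "z = (if \<exists>x\<in>bkt h. hash p (m h) (b h) x = t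
      then THE x. x \<in> bkt h \<and> hash p (m h) (b h) x = t else 0)"
      unfolding B_def set_map set_upt by (auto simp only: image_iff atLeastLessThan_iff)
    show "z \<in> insert 0 (bkt h)"
    proof (cases "\<exists>x\<in>bkt h. hash p (m h) (b h) x = t")
      case True
      then obtain x where x: "x \<in> bkt h" "hash p (m h) (b h) x = t" by auto
      then have "B h ! t = x" using Bval by blast
      then have "z = x" using t True by (simp add: B_def)
      then show ?thesis using x by simp
    qed (use t in auto)
  qed
  have lenB: "length (B h) = m h" for h by (simp add: B_def)
  obtain ks off where ks: "length ks = (\<Sum>h<r. length (B h))" "set ks = (\<Union>h<r. set (B h))"
    "\<And>h. h \<in> {..<r} \<Longrightarrow> off h + length (B h) \<le> length ks"
    "\<And>h e. h \<in> {..<r} \<Longrightarrow> e < length (B h) \<Longrightarrow> ks ! (off h + e) = B h ! e"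
    by (rule layout[of "{..<r}" B]) auto
  have lenks: "length ks \<le> 7 * r"
    using sq by (simp add: ks(1) lenB m_def sum_Suc sum_distrib_left[symmetric])
  have mle: "m h \<le> 7 * r" "off h \<le> 7 * r" if "h < r" for h using ks(3)[of h] that lenks lenB by auto
  have main: "h < r \<and> t < length ks \<and> (ks ! t = x \<longleftrightarrow> x \<in> X)"
    if x: "x \<in> {0<..<p}" and h: "h = hash p r a x" and t: "t = off h + hash p (m h) (b h) x" for x h t
  proof -
    have hr: "h < r" using h hash_less r by blast
    have e: "hash p (m h) (b h) x < length (B h)" unfolding lenB by (rule hash_less) (simp add: m_def)
    have "ks ! t = B h ! hash p (m h) (b h) x" using ks(4)[of h, OF _ e] hr t by simp
    moreover have "B h ! hash p (m h) (b h) x \<in> insert 0 (bkt h)" using Bin nth_mem[OF e] by blast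
    moreover have "x \<in> X \<Longrightarrow> x \<in> bkt h" using h by (simp add: bkt_def)
    moreover have "x \<in> bkt h \<Longrightarrow> x \<in> X" by (simp add: bkt_def)
    ultimately have "ks ! t = x \<longleftrightarrow> x \<in> X" using Bval x by fastforce
    then show ?thesis using hr t e ks(3)[of h] by simp
  qed
  show ?thesis
  proof (intro exI conjI)
    show "a < p" by fact
    show "length (map b [0..<r]) = card X" "length (map m [0..<r]) = card X"
      "length (map off [0..<r]) = card X" by (simp_all add: r_def)
    show "length ks \<le> 7 * card X" using lenks r_def by simp
    show "set (map b [0..<r]) \<subseteq> {..<p}" using b by auto
    show "set (map m [0..<r]) \<subseteq> {..7 * card X}" "set (map off [0..<r]) \<subseteq> {..7 * card X}"
      using mle r_def by auto
    show "set ks \<subseteq> insert 0 X" using ks(2) Bin by (fastforce simp: bkt_def)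
    show "\<forall>x\<in>{0<..<p}. let h = hash p (card X) a x;
           t = map off [0..<r] ! h + hash p (map m [0..<r] ! h) (map b [0..<r] ! h) x in
        h < card X \<and> t < length ks \<and> (ks ! t = x \<longleftrightarrow> x \<in> X)"
      using main hash_less r unfolding Let_def r_def[symmetric] by simp
  qed
qed

section \<open>Level ancestors of words\<close>

lemma sorted_list_of_set_image_strict_mono:
  fixes f :: "'a::linorder \<Rightarrow> 'b::linorder"
  assumes "finite A" "strict_mono_on A f"
  shows "sorted_list_of_set (f ` A) = map f (sorted_list_of_set A)"
proof -
  have "sorted_wrt (<) (map f (sorted_list_of_set A))"
    unfolding sorted_wrt_map
    by (rule sorted_wrt_mono_rel[OF _ strict_sorted_list_of_set[of A]])
      (use assms in \<open>auto simp: strict_mono_on_def\<close>)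
  then show ?thesis
    using assms(1) by (metis image_set list.set_map set_sorted_list_of_set strict_sorted_equal
        strict_sorted_list_of_set finite_imageI)
qed

text \<open>The contract between the trie and the query program, which includes that no read leaves
  its table. The first branch climbs by a jump pointer and a ladder, the second selects inside a
  micro tree. The entries of \<open>jmp\<close> are ladder addresses shifted by a depth, so that
  subtracting the depth \<open>l\<close> sought gives the cell.\<close>

definition ancestor_tables where
  "ancestor_tables V idx md (s::nat) jb ld mb mk lad jmp lg mic sel \<longleftrightarrow> (\<forall>v\<in>V. \<forall>l\<le>length v.
        (if l < md v
         then l \<le> ld v \<and> ld v - l < length lg \<and> jb v + lg ! (ld v - l) < length jmp \<and>
           l \<le> jmp ! (jb v + lg ! (ld v - l)) \<and> jmp ! (jb v + lg ! (ld v - l)) - l < length lad \<and>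
           lad ! (jmp ! (jb v + lg ! (ld v - l)) - l) = idx (take l v)
         else mk v * s + (l - md v) < length sel \<and> mb v + sel ! (mk v * s + (l - md v)) < length mic \<and>
           mic ! (mb v + sel ! (mk v * s + (l - md v))) = idx (take l v)))"

text \<open>A trie as a prefix-closed set of words: \<open>take l v\<close> is the ancestor of
  \<open>v\<close> at depth \<open>l\<close>, and \<open>idx\<close> numbers the nodes.\<close>

locale prefix_tree =
  fixes V :: "'a list set" and idx :: "'a list \<Rightarrow> nat" and m :: nat
  assumes idx: "bij_betw idx V {..<m}"
    and take_closed: "v \<in> V \<Longrightarrow> take l v \<in> V"
    and nonempty: "V \<noteq> {}"
begin

lemma fin: "finite V" using idx bij_betw_finite by blast
lemma m: "m = card V" using bij_betw_same_card[OF idx] by simp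
lemma idx_less: "v \<in> V \<Longrightarrow> idx v < m" using idx by (auto simp: bij_betw_def)
lemma idx_inj: "inj_on idx V" using idx by (auto simp: bij_betw_def)
lemma m_pos: "m \<ge> 1" using nonempty fin by (simp add: m Suc_leI card_gt_0_iff)

text \<open>The subtree rooted at \<open>u\<close>.\<close>

definition ext :: "'a list \<Rightarrow> 'a list set" where
  "ext u = {w \<in> V. take (length u) w = u}"

lemma finite_ext: "finite (ext u)" using fin by (simp add: ext_def)
lemma ext_subset: "ext u \<subseteq> V" by (auto simp: ext_def)
lemma ext_self: "u \<in> V \<Longrightarrow> u \<in> ext u" by (simp add: ext_def)
lemma ext_length: "w \<in> ext u \<Longrightarrow> length u \<le> length w" by (auto simp: ext_def) (metis length_take min.cobounded1)
lemma ext_take: "w \<in> ext u \<Longrightarrow> l \<le> length u \<Longrightarrow> take l w = take l u"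
  by (auto simp: ext_def) (metis min.absorb1 take_take)
lemma in_ext_take: "v \<in> V \<Longrightarrow> v \<in> ext (take l v)" by (auto simp: ext_def min_def)
lemma ext_mono: "w \<in> ext u \<Longrightarrow> ext w \<subseteq> ext u"
proof
  fix x assume w: "w \<in> ext u" and x: "x \<in> ext w"
  have "take (length u) x = take (length u) w" using ext_take[OF x] ext_length[OF w] by simp
  then show "x \<in> ext u" using w x by (simp add: ext_def)
qed

lemma length_less: assumes "v \<in> V" shows "length v < m"
proof -
  have "inj_on (\<lambda>l. take l v) {..length v}" by (auto simp: inj_on_def) (metis length_take min.absorb2)
  then have "card ((\<lambda>l. take l v) ` {..length v}) = length v + 1" by (simp add: card_image)
  moreover have "card ((\<lambda>l. take l v) ` {..length v}) \<le> card V"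
    using assms take_closed fin by (intro card_mono) auto
  ultimately show ?thesis by (simp add: m)
qed

text \<open>Among the longest extensions one is singled out, so that the words with the same deepest
  extension form a path; these are the long paths of the ladder decomposition.\<close>

definition rank :: "'a list \<Rightarrow> nat" where "rank w = length w * m + idx w"

definition deepest :: "'a list \<Rightarrow> 'a list" where
  "deepest u = inv_into V rank (Max (rank ` ext u))"

lemma rank_inj: "inj_on rank V"
proof
  fix x y assume xy: "x \<in> V" "y \<in> V" "rank x = rank y"
  have "rank w mod m = idx w" if "w \<in> V" for w using idx_less[OF that] by (simp add: rank_def)
  then show "x = y" using xy idx_inj by (metis inj_onD)
qed

lemma deepest:
  assumes "u \<in> V"
  shows "deepest u \<in> ext u" "\<And>w. w \<in> ext u \<Longrightarrow> rank w \<le> rank (deepest u)"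
proof -
  have "Max (rank ` ext u) \<in> rank ` ext u"
    using ext_self[OF assms] finite_ext by (intro Max_in) auto
  then obtain w where w: "w \<in> ext u" "Max (rank ` ext u) = rank w" by auto
  moreover have "w \<in> V" using w ext_subset by blast
  ultimately have "deepest u = w" using rank_inj by (simp only: deepest_def w inv_into_f_f)
  then show "deepest u \<in> ext u" "\<And>w. w \<in> ext u \<Longrightarrow> rank w \<le> rank (deepest u)"
    using w finite_ext by (auto simp: w(2)[symmetric])
qed

lemma deepest_longest: assumes "u \<in> V" "w \<in> ext u" shows "length w \<le> length (deepest u)"
proof (rule ccontr)
  assume "\<not> ?thesis"
  then have "Suc (length (deepest u)) * m \<le> length w * m" by (intro mult_right_mono) auto
  moreover have "idx (deepest u) < m" using deepest(1)[OF assms(1)] ext_subset idx_less by blast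
  ultimately have "rank (deepest u) < rank w" by (simp add: rank_def)
  then show False using deepest(2)[OF assms] by simp
qed

text \<open>Moving down from \<open>u\<close> towards its deepest extension shrinks the subtree but
  keeps that extension inside, where it remains maximal.\<close>

lemma deepest_path:
  assumes "u \<in> V" "length u \<le> l"
  shows "deepest (take l (deepest u)) = deepest u"
proof -
  let ?w = "deepest u" let ?u = "take l ?w"
  have w: "?w \<in> ext u" using deepest(1)[OF assms(1)] .
  then have wV: "?w \<in> V" and uV: "?u \<in> V" using ext_subset take_closed by blast+
  have "?u \<in> ext u" using w assms(2) uV by (auto simp: ext_def min_def)
  then have "rank (deepest ?u) \<le> rank ?w"
    using deepest(1)[OF uV] ext_mono deepest(2)[OF assms(1)] by blast
  moreover have "rank ?w \<le> rank (deepest ?u)"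
    using deepest(2)[OF uV] in_ext_take[OF wV] by blast
  moreover have "deepest ?u \<in> V" using deepest(1)[OF uV] ext_subset by blast
  ultimately show ?thesis using rank_inj wV by (metis inj_onD le_antisym)
qed

text \<open>A long path of h nodes is prolonged upwards to 2 * h nodes. If \<open>w\<close> extends
  \<open>u\<close>, the path of \<open>u\<close> has more than \<open>length w - length u\<close>
  nodes, so its ladder reaches at least as far above \<open>u\<close> as \<open>w\<close> lies
  below; this is the condition \<open>2 * length u \<le> l + length w\<close>. The long paths
  partition \<open>V\<close>, whence the size \<open>2 * m\<close>.\<close>

lemma ladders:
  "\<exists>lad qd. length lad = 2 * m \<and> set lad \<subseteq> {..<m} \<and> (\<forall>u\<in>V. qd u \<le> 3 * m \<and>
     (\<forall>w\<in>ext u. \<forall>l\<le>length u. 2 * length u \<le> l + length w \<longrightarrow>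
        l \<le> qd u \<and> qd u - l < length lad \<and> lad ! (qd u - l) = idx (take l u)))"
proof -
  define path where "path w = {u\<in>V. deepest u = w}" for w
  have finp: "finite (path w)" for w using fin by (simp add: path_def)
  \<comment> \<open>Truncated subtraction repeats the empty word once a ladder has passed the root,
    so that every ladder has exactly twice the size of its path.\<close>
  define B where "B w = map (\<lambda>e. idx (take (length w - e) w)) [0..<2 * card (path w)]" for w
  obtain lad off where lad: "length lad = (\<Sum>w\<in>deepest ` V. length (B w))"
     "set lad = (\<Union>w\<in>deepest ` V. set (B w))"
     "\<And>w. w \<in> deepest ` V \<Longrightarrow> off w + length (B w) \<le> length lad"
     "\<And>w e. w \<in> deepest ` V \<Longrightarrow> e < length (B w) \<Longrightarrow> lad ! (off w + e) = B w ! e"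
    by (rule layout[of "deepest ` V" B]) (use fin in auto)
  have "(\<Sum>w\<in>deepest ` V. card (path w)) = card (\<Union>w\<in>deepest ` V. path w)"
    using fin finp by (intro card_UN_disjoint[symmetric]) (auto simp: path_def)
  also have "(\<Union>w\<in>deepest ` V. path w) = V" by (auto simp: path_def)
  finally have len: "length lad = 2 * m"
    using lad(1) by (simp add: B_def m sum_distrib_left[symmetric])
  have dV: "deepest u \<in> V" if "u \<in> V" for u using deepest(1)[OF that] ext_subset by blast
  have set: "set lad \<subseteq> {..<m}" using lad(2) dV idx_less take_closed by (auto simp: B_def)
  define qd where "qd u = off (deepest u) + length (deepest u)" for u
  have main: "l \<le> qd u \<and> qd u - l < length lad \<and> lad ! (qd u - l) = idx (take l u)"
    if u: "u \<in> V" and w: "w \<in> ext u" and l: "l \<le> length u" "2 * length u \<le> l + length w" for u w l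
  proof -
    let ?d = "deepest u"
    have d: "?d \<in> ext u" using deepest(1)[OF u] .
    have wd: "length w \<le> length ?d" using deepest_longest[OF u w] .
    have ud: "length u \<le> length ?d" using ext_length[OF d] .
    have inj: "inj_on (\<lambda>l. take l ?d) {length u..length ?d}"
      by (auto simp: inj_on_def) (metis length_take min.absorb2)
    have "(\<lambda>l. take l ?d) ` {length u..length ?d} \<subseteq> path ?d"
      using deepest_path[OF u] take_closed dV[OF u] by (auto simp: path_def)
    then have "card ((\<lambda>l. take l ?d) ` {length u..length ?d}) \<le> card (path ?d)"
      by (intro card_mono finp)
    then have cnt: "length ?d - length u + 1 \<le> card (path ?d)"
      using card_image[OF inj] ud by simp
    have e: "length ?d - l < length (B ?d)" using cnt l wd ud by (simp add: B_def)
    have q: "qd u - l = off ?d + (length ?d - l)" using l ud by (simp add: qd_def)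
    have "lad ! (qd u - l) = B ?d ! (length ?d - l)" unfolding q using lad(4)[OF _ e] u by simp
    also have "\<dots> = idx (take l ?d)" using e l ud by (simp add: B_def)
    also have "take l ?d = take l u" using ext_take[OF d] l by simp
    finally show ?thesis using q e lad(3)[of ?d] u l ud by (simp add: qd_def)
  qed
  have "qd u \<le> 3 * m" if u: "u \<in> V" for u
    using lad(3)[of "deepest u"] len u length_less[OF dV[OF u]] by (simp add: qd_def)
  then show ?thesis using len set main by blast
qed

end

section \<open>Micro trees and tabulated selection\<close>

text \<open>A word is micro if it has at most \<open>s\<close> extensions. \<open>md v\<close> is the length of the shortest
  micro prefix of \<open>v\<close>, or \<open>length v + 1\<close> if there is none.\<close>

locale micro_macro = prefix_tree V idx m for V :: "'a list set" and idx m +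
  fixes s :: nat
  assumes s: "s \<ge> 1" "m < 4 ^ s"
begin

definition md :: "'a list \<Rightarrow> nat" where
  "md v = (LEAST d. d > length v \<or> card (ext (take d v)) \<le> s)"

lemma md_le: "md v \<le> length v + 1" unfolding md_def by (rule Least_le) simp
lemma md_micro: assumes "md v \<le> length v" shows "card (ext (take (md v) v)) \<le> s"
proof -
  have "md v > length v \<or> card (ext (take (md v) v)) \<le> s"
    unfolding md_def by (rule LeastI[of _ "length v + 1"]) simp
  then show ?thesis using assms by simp
qed
lemma md_macro: "d < md v \<Longrightarrow> card (ext (take d v)) > s"
  using not_less_Least[of d "\<lambda>d. d > length v \<or> card (ext (take d v)) \<le> s"] by (simp add: md_def)
lemma mdI: "d \<le> length v \<Longrightarrow> card (ext (take d v)) \<le> s \<Longrightarrow> (\<And>d'. d' < d \<Longrightarrow> card (ext (take d' v)) > s) \<Longrightarrow> md v = d"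
  unfolding md_def by (rule Least_equality) (auto simp: not_less[symmetric])

text \<open>The roots of the maximal micro subtrees.\<close>

definition roots :: "'a list set" where
  "roots = {u\<in>V. md u = length u}"

text \<open>The words below \<open>u\<close> share its prefixes, and the first micro one among these
  is \<open>u\<close>. Two micro trees with a common word therefore have the same root.\<close>

lemma md_ext: assumes "u \<in> roots" "v \<in> ext u" shows "md v = length u"
proof (rule mdI)
  show "length u \<le> length v" using ext_length[OF assms(2)] .
  have u: "take (length u) v = u" using assms(2) by (simp add: ext_def)
  show "card (ext (take (length u) v)) \<le> s" unfolding u
    using md_micro[of u] assms(1) by (simp add: roots_def)
  show "card (ext (take d v)) > s" if "d < length u" for d
    using md_macro[of d u] that assms(1) ext_take[OF assms(2), of d] by (simp add: roots_def)
qed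

lemma take_md_root: assumes "v \<in> V" "md v \<le> length v" shows "take (md v) v \<in> roots"
proof -
  have "md (take (md v) v) = md v"
  proof (rule mdI)
    show "card (ext (take (md v) (take (md v) v))) \<le> s" using md_micro[OF assms(2)] by simp
    show "card (ext (take d (take (md v) v))) > s" if "d < md v" for d
      using md_macro[OF that] that by (simp add: min_def)
  qed (use assms in simp)
  then show ?thesis using assms take_closed by (simp add: roots_def)
qed

text \<open>In a micro tree, listed by increasing length, the prefixes of \<open>v\<close> form a set of positions
  whose \<open>r\<close>-th smallest element is the prefix of length \<open>md v + r\<close>. A micro tree has at most \<open>s\<close>
  words, so that the set is one of \<open>2 ^ s\<close> and selection in it can be tabulated.\<close>

lemma micro_tables:
  "\<exists>mic mb mk sel. length mic \<le> m \<and> set mic \<subseteq> {..<m} \<and> length sel = 2 ^ s * s \<and> set sel \<subseteq> {..<s} \<and>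
     (\<forall>v\<in>V. mb v \<le> m \<and> mk v < 2 ^ s \<and> (\<forall>l. md v \<le> l \<and> l \<le> length v \<longrightarrow>
        mk v * s + (l - md v) < length sel \<and> mb v + sel ! (mk v * s + (l - md v)) < length mic \<and>
        mic ! (mb v + sel ! (mk v * s + (l - md v))) = idx (take l v)))"
proof -
  define L where "L u = sort_key length (SOME xs. set xs = ext u \<and> distinct xs)" for u
  have "\<exists>xs. set xs = ext u \<and> distinct xs" for u using finite_ext finite_distinct_list by blast
  then have "set (SOME xs. set xs = ext u \<and> distinct xs) = ext u \<and>
      distinct (SOME xs. set xs = ext u \<and> distinct xs)" for u by (rule someI_ex)
  then have L: "set (L u) = ext u" "distinct (L u)" "sorted (map length (L u))" for u
    by (auto simp: L_def)
  have lenL: "length (L u) = card (ext u)" for u using L distinct_card by metis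
  define B where "B u = map idx (L u)" for u
  have finr: "finite roots" using fin by (simp add: roots_def)
  obtain mic off where mic: "length mic = (\<Sum>u\<in>roots. length (B u))"
     "set mic = (\<Union>u\<in>roots. set (B u))"
     "\<And>u. u \<in> roots \<Longrightarrow> off u + length (B u) \<le> length mic"
     "\<And>u e. u \<in> roots \<Longrightarrow> e < length (B u) \<Longrightarrow> mic ! (off u + e) = B u ! e"
    by (rule layout[OF finr, of B]) (rule that)
  have disj: "ext u \<inter> ext u' = {}" if "u \<in> roots" "u' \<in> roots" "u \<noteq> u'" for u u'
  proof (rule ccontr)
    assume "\<not> ?thesis"
    then obtain v where v: "v \<in> ext u" "v \<in> ext u'" by blast
    then have "length u = length u'" using md_ext that by metis
    then show False using v that by (auto simp: ext_def)
  qed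
  have "length mic = (\<Sum>u\<in>roots. card (ext u))" using mic(1) by (simp add: B_def lenL)
  also have "\<dots> = card (\<Union>u\<in>roots. ext u)"
    using finr finite_ext disj by (intro card_UN_disjoint[symmetric]) auto
  also have "\<dots> \<le> m" unfolding m using fin by (intro card_mono) (auto simp: ext_def)
  finally have lenmic: "length mic \<le> m" .
  have setmic: "set mic \<subseteq> {..<m}" using mic(2) idx_less L(1) ext_subset by (fastforce simp: B_def)
  define root where "root v = take (md v) v" for v
  define A where "A v = {t. t < length (L (root v)) \<and> take (length (L (root v) ! t)) v = L (root v) ! t}" for v
  have AP: "A v \<in> Pow {..<s}" if "md v \<le> length v" for v
    using md_micro[OF that] by (auto simp: A_def lenL root_def)
  have Asel: "l - md v < card (A v) \<and> sorted_list_of_set (A v) ! (l - md v) \<in> A v \<and>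
      L (root v) ! (sorted_list_of_set (A v) ! (l - md v)) = take l v"
    if v: "v \<in> V" and l: "md v \<le> l" "l \<le> length v" for v l
  proof -
    let ?f = "\<lambda>t. length (L (root v) ! t)"
    have mdv: "md v \<le> length v" using l by simp
    have lr: "length (root v) = md v" using mdv by (simp add: root_def)
    have finA: "finite (A v)" by (simp add: A_def)
    \<comment> \<open>Prefixes of one word that have equal length coincide, and \<open>L\<close> is
      distinct and sorted by length. So increasing positions list the prefixes of \<open>v\<close>
      by depth.\<close>
    have smono: "strict_mono_on (A v) ?f"
    proof (rule strict_mono_onI)
      fix t t' assume t: "t \<in> A v" "t' \<in> A v" "t < t'"
      have "?f t \<le> ?f t'"
        using L(3)[of "root v"] t by (auto simp: A_def sorted_iff_nth_mono)
      moreover have "?f t \<noteq> ?f t'"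
        using t L(2)[of "root v"] by (auto simp: A_def nth_eq_iff_index_eq)
      ultimately show "?f t < ?f t'" by simp
    qed
    have img: "?f ` A v = {md v..length v}"
    proof (intro equalityI subsetI)
      fix d assume "d \<in> ?f ` A v"
      then obtain t where t: "t \<in> A v" "d = ?f t" by auto
      then have "L (root v) ! t \<in> ext (root v)" using L(1)[of "root v"] nth_mem[of t "L (root v)"] by (simp add: A_def)
      then have "md v \<le> d" using ext_length t lr by metis
      moreover have "take d v = L (root v) ! t" using t by (simp add: A_def)
      then have "d \<le> length v" using t(2) by (metis length_take min.cobounded1)
      ultimately show "d \<in> {md v..length v}" by simp
    next
      fix d assume d: "d \<in> {md v..length v}"
      then have "take d v \<in> ext (root v)"
        using take_closed[OF v] by (auto simp: ext_def root_def min_def)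
      then obtain t where t: "t < length (L (root v))" "L (root v) ! t = take d v"
        using L(1)[of "root v"] by (metis in_set_conv_nth)
      then have "t \<in> A v" "?f t = d" using d by (auto simp: A_def)
      then show "d \<in> ?f ` A v" by blast
    qed
    have eq: "map ?f (sorted_list_of_set (A v)) = [md v..<Suc (length v)]"
      using sorted_list_of_set_image_strict_mono[OF finA smono] unfolding img
      by (metis atLeastLessThanSuc_atLeastAtMost sorted_list_of_set_range)
    then have cA: "card (A v) = Suc (length v) - md v"
      by (metis length_map length_sorted_list_of_set length_upt)
    then have r: "l - md v < card (A v)" using l by linarith
    let ?t = "sorted_list_of_set (A v) ! (l - md v)"
    have "?f ?t = map ?f (sorted_list_of_set (A v)) ! (l - md v)" using r by simp
    also have "\<dots> = l" unfolding eq using l by (simp del: upt_Suc)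
    finally have ft: "?f ?t = l" .
    have tA: "?t \<in> A v" using r finA by (metis length_sorted_list_of_set nth_mem set_sorted_list_of_set)
    then have "L (root v) ! ?t = take l v" using ft by (auto simp: A_def)
    then show ?thesis using r tA by blast
  qed
  \<comment> \<open>An arbitrary numbering of the subsets of \<open>{..<s}\<close> replaces bit
    masks: a query only needs the number of a row of \<open>sel\<close>.\<close>
  have "card (Pow {..<s}) = card {..<(2::nat) ^ s}" by (simp add: card_Pow)
  then obtain enc where enc: "bij_betw enc (Pow {..<s}) {..<(2::nat) ^ s}"
    using finite_same_card_bij by (metis finite_Pow_iff finite_lessThan)
  define dec where "dec = inv_into (Pow {..<s}) enc"
  have dec: "dec (enc X) = X" if "X \<in> Pow {..<s}" for X
    using enc that by (simp add: dec_def bij_betw_def)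
  have decP: "dec i \<in> Pow {..<s}" if "i < 2 ^ s" for i
    using enc that unfolding dec_def bij_betw_def by (metis inv_into_into lessThan_iff)
  \<comment> \<open>One row of \<open>s\<close> cells per subset, one column per rank; 0 fills the
    rest of a row.\<close>
  define sel where "sel = map (\<lambda>i. if i mod s < card (dec (i div s))
     then sorted_list_of_set (dec (i div s)) ! (i mod s) else 0) [0..<2 ^ s * s]"
  have setsel: "set sel \<subseteq> {..<s}"
  proof
    fix x assume "x \<in> set sel"
    then obtain i where i: "i < 2 ^ s * s" "x = (if i mod s < card (dec (i div s))
     then sorted_list_of_set (dec (i div s)) ! (i mod s) else 0)" unfolding sel_def set_map set_upt
      by (auto simp only: image_iff atLeastLessThan_iff)
    have P: "dec (i div s) \<in> Pow {..<s}" using i s by (intro decP) (simp add: less_mult_imp_div_less)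
    then have "finite (dec (i div s))" using finite_subset by auto
    then have "i mod s < card (dec (i div s)) \<Longrightarrow> sorted_list_of_set (dec (i div s)) ! (i mod s) \<in> dec (i div s)"
      by (metis length_sorted_list_of_set nth_mem set_sorted_list_of_set)
    then show "x \<in> {..<s}" using i P s by auto
  qed
  define mb where "mb v = (if md v \<le> length v then off (root v) else 0)" for v
  define mk where "mk v = (if md v \<le> length v then enc (A v) else 0)" for v
  have root: "root v \<in> roots" if "v \<in> V" "md v \<le> length v" for v
    using take_md_root that by (simp add: root_def)
  have mb: "mb v \<le> m" if "v \<in> V" for v
    using mic(3)[OF root[OF that]] lenmic by (auto simp: mb_def)
  have mk: "mk v < 2 ^ s" for v
    using AP[of v] enc by (auto simp: mk_def bij_betw_def)
  have main: "mk v * s + (l - md v) < length sel \<and> mb v + sel ! (mk v * s + (l - md v)) < length mic \<and>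
        mic ! (mb v + sel ! (mk v * s + (l - md v))) = idx (take l v)"
    if v: "v \<in> V" and l: "md v \<le> l" "l \<le> length v" for v l
  proof -
    have mdv: "md v \<le> length v" using l by simp
    define r where "r = l - md v"
    define t where "t = sorted_list_of_set (A v) ! r"
    have S: "r < card (A v)" "t \<in> A v" "L (root v) ! t = take l v"
      using Asel[OF v l] by (auto simp: r_def t_def)
    have "card (A v) \<le> card {..<s}" using AP[OF mdv] by (intro card_mono) auto
    then have rs: "r < s" using S by simp
    have "mk v * s + r < mk v * s + s" using rs by simp
    also have "\<dots> = (mk v + 1) * s" by simp
    also have "\<dots> \<le> 2 ^ s * s" using mk[of v] by (intro mult_right_mono) auto
    finally have i: "mk v * s + r < length sel" by (simp add: sel_def)
    have "(mk v * s + r) div s = mk v" "(mk v * s + r) mod s = r" using rs by auto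
    then have selt: "sel ! (mk v * s + r) = t"
      using i S(1) mdv dec[OF AP[OF mdv]] by (simp add: sel_def mk_def t_def)
    have tl: "t < length (B (root v))" using S(2) by (simp add: A_def B_def)
    have mbv: "mb v = off (root v)" using mdv by (simp add: mb_def)
    have "mb v + t < length mic" using mic(3)[OF root[OF v mdv]] tl mbv by simp
    moreover have "mic ! (mb v + t) = idx (take l v)"
      using mic(4)[OF root[OF v mdv] tl] tl S(3) mbv by (simp add: B_def)
    ultimately show ?thesis using i selt unfolding r_def[symmetric] by simp
  qed
  have "length sel = 2 ^ s * s" by (simp add: sel_def)
  then show ?thesis using lenmic setmic setsel mb mk main by blast
qed

section \<open>Jump pointers at the leaves of the macro tree\<close>

text \<open>The leaves of the tree of words with more than \<open>s\<close> extensions. Only they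
  carry jump pointers.\<close>

definition tips :: "'a list set" where
  "tips = {w\<in>V. card (ext w) > s \<and> (\<forall>x\<in>ext w. x \<noteq> w \<longrightarrow> card (ext x) \<le> s)}"

text \<open>The subtrees of different tips are disjoint and contain more than \<open>s\<close> words
  each. This pays for a number of pointers per tip that is linear in \<open>s\<close>, hence
  logarithmic in the size of the trie.\<close>

lemma card_tips: "card tips * s \<le> m"
proof -
  have fint: "finite tips" using fin by (simp add: tips_def)
  have disj: "ext w \<inter> ext w' = {}" if w: "w \<in> tips" "w' \<in> tips" "w \<noteq> w'" for w w'
  proof (rule ccontr)
    assume "\<not> ?thesis"
    then obtain v where v: "v \<in> ext w" "v \<in> ext w'" by blast
    then have "w = take (length w) v" "w' = take (length w') v" by (simp_all add: ext_def)
    then have "length w \<le> length w' \<Longrightarrow> take (length w) w' = w"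
      "length w' \<le> length w \<Longrightarrow> take (length w') w = w'"
      by (metis min.absorb1 take_take)+
    then have "w' \<in> ext w \<or> w \<in> ext w'"
      using w by (cases "length w \<le> length w'") (auto simp: ext_def tips_def)
    then show False using w by (force simp: tips_def)
  qed
  have "card tips * s = (\<Sum>w\<in>tips. s)" by simp
  also have "\<dots> \<le> (\<Sum>w\<in>tips. card (ext w))" by (rule sum_mono) (auto simp: tips_def)
  also have "\<dots> = card (\<Union>w\<in>tips. ext w)"
    using fint finite_ext disj by (intro card_UN_disjoint[symmetric]) auto
  also have "\<dots> \<le> m" unfolding m using fin by (intro card_mono) (auto simp: ext_def)
  finally show ?thesis .
qed

text \<open>A longest macro extension of the last macro prefix of \<open>v\<close> is a tip. It has
  the same macro prefixes as \<open>v\<close> at the depths below \<open>md v\<close>, so an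
  ancestor of \<open>v\<close> there can be sought from the tip instead.\<close>

lemma tip_exists:
  assumes v: "v \<in> V" and mdv: "md v > 0"
  shows "\<exists>w\<in>tips. md v \<le> length w + 1 \<and> (\<forall>l<md v. take l w = take l v)"
proof -
  define u where "u = take (md v - 1) v"
  have lu: "length u + 1 = md v" using md_le[of v] mdv by (simp add: u_def)
  have uV: "u \<in> V" using take_closed[OF v] by (simp add: u_def)
  define X where "X = {w\<in>ext u. card (ext w) > s}"
  have "u \<in> X" using md_macro[of "md v - 1" v] mdv ext_self[OF uV] by (simp add: X_def u_def)
  moreover have "\<forall>x. x \<in> X \<longrightarrow> length x < m"
    using ext_subset length_less by (auto simp: X_def)
  ultimately obtain w where w: "w \<in> X" "\<And>x. x \<in> X \<Longrightarrow> length x \<le> length w"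
    using arg_max_nat_lemma[of "\<lambda>x. x \<in> X" u length m] by blast
  have wu: "w \<in> ext u" using w by (simp add: X_def)
  have "w \<in> tips"
  proof -
    have "card (ext x) \<le> s" if x: "x \<in> ext w" "x \<noteq> w" for x
    proof (rule ccontr)
      assume "\<not> ?thesis"
      then have "x \<in> X" using x(1) ext_mono[OF wu] by (auto simp: X_def)
      then have "length x \<le> length w" using w by blast
      then show False using x by (auto simp: ext_def)
    qed
    then show ?thesis using w ext_subset by (auto simp: tips_def X_def)
  qed
  moreover have "take l w = take l v" if "l < md v" for l
    proof -
    have "l \<le> md v - 1" "l \<le> length u" using that lu by auto
    then show ?thesis using ext_take[OF wu, of l] by (simp add: u_def)
  qed
  ultimately show ?thesis using ext_length[OF wu] lu by (intro bexI[of _ w]) auto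
qed

text \<open>The number of binary digits of \<open>e\<close>, which is 0 for
  \<open>e = 0\<close>.\<close>

definition bits :: "nat \<Rightarrow> nat" where "bits e = (LEAST t. e < 2 ^ t)"

lemma bits: "e < 2 ^ bits e" unfolding bits_def by (rule LeastI[of _ e]) simp
lemma bits_le: "e < 2 ^ t \<Longrightarrow> bits e \<le> t" unfolding bits_def by (rule Least_le)
lemma bits_ge: "t < bits e \<Longrightarrow> 2 ^ t \<le> e" using not_less_Least[of t "\<lambda>t. e < 2 ^ t"] by (simp add: bits_def)

text \<open>To rise by \<open>e > 0\<close> levels from a tip \<open>w\<close>, jump by the largest
  power of two \<open>d \<le> e\<close>. The word reached has \<open>w\<close> at distance
  \<open>d\<close> below it, so its ladder covers \<open>d\<close> further levels, and only
  \<open>e - d \<le> d\<close> remain.\<close>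

lemma level_ancestor:
  "\<exists>jb ld mb mk lad jmp lg mic sel.
     length lad = 2 * m \<and> set lad \<subseteq> {..<m} \<and>
     length jmp \<le> 3 * m \<and> set jmp \<subseteq> {..3 * m} \<and> length lg = m \<and> set lg \<subseteq> {..2 * s} \<and>
     length mic \<le> m \<and> set mic \<subseteq> {..<m} \<and> length sel = 2 ^ s * s \<and> set sel \<subseteq> {..<s} \<and>
     (\<forall>v\<in>V. jb v \<le> 3 * m \<and> ld v \<le> m \<and> mb v \<le> m \<and> mk v < 2 ^ s) \<and>
     ancestor_tables V idx md s jb ld mb mk lad jmp lg mic sel"
proof -
  obtain lad qd where lad: "length lad = 2 * m" "set lad \<subseteq> {..<m}"
    "\<And>u. u \<in> V \<Longrightarrow> qd u \<le> 3 * m"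
    "\<And>u w l. u \<in> V \<Longrightarrow> w \<in> ext u \<Longrightarrow> l \<le> length u \<Longrightarrow> 2 * length u \<le> l + length w \<Longrightarrow>
        l \<le> qd u \<and> qd u - l < length lad \<and> lad ! (qd u - l) = idx (take l u)"
    using ladders by metis
  obtain mic mb mk sel where mic: "length mic \<le> m" "set mic \<subseteq> {..<m}" "length sel = 2 ^ s * s" "set sel \<subseteq> {..<s}"
     "\<And>v. v \<in> V \<Longrightarrow> mb v \<le> m" "\<And>v. v \<in> V \<Longrightarrow> mk v < 2 ^ s"
     "\<And>v l. v \<in> V \<Longrightarrow> md v \<le> l \<Longrightarrow> l \<le> length v \<Longrightarrow>
        mk v * s + (l - md v) < length sel \<and> mb v + sel ! (mk v * s + (l - md v)) < length mic \<and>
        mic ! (mb v + sel ! (mk v * s + (l - md v))) = idx (take l v)"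
    using micro_tables by metis
  have fint: "finite tips" using fin by (simp add: tips_def)
  have tV: "w \<in> V" if "w \<in> tips" for w using that by (simp add: tips_def)
  \<comment> \<open>Entry 0 is the jump of length 0, for the case that the tip itself is sought.
    Entries up to \<open>2 * s\<close> suffice because depths are below
    \<open>m < 4 ^ s\<close>.\<close>
  define dst :: "nat \<Rightarrow> nat" where "dst t = (if t = 0 then 0 else 2 ^ (t - 1))" for t
  define B where "B w = map (\<lambda>t. qd (take (length w - dst t) w)) [0..<2 * s + 1]" for w
  obtain jmp off where jmp: "length jmp = (\<Sum>w\<in>tips. length (B w))"
     "set jmp = (\<Union>w\<in>tips. set (B w))"
     "\<And>w. w \<in> tips \<Longrightarrow> off w + length (B w) \<le> length jmp"
     "\<And>w e. w \<in> tips \<Longrightarrow> e < length (B w) \<Longrightarrow> jmp ! (off w + e) = B w ! e"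
    by (rule layout[OF fint, of B]) (rule that)
  have "length jmp = card tips * (2 * s + 1)" using jmp(1) by (simp add: B_def)
  also have "\<dots> \<le> card tips * (3 * s)" using s by (intro mult_left_mono) auto
  finally have lenj: "length jmp \<le> 3 * m" using card_tips by linarith
  have setj: "set jmp \<subseteq> {..3 * m}"
    using lad(3) take_closed tV unfolding jmp(2) B_def by auto
  define lg where "lg = map bits [0..<m]"
  have "bits e \<le> 2 * s" if "e < m" for e
    using that s by (intro bits_le) (simp add: power_mult)
  then have setlg: "set lg \<subseteq> {..2 * s}" by (auto simp: lg_def)
  define tip where "tip v = (SOME w. w \<in> tips \<and> md v \<le> length w + 1 \<and> (\<forall>l<md v. take l w = take l v))" for v
  have tip: "tip v \<in> tips" "md v \<le> length (tip v) + 1" "\<And>l. l < md v \<Longrightarrow> take l (tip v) = take l v"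
    if "v \<in> V" "md v > 0" for v
    using someI_ex[of "\<lambda>w. w \<in> tips \<and> md v \<le> length w + 1 \<and> (\<forall>l<md v. take l w = take l v)"]
      tip_exists[OF that] unfolding tip_def by blast+
  define jb where "jb v = (if md v > 0 then off (tip v) else 0)" for v
  define ld where "ld v = (if md v > 0 then length (tip v) else 0)" for v
  have jb: "jb v \<le> 3 * m" if "v \<in> V" for v
    using jmp(3)[OF tip(1)[OF that]] lenj by (auto simp: jb_def)
  have ld: "ld v \<le> m" if "v \<in> V" for v
    using length_less[OF tV[OF tip(1)[OF that]]] by (auto simp: ld_def)
  have main: "l \<le> ld v \<and> ld v - l < length lg \<and> jb v + lg ! (ld v - l) < length jmp \<and>
           l \<le> jmp ! (jb v + lg ! (ld v - l)) \<and> jmp ! (jb v + lg ! (ld v - l)) - l < length lad \<and>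
           lad ! (jmp ! (jb v + lg ! (ld v - l)) - l) = idx (take l v)"
    if v: "v \<in> V" and l: "l < md v" for v l
  proof -
    have pos: "md v > 0" using l by simp
    define w where "w = tip v"
    have w: "w \<in> tips" "md v \<le> length w + 1" "take l w = take l v" using tip[OF v pos] l by (auto simp: w_def)
    have wV: "w \<in> V" using tV w by blast
    have ldv: "ld v = length w" and jbv: "jb v = off w" using pos by (simp_all add: ld_def jb_def w_def)
    define e where "e = length w - l"
    have em: "e < m" using length_less[OF wV] by (simp add: e_def)
    have lge: "lg ! e = bits e" using em by (simp add: lg_def)
    have b2: "bits e \<le> 2 * s" using em s by (intro bits_le) (simp add: power_mult)
    then have bB: "bits e < length (B w)" by (simp add: B_def)
    define d where "d = dst (bits e)"
    have de: "d \<le> e \<and> e \<le> 2 * d"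
    proof (cases "bits e")
      case 0
      then have "e = 0" using bits[of e] by simp
      then show ?thesis using 0 by (simp add: d_def dst_def)
    next
      case (Suc t)
      then have "2 ^ t \<le> e" "e < 2 * 2 ^ t" using bits[of e] bits_ge[of t e] by simp_all
      then show ?thesis using Suc by (simp add: d_def dst_def)
    qed
    define u where "u = take (length w - d) w"
    have uV: "u \<in> V" and wu: "w \<in> ext u" using take_closed[OF wV] in_ext_take[OF wV] by (auto simp: u_def)
    have lu: "length u = length w - d" by (simp add: u_def)
    have j: "jmp ! (off w + bits e) = qd u"
      using jmp(4)[OF w(1) bB] b2 by (simp add: B_def u_def d_def del: upt_Suc)
    have lw: "l \<le> length w" using w(2) l by simp
    have "l \<le> length u" "2 * length u \<le> l + length w" using de lw by (auto simp: lu e_def)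
    from lad(4)[OF uV wu this]
    have "l \<le> qd u" "qd u - l < length lad" "lad ! (qd u - l) = idx (take l u)" by auto
    moreover have "take l u = take l v"
      using w(3) \<open>l \<le> length u\<close> lu by (simp add: u_def min_def)
    moreover have "off w + bits e < length jmp" using jmp(3)[OF w(1)] bB by simp
    ultimately show ?thesis using lw em by (simp add: ldv jbv e_def[symmetric] lge j) (simp add: lg_def)
  qed
  have lenlg: "length lg = m" by (simp add: lg_def)
  show ?thesis
    by (rule exI[of _ jb], rule exI[of _ ld], rule exI[of _ mb], rule exI[of _ mk], rule exI[of _ lad],
        rule exI[of _ jmp], rule exI[of _ lg], rule exI[of _ mic], rule exI[of _ sel])
      (use lad(1,2) lenj setj lenlg setlg mic main jb ld in \<open>auto simp: ancestor_tables_def not_less\<close>)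
qed

end

section \<open>Structured programs on the word RAM\<close>

datatype aexp = Lit nat | Var nat | Bin binop aexp aexp | Get aexp

text \<open>There is no command that writes to memory, so the data structure is trivially intact
  after a query. The two expressions of \<open>If\<close> and \<open>While\<close> form the guard
  that the first is less than the second.\<close>

datatype com = Asg nat aexp | Seq com com | If aexp aexp com com | While aexp aexp com

text \<open>Registers from 50 on are reserved for the evaluation of expressions.\<close>

fun comp_a :: "nat \<Rightarrow> aexp \<Rightarrow> instr list" where
  "comp_a d (Lit k) = [Const d k]"
| "comp_a d (Var r) = [Op Or d r r]"
| "comp_a d (Bin f a b) = comp_a d a @ comp_a (d + 1) b @ [Op f d d (d + 1)]"
| "comp_a d (Get a) = comp_a d a @ [Load d d]"

fun alen :: "aexp \<Rightarrow> nat" where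
  "alen (Lit k) = 1"
| "alen (Var r) = 1"
| "alen (Bin f a b) = alen a + alen b + 1"
| "alen (Get a) = alen a + 1"

fun avars :: "aexp \<Rightarrow> nat set" where
  "avars (Lit k) = {}"
| "avars (Var r) = {r}"
| "avars (Bin f a b) = avars a \<union> avars b"
| "avars (Get a) = avars a"

lemma length_comp_a [simp]: "length (comp_a d e) = alen e"
  by (induction e arbitrary: d) auto

fun val :: "nat \<Rightarrow> nat list \<Rightarrow> (nat \<Rightarrow> nat) \<Rightarrow> aexp \<Rightarrow> nat option" where
  "val w M rs (Lit k) = Some (k mod 2 ^ w)"
| "val w M rs (Var r) = Some (rs r)"
| "val w M rs (Bin f a b) = (case val w M rs a of None \<Rightarrow> None | Some x \<Rightarrow>
     (case val w M rs b of None \<Rightarrow> None | Some y \<Rightarrow> Some (binop_val w f x y)))"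
| "val w M rs (Get a) = (case val w M rs a of None \<Rightarrow> None | Some x \<Rightarrow>
     if x < length M then Some (M ! x) else None)"

definition code_at :: "program \<Rightarrow> nat \<Rightarrow> instr list \<Rightarrow> bool" where
  "code_at P n xs \<longleftrightarrow> (\<exists>us vs. P = us @ xs @ vs \<and> length us = n)"

lemma code_at_append:
  "code_at P n (xs @ ys) \<longleftrightarrow> code_at P n xs \<and> code_at P (n + length xs) ys"
proof
  assume "code_at P n (xs @ ys)"
  then obtain us vs where "P = us @ xs @ ys @ vs" "length us = n" by (auto simp: code_at_def)
  then show "code_at P n xs \<and> code_at P (n + length xs) ys"
    unfolding code_at_def by (metis append.assoc length_append)
next
  assume "code_at P n xs \<and> code_at P (n + length xs) ys"
  then obtain us vs us' vs' where P: "P = us @ xs @ vs" "length us = n"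
    "P = us' @ ys @ vs'" "length us' = n + length xs" unfolding code_at_def by blast
  then have "(us @ xs) @ vs = us' @ (ys @ vs')" "length (us @ xs) = length us'" by simp_all
  then have "vs = ys @ vs'" using append_eq_append_conv by blast
  then show "code_at P n (xs @ ys)" using P by (auto simp: code_at_def)
qed

lemma code_at_Nil [simp]: "n \<le> length P \<Longrightarrow> code_at P n []"
  unfolding code_at_def by (metis append_Nil append_take_drop_id length_take min.absorb2)

lemma code_at_Cons: "code_at P n (x # xs) \<longleftrightarrow> n < length P \<and> P ! n = x \<and> code_at P (Suc n) xs"
proof -
  have "code_at P n [x] \<longleftrightarrow> n < length P \<and> P ! n = x"
    unfolding code_at_def using id_take_nth_drop[of n P] by (auto simp: nth_append)
      (metis length_take less_imp_le_nat min.absorb2)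
  then show ?thesis using code_at_append[of P n "[x]" xs] by simp
qed

lemma step1: "code_at P (pc s) [x] \<Longrightarrow> exec_instr w x s = Some s' \<Longrightarrow> (s, s') \<in> step w P ^^ 1"
  by (simp add: code_at_Cons step_def)

lemma steps_trans: "(s, s') \<in> step w P ^^ a \<Longrightarrow> (s', s'') \<in> step w P ^^ b \<Longrightarrow> (s, s'') \<in> step w P ^^ (a + b)"
  by (auto simp: relpow_add)

text \<open>The registers from \<open>d\<close> on serve as an evaluation stack. That all registers
  below \<open>d\<close> are preserved protects both the variables and the left operand while the
  right one is evaluated.\<close>

lemma comp_a_correct:
  assumes "code_at P (pc s) (comp_a d e)" "val w (mem s) rs e = Some v" "\<forall>r<50. reg s r = rs r"
    "avars e \<subseteq> {..<50}" "50 \<le> d"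
  shows "\<exists>s'. (s, s') \<in> step w P ^^ alen e \<and> pc s' = pc s + alen e \<and> mem s' = mem s \<and>
    reg s' d = v \<and> (\<forall>r<d. reg s' r = reg s r)"
  using assms
proof (induction e arbitrary: s d v)
  case (Lit k)
  let ?s = "s\<lparr>pc := pc s + 1, reg := (reg s)(d := k mod 2 ^ w)\<rparr>"
  have "(s, ?s) \<in> step w P ^^ 1" using Lit by (intro step1) auto
  then show ?case using Lit by (intro exI[of _ ?s]) auto
next
  case (Var r)
  let ?s = "s\<lparr>pc := pc s + 1, reg := (reg s)(d := reg s r)\<rparr>"
  have "(s, ?s) \<in> step w P ^^ 1" using Var by (intro step1) auto
  then show ?case using Var by (intro exI[of _ ?s]) auto
next
  case (Bin f a b)
  from Bin.prems have c: "code_at P (pc s) (comp_a d a)" "code_at P (pc s + alen a) (comp_a (d + 1) b)"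
    "code_at P (pc s + alen a + alen b) [Op f d d (d + 1)]"
    by (auto simp: code_at_append add.assoc)
  from Bin.prems obtain x y where xy: "val w (mem s) rs a = Some x" "val w (mem s) rs b = Some y"
    "v = binop_val w f x y" by (auto split: option.splits)
  obtain s1 where s1: "(s, s1) \<in> step w P ^^ alen a" "pc s1 = pc s + alen a" "mem s1 = mem s"
    "reg s1 d = x" "\<forall>r<d. reg s1 r = reg s r"
    using Bin.IH(1)[OF c(1) xy(1)] Bin.prems by auto
  obtain s2 where s2: "(s1, s2) \<in> step w P ^^ alen b" "pc s2 = pc s1 + alen b" "mem s2 = mem s"
    "reg s2 (d + 1) = y" "\<forall>r<d + 1. reg s2 r = reg s1 r"
    using Bin.IH(2)[of s1 "d + 1" y] c(2) xy(2) s1 Bin.prems by auto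
  let ?s = "s2\<lparr>pc := pc s2 + 1, reg := (reg s2)(d := v)\<rparr>"
  have "(s2, ?s) \<in> step w P ^^ 1"
    using c(3) s1 s2 xy by (intro step1[of P _ "Op f d d (d + 1)"]) auto
  then have "(s, ?s) \<in> step w P ^^ (alen a + (alen b + 1))" using s1 s2 steps_trans by blast
  then show ?case using s1 s2 by (intro exI[of _ ?s]) (auto simp: add.assoc)
next
  case (Get a)
  from Get.prems have c: "code_at P (pc s) (comp_a d a)" "code_at P (pc s + alen a) [Load d d]"
    by (auto simp: code_at_append)
  from Get.prems obtain x where x: "val w (mem s) rs a = Some x" "x < length (mem s)" "v = mem s ! x"
    by (auto split: option.splits if_splits)
  obtain s1 where s1: "(s, s1) \<in> step w P ^^ alen a" "pc s1 = pc s + alen a" "mem s1 = mem s"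
    "reg s1 d = x" "\<forall>r<d. reg s1 r = reg s r"
    using Get.IH[OF c(1) x(1)] Get.prems by auto
  let ?s = "s1\<lparr>pc := pc s1 + 1, reg := (reg s1)(d := v)\<rparr>"
  have "(s1, ?s) \<in> step w P ^^ 1"
    using c(2) s1 x by (intro step1[of P _ "Load d d"]) auto
  then have "(s, ?s) \<in> step w P ^^ (alen a + 1)" using s1 steps_trans by blast
  then show ?case using s1 by (intro exI[of _ ?s]) auto
qed

section \<open>Commands: compilation, cost and total correctness\<close>

fun clen :: "com \<Rightarrow> nat" where
  "clen (Asg r e) = alen e + 1"
| "clen (Seq a b) = clen a + clen b"
| "clen (If a b c d) = alen a + alen b + 2 + clen c + clen d"
| "clen (While a b c) = alen a + alen b + 3 + clen c"

text \<open>Jump targets are absolute, hence the start address \<open>n\<close>.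
  \<open>JumpLess\<close> falls through when the guard fails, so the else branch is laid out first.
  \<open>Op Or r 50 50\<close> copies register 50, as the machine has no move instruction.\<close>

fun comp :: "nat \<Rightarrow> com \<Rightarrow> instr list" where
  "comp n (Asg r e) = comp_a 50 e @ [Op Or r 50 50]"
| "comp n (Seq a b) = comp n a @ comp (n + clen a) b"
| "comp n (If a b c d) = comp_a 50 a @ comp_a 51 b @
     [JumpLess 50 51 (n + alen a + alen b + clen d + 2)] @
     comp (n + alen a + alen b + 1) d @ [Jump (n + alen a + alen b + clen d + 2 + clen c)] @
     comp (n + alen a + alen b + clen d + 2) c"
| "comp n (While a b c) = comp_a 50 a @ comp_a 51 b @
     [JumpLess 50 51 (n + alen a + alen b + 2), Jump (n + alen a + alen b + 3 + clen c)] @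
     comp (n + alen a + alen b + 2) c @ [Jump n]"

lemma length_comp [simp]: "length (comp n c) = clen c"
  by (induction c arbitrary: n) auto

fun cvars :: "com \<Rightarrow> nat set" where
  "cvars (Asg r e) = insert r (avars e)"
| "cvars (Seq a b) = cvars a \<union> cvars b"
| "cvars (If a b c d) = avars a \<union> avars b \<union> cvars c \<union> cvars d"
| "cvars (While a b c) = avars a \<union> avars b \<union> cvars c"

fun writes :: "com \<Rightarrow> nat set" where
  "writes (Asg r e) = {r}"
| "writes (Seq a b) = writes a \<union> writes b"
| "writes (If a b c d) = writes c \<union> writes d"
| "writes (While a b c) = writes c"

text \<open>The time index is the exact number of machine steps of the compiled code: the else
  branch pays one more for jumping over the then branch, and each round and the exit of a loop pay
  for a jump.\<close>

inductive run :: "nat \<Rightarrow> nat list \<Rightarrow> com \<Rightarrow> (nat \<Rightarrow> nat) \<Rightarrow> nat \<Rightarrow> (nat \<Rightarrow> nat) \<Rightarrow> bool" for w M where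
  Asg: "val w M rs e = Some v \<Longrightarrow> run w M (Asg r e) rs (alen e + 1) (rs(r := v))"
| Seq: "run w M a rs t rs' \<Longrightarrow> run w M b rs' t' rs'' \<Longrightarrow> run w M (Seq a b) rs (t + t') rs''"
| IfT: "val w M rs a = Some x \<Longrightarrow> val w M rs b = Some y \<Longrightarrow> x < y \<Longrightarrow> run w M c rs t rs' \<Longrightarrow>
    run w M (If a b c d) rs (alen a + alen b + 1 + t) rs'"
| IfF: "val w M rs a = Some x \<Longrightarrow> val w M rs b = Some y \<Longrightarrow> \<not> x < y \<Longrightarrow> run w M d rs t rs' \<Longrightarrow>
    run w M (If a b c d) rs (alen a + alen b + 1 + t + 1) rs'"
| WhileT: "val w M rs a = Some x \<Longrightarrow> val w M rs b = Some y \<Longrightarrow> x < y \<Longrightarrow> run w M c rs t rs' \<Longrightarrow>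
    run w M (While a b c) rs' t' rs'' \<Longrightarrow> run w M (While a b c) rs (alen a + alen b + 1 + t + 1 + t') rs''"
| WhileF: "val w M rs a = Some x \<Longrightarrow> val w M rs b = Some y \<Longrightarrow> \<not> x < y \<Longrightarrow>
    run w M (While a b c) rs (alen a + alen b + 2) rs"

lemma run_frame: "run w M c rs t rs' \<Longrightarrow> r \<notin> writes c \<Longrightarrow> rs' r = rs r"
  by (induction rule: run.induct) auto

lemma guard_correct:
  assumes "code_at P (pc s) (comp_a 50 a @ comp_a 51 b @ [JumpLess 50 51 l])"
    "val w (mem s) rs a = Some x" "val w (mem s) rs b = Some y" "\<forall>r<50. reg s r = rs r"
    "avars a \<subseteq> {..<50}" "avars b \<subseteq> {..<50}"
  shows "\<exists>s'. (s, s') \<in> step w P ^^ (alen a + alen b + 1) \<and>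
    pc s' = (if x < y then l else pc s + alen a + alen b + 1) \<and> mem s' = mem s \<and>
    (\<forall>r<50. reg s' r = rs r)"
proof -
  from assms(1) have c: "code_at P (pc s) (comp_a 50 a)" "code_at P (pc s + alen a) (comp_a 51 b)"
    "code_at P (pc s + alen a + alen b) [JumpLess 50 51 l]"
    by (auto simp: code_at_append add.assoc)
  obtain s1 where s1: "(s, s1) \<in> step w P ^^ alen a" "pc s1 = pc s + alen a" "mem s1 = mem s"
    "reg s1 50 = x" "\<forall>r<50. reg s1 r = reg s r"
    using comp_a_correct[OF c(1) assms(2,4,5)] by auto
  obtain s2 where s2: "(s1, s2) \<in> step w P ^^ alen b" "pc s2 = pc s1 + alen b" "mem s2 = mem s"
    "reg s2 51 = y" "\<forall>r<51. reg s2 r = reg s1 r"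
    using comp_a_correct[of P s1 51 b w rs y] c(2) s1 assms by auto
  let ?s = "s2\<lparr>pc := if x < y then l else pc s2 + 1\<rparr>"
  have "(s2, ?s) \<in> step w P ^^ 1"
    using c(3) s1 s2 by (intro step1[of P _ "JumpLess 50 51 l"]) auto
  then have "(s, ?s) \<in> step w P ^^ (alen a + (alen b + 1))" using s1 s2 steps_trans by blast
  then show ?thesis using s1 s2 assms(4) by (intro exI[of _ ?s]) (auto simp: add.assoc)
qed

lemma jump_correct: "code_at P (pc s) [Jump l] \<Longrightarrow> (s, s\<lparr>pc := l\<rparr>) \<in> step w P ^^ 1"
  by (rule step1) auto

lemma comp_correct:
  assumes "run w M c rs t rs'" "code_at P (pc s) (comp (pc s) c)" "\<forall>r<50. reg s r = rs r"
    "cvars c \<subseteq> {..<50}" "mem s = M"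
  shows "\<exists>s'. (s, s') \<in> step w P ^^ t \<and> pc s' = pc s + clen c \<and> mem s' = M \<and> (\<forall>r<50. reg s' r = rs' r)"
  using assms
proof (induction arbitrary: s rule: run.induct)
  case (Asg rs e v r)
  from Asg.prems have c: "code_at P (pc s) (comp_a 50 e)" "code_at P (pc s + alen e) [Op Or r 50 50]"
    by (auto simp: code_at_append)
  obtain s1 where s1: "(s, s1) \<in> step w P ^^ alen e" "pc s1 = pc s + alen e" "mem s1 = mem s"
    "reg s1 50 = v" "\<forall>r<50. reg s1 r = reg s r"
    using comp_a_correct[OF c(1), of w rs v] Asg by auto
  let ?s = "s1\<lparr>pc := pc s1 + 1, reg := (reg s1)(r := v)\<rparr>"
  have "(s1, ?s) \<in> step w P ^^ 1"
    using c(2) s1 by (intro step1[of P _ "Op Or r 50 50"]) auto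
  then have "(s, ?s) \<in> step w P ^^ (alen e + 1)" using s1 steps_trans by blast
  then show ?case using s1 Asg by (intro exI[of _ ?s]) auto
next
  case (Seq a rs t rs' b t' rs'')
  from Seq.prems have c: "code_at P (pc s) (comp (pc s) a)" "code_at P (pc s + clen a) (comp (pc s + clen a) b)"
    by (auto simp: code_at_append)
  obtain s1 where s1: "(s, s1) \<in> step w P ^^ t" "pc s1 = pc s + clen a" "mem s1 = M" "\<forall>r<50. reg s1 r = rs' r"
    using Seq.IH(1)[OF c(1)] Seq.prems by auto
  obtain s2 where s2: "(s1, s2) \<in> step w P ^^ t'" "pc s2 = pc s1 + clen b" "mem s2 = M" "\<forall>r<50. reg s2 r = rs'' r"
    using Seq.IH(2)[of s1] c(2) s1 Seq.prems by auto
  then show ?case using s1 steps_trans by (intro exI[of _ s2]) auto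
next
  case (IfT rs a x b y c t rs' d)
  let ?l = "pc s + alen a + alen b + clen d + 2"
  from IfT.prems have cc: "code_at P (pc s) (comp_a 50 a @ comp_a 51 b @ [JumpLess 50 51 ?l])"
    "code_at P ?l (comp ?l c)" by (simp_all add: code_at_append code_at_Cons algebra_simps)
  obtain s1 where s1: "(s, s1) \<in> step w P ^^ (alen a + alen b + 1)" "pc s1 = ?l" "mem s1 = M" "\<forall>r<50. reg s1 r = rs r"
    using guard_correct[OF cc(1), of w rs x y] IfT by auto
  obtain s2 where s2: "(s1, s2) \<in> step w P ^^ t" "pc s2 = pc s1 + clen c" "mem s2 = M" "\<forall>r<50. reg s2 r = rs' r"
    using IfT.IH[of s1] cc(2) s1 IfT.prems by auto
  have "(s, s2) \<in> step w P ^^ (alen a + alen b + 1 + t)" using steps_trans[OF s1(1) s2(1)] .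
  then show ?case using s1(2) s2 by (intro exI[of _ s2]) auto
next
  case (IfF rs a x b y d t rs' c)
  let ?l = "pc s + alen a + alen b + clen d + 2"
  let ?l' = "pc s + alen a + alen b + 1"
  from IfF.prems have cc: "code_at P (pc s) (comp_a 50 a @ comp_a 51 b @ [JumpLess 50 51 ?l])"
    "code_at P ?l' (comp ?l' d)" "code_at P (?l' + clen d) [Jump (?l + clen c)]"
    by (simp_all add: code_at_append code_at_Cons algebra_simps)
  obtain s1 where s1: "(s, s1) \<in> step w P ^^ (alen a + alen b + 1)" "pc s1 = ?l'" "mem s1 = M" "\<forall>r<50. reg s1 r = rs r"
    using guard_correct[OF cc(1), of w rs x y] IfF by auto
  obtain s2 where s2: "(s1, s2) \<in> step w P ^^ t" "pc s2 = pc s1 + clen d" "mem s2 = M" "\<forall>r<50. reg s2 r = rs' r"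
    using IfF.IH[of s1] cc(2) s1 IfF.prems by auto
  let ?s = "s2\<lparr>pc := ?l + clen c\<rparr>"
  have "(s2, ?s) \<in> step w P ^^ 1" using cc(3) s1(2) s2(2) by (intro jump_correct) simp
  then have "(s, ?s) \<in> step w P ^^ (alen a + alen b + 1 + t + 1)"
    using steps_trans[OF steps_trans[OF s1(1) s2(1)]] by blast
  then show ?case using s2 by (intro exI[of _ ?s]) auto
next
  case (WhileT rs a x b y c t rs' t' rs'')
  let ?l = "pc s + alen a + alen b + 2"
  from WhileT.prems have cc: "code_at P (pc s) (comp_a 50 a @ comp_a 51 b @ [JumpLess 50 51 ?l])"
    "code_at P ?l (comp ?l c)" "code_at P (?l + clen c) [Jump (pc s)]"
    by (simp_all add: code_at_append code_at_Cons algebra_simps)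
  obtain s1 where s1: "(s, s1) \<in> step w P ^^ (alen a + alen b + 1)" "pc s1 = ?l" "mem s1 = M" "\<forall>r<50. reg s1 r = rs r"
    using guard_correct[OF cc(1), of w rs x y] WhileT by auto
  obtain s2 where s2: "(s1, s2) \<in> step w P ^^ t" "pc s2 = pc s1 + clen c" "mem s2 = M" "\<forall>r<50. reg s2 r = rs' r"
    using WhileT.IH(1)[of s1] cc(2) s1 WhileT.prems by auto
  let ?s = "s2\<lparr>pc := pc s\<rparr>"
  have "(s2, ?s) \<in> step w P ^^ 1" using cc(3) s1(2) s2(2) by (intro jump_correct) simp
  then have st: "(s, ?s) \<in> step w P ^^ (alen a + alen b + 1 + t + 1)"
    using steps_trans[OF steps_trans[OF s1(1) s2(1)]] by blast
  obtain s3 where s3: "(?s, s3) \<in> step w P ^^ t'" "pc s3 = pc s + clen (While a b c)" "mem s3 = M" "\<forall>r<50. reg s3 r = rs'' r"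
    using WhileT.IH(2)[of ?s] s2 WhileT.prems by auto
  then show ?case using steps_trans[OF st s3(1)] by blast
next
  case (WhileF rs a x b y c)
  let ?l = "pc s + alen a + alen b + 2"
  let ?e = "pc s + alen a + alen b + 3 + clen c"
  from WhileF.prems have cc: "code_at P (pc s) (comp_a 50 a @ comp_a 51 b @ [JumpLess 50 51 ?l])"
    "code_at P (pc s + alen a + alen b + 1) [Jump ?e]"
    by (simp_all add: code_at_append code_at_Cons algebra_simps)
  obtain s1 where s1: "(s, s1) \<in> step w P ^^ (alen a + alen b + 1)" "pc s1 = pc s + alen a + alen b + 1"
    "mem s1 = M" "\<forall>r<50. reg s1 r = rs r"
    using guard_correct[OF cc(1), of w rs x y] WhileF by auto
  let ?s = "s1\<lparr>pc := ?e\<rparr>"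
  have "(s1, ?s) \<in> step w P ^^ 1" using cc(2) s1(2) by (intro jump_correct) simp
  then have "(s, ?s) \<in> step w P ^^ (alen a + alen b + 1 + 1)"
    using steps_trans[OF s1(1)] by blast
  then show ?case using s1 by (intro exI[of _ ?s]) auto
qed

text \<open>Total correctness of commands without nested loops, for at most \<open>n\<close> iterations of each loop.\<close>

definition tot :: "nat \<Rightarrow> nat list \<Rightarrow> nat \<Rightarrow> com \<Rightarrow> (nat \<Rightarrow> nat) \<Rightarrow> ((nat \<Rightarrow> nat) \<Rightarrow> bool) \<Rightarrow> bool" where
  "tot w M n c rs Q \<longleftrightarrow> (\<exists>t rs'. t \<le> clen c * (n + 1) \<and> run w M c rs t rs' \<and> Q rs')"

lemma tot_conseq:
  assumes "tot w M n c rs Q" "\<And>rs'. Q rs' \<Longrightarrow> (\<And>r. r \<notin> writes c \<Longrightarrow> rs' r = rs r) \<Longrightarrow> Q' rs'"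
  shows "tot w M n c rs Q'"
  using assms unfolding tot_def by (meson run_frame)

lemma tot_Asg:
  assumes "val w M rs e = Some v" "Q (rs(r := v))"
  shows "tot w M n (Asg r e) rs Q"
  unfolding tot_def
  by (rule exI[of _ "alen e + 1"], rule exI[of _ "rs(r := v)"]) (use run.Asg[OF assms(1)] assms(2) in auto)

lemma tot_Seq:
  assumes "tot w M n a rs (\<lambda>rs'. tot w M n b rs' Q)"
  shows "tot w M n (Seq a b) rs Q"
proof -
  obtain t rs' t' rs'' where H: "t \<le> clen a * (n + 1)" "run w M a rs t rs'"
    "t' \<le> clen b * (n + 1)" "run w M b rs' t' rs''" "Q rs''"
    using assms unfolding tot_def by blast
  have "t + t' \<le> clen (Seq a b) * (n + 1)" using H by (simp add: algebra_simps)
  then show ?thesis unfolding tot_def using run.Seq H by blast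
qed

lemma tot_If:
  assumes "val w M rs a = Some x" "val w M rs b = Some y"
    "x < y \<Longrightarrow> tot w M n c rs Q" "\<not> x < y \<Longrightarrow> tot w M n d rs Q"
  shows "tot w M n (If a b c d) rs Q"
proof -
  have le: "alen a + alen b + 2 + t \<le> clen (If a b c d) * (n + 1)"
    if "t \<le> clen c * (n + 1) \<or> t \<le> clen d * (n + 1)" for t
    using that by (auto simp: algebra_simps)
  show ?thesis
  proof (cases "x < y")
    case True
    then obtain t rs' where t: "t \<le> clen c * (n + 1)" "run w M c rs t rs'" "Q rs'"
      using assms(3) unfolding tot_def by blast
    moreover have "alen a + alen b + 1 + t \<le> clen (If a b c d) * (n + 1)" using le[of t] t(1) by linarith
    ultimately show ?thesis unfolding tot_def using run.IfT[OF assms(1,2) True] by blast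
  next
    case False
    then obtain t rs' where t: "t \<le> clen d * (n + 1)" "run w M d rs t rs'" "Q rs'"
      using assms(4) unfolding tot_def by blast
    moreover have "alen a + alen b + 1 + t + 1 \<le> clen (If a b c d) * (n + 1)" using le[of t] t(1) by linarith
    ultimately show ?thesis unfolding tot_def using run.IfF[OF assms(1,2) False] by blast
  qed
qed

text \<open>The index of the invariant bounds the rounds that remain, and so serves both as
  termination measure and as time bound. The body is run with bound 0, that is, within
  \<open>clen c\<close> steps.\<close>

lemma tot_While:
  assumes I: "I k rs" and k: "k \<le> n"
    and guard: "\<And>k rs. I k rs \<Longrightarrow> \<exists>x y. val w M rs a = Some x \<and> val w M rs b = Some y \<and>
      (x < y \<longrightarrow> (\<exists>k'. k = Suc k' \<and> tot w M 0 c rs (I k'))) \<and> (\<not> x < y \<longrightarrow> Q rs)"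
  shows "tot w M n (While a b c) rs Q"
proof -
  let ?K = "alen a + alen b + 2 + clen c"
  have "\<exists>t rs'. t \<le> k * ?K + (alen a + alen b + 2) \<and> run w M (While a b c) rs t rs' \<and> Q rs'"
    using I
  proof (induction k arbitrary: rs rule: less_induct)
    case (less k)
    obtain x y where xy: "val w M rs a = Some x" "val w M rs b = Some y"
      "x < y \<longrightarrow> (\<exists>k'. k = Suc k' \<and> tot w M 0 c rs (I k'))" "\<not> x < y \<longrightarrow> Q rs"
      using guard[OF less.prems] by blast
    show ?case
    proof (cases "x < y")
      case True
      then obtain k' t rs' where k': "k = Suc k'" "t \<le> clen c" "run w M c rs t rs'" "I k' rs'"
        using xy unfolding tot_def by auto
      obtain t' rs'' where t': "t' \<le> k' * ?K + (alen a + alen b + 2)" "run w M (While a b c) rs' t' rs''" "Q rs''"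
        using less.IH[of k' rs'] k' by auto
      have "alen a + alen b + 1 + t + 1 + t' \<le> k * ?K + (alen a + alen b + 2)"
        using t' k' by simp
      then show ?thesis using run.WhileT[OF xy(1,2) True k'(3) t'(2)] t'(3) by blast
    next
      case False
      have "alen a + alen b + 2 \<le> k * ?K + (alen a + alen b + 2)" by simp
      then show ?thesis using run.WhileF[OF xy(1,2) False] xy(4) False by blast
    qed
  qed
  moreover have "k * ?K + (alen a + alen b + 2) \<le> clen (While a b c) * (n + 1)"
  proof -
    have "k * ?K \<le> n * clen (While a b c)" using k by (intro mult_mono) auto
    then show ?thesis by (simp add: algebra_simps)
  qed
  ultimately show ?thesis unfolding tot_def by (meson order_trans)
qed

lemma tot_answers_query:
  assumes "tot w M n c (\<lambda>d. if d < length args then args ! d else 0) (\<lambda>rs. rs 0 = res)"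
    "cvars c \<subseteq> {..<50}"
  shows "\<exists>t\<le>clen c * (n + 1). answers_query w (comp 0 c @ [Halt]) M args t res"
proof -
  let ?P = "comp 0 c @ [Halt]"
  obtain t rs' where t: "t \<le> clen c * (n + 1)" "rs' 0 = res"
    "run w M c (\<lambda>d. if d < length args then args ! d else 0) t rs'"
    using assms(1) unfolding tot_def by blast
  have "code_at ?P 0 (comp 0 c)" unfolding code_at_def by (metis append_Nil list.size(3))
  then obtain s' where "(initial_state M args, s') \<in> step w ?P ^^ t" "pc s' = clen c" "mem s' = M"
    "\<forall>r<50. reg s' r = rs' r"
    using comp_correct[OF t(3), of ?P "initial_state M args"] assms(2) by (auto simp: initial_state_def)
  then show ?thesis using t by (auto simp: answers_query_def halted_def nth_append intro!: exI[of _ s'] exI[of _ t])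
qed

section \<open>Predecessors near a finger\<close>

locale boundaries =
  fixes a :: "nat \<Rightarrow> nat" and k :: nat
  assumes a0: "a 0 = 0" and k: "k \<ge> 1" and a_mono: "\<And>i j. i < j \<Longrightarrow> j \<le> k \<Longrightarrow> a i < a j"
begin

lemma a_le: "i \<le> j \<Longrightarrow> j \<le> k \<Longrightarrow> a i \<le> a j"
  using a_mono by (cases "i = j") (auto simp: less_imp_le)

text \<open>The last child has no upper limit, so that the end \<open>a k\<close> of the string has
  a predecessor too.\<close>

definition is_pred :: "nat \<Rightarrow> nat \<Rightarrow> bool" where
  "is_pred g x \<longleftrightarrow> g < k \<and> a g \<le> x \<and> (g + 1 < k \<longrightarrow> x < a (g + 1))"

definition samples :: "nat \<Rightarrow> nat set" where
  "samples T = {q. q < k \<and> T * T dvd q}"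

definition block :: "nat \<Rightarrow> nat \<Rightarrow> nat \<Rightarrow> nat set" where
  "block T h v = {q \<in> samples T. a q div 2 ^ h = v}"

definition sample_pred :: "nat \<Rightarrow> nat \<Rightarrow> nat \<Rightarrow> bool" where
  "sample_pred T q x \<longleftrightarrow> q \<in> samples T \<and> a q \<le> x \<and> (q + T * T < k \<longrightarrow> x < a (q + T * T))"

lemma finite_block: "finite (block T h v)" by (simp add: block_def samples_def)

text \<open>By \<open>side\<close>, the block lies entirely on one side of \<open>x\<close>; by
  \<open>other\<close>, every sample outside compares with \<open>x\<close> as with the block. So
  the predecessor is the last sample of the block or the one just before its first, which exists
  because \<open>a 0 = 0\<close> is never to the right of \<open>x\<close>.\<close>

lemma sample_pred_from_block:
  assumes ne: "block T h v \<noteq> {}" and T: "T \<ge> 1"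
    and side: "(\<forall>b\<in>block T h v. a b \<le> x) \<or> (\<forall>b\<in>block T h v. x < a b)"
    and other: "\<And>q b. q \<in> samples T \<Longrightarrow> q \<notin> block T h v \<Longrightarrow> b \<in> block T h v \<Longrightarrow> a q \<le> x \<longleftrightarrow> a q < a b"
  shows "x < a (Min (block T h v)) \<Longrightarrow> T * T \<le> Min (block T h v) \<and> sample_pred T (Min (block T h v) - T * T) x"
    and "\<not> x < a (Min (block T h v)) \<Longrightarrow> sample_pred T (Max (block T h v)) x"
proof -
  let ?B = "block T h v"
  let ?l = "Min ?B" and ?h = "Max ?B"
  have l: "?l \<in> ?B" and h: "?h \<in> ?B" using ne finite_block by auto
  have G: "T * T \<ge> 1" using T by simp
  {
    assume x: "x < a ?l"
    have "?l \<noteq> 0"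
    proof
      assume "?l = 0"
      then have "x < a 0" using x by metis
      then show False by (simp add: a0)
    qed
    moreover have d: "T * T dvd ?l" "?l < k" using l by (auto simp: block_def samples_def)
    ultimately have le: "T * T \<le> ?l" by (simp add: dvd_imp_le)
    have q: "?l - T * T \<in> samples T" using d by (auto simp: samples_def dvd_diff_nat)
    have "?l - T * T < ?l" using le G by linarith
    moreover have "?l \<le> b" if "b \<in> ?B" for b using that finite_block by simp
    ultimately have "?l - T * T \<notin> ?B" by (meson not_less)
    moreover have "a (?l - T * T) < a ?l" using a_mono[of "?l - T * T" ?l] \<open>?l - T * T < ?l\<close> d by simp
    ultimately have "a (?l - T * T) \<le> x" using other[OF q _ l] by blast
    then show "T * T \<le> ?l \<and> sample_pred T (?l - T * T) x" using le q x by (simp add: sample_pred_def)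
  }
  {
    assume x: "\<not> x < a ?l"
    then have hx: "a ?h \<le> x" using side l h by auto
    have "x < a (?h + T * T)" if "?h + T * T < k"
    proof -
      have "?h + T * T \<in> samples T" using h that by (auto simp: block_def samples_def)
      moreover have "?h + T * T \<notin> ?B" using Max_ge[OF finite_block, of "?h + T * T" T h v] G by fastforce
      moreover have "a ?h < a (?h + T * T)" using a_mono[of ?h "?h + T * T"] that G by simp
      ultimately show ?thesis using other[of "?h + T * T", OF _ _ h] by auto
    qed
    then show "sample_pred T ?h x" using hx h by (simp add: sample_pred_def block_def)
  }
qed

text \<open>With one bit less removed the block of \<open>x\<close> is empty, so all samples lie in
  the other half of the larger block and hence on one side of \<open>x\<close>. For
  \<open>h = 0\<close> the block is the position \<open>x\<close> itself.\<close>

lemma sample_pred_deepest: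
  assumes T: "T \<ge> 1" and ne: "block T h (x div 2 ^ h) \<noteq> {}"
    and h: "h = 0 \<or> block T (h - 1) (x div 2 ^ (h - 1)) = {}"
  shows "x < a (Min (block T h (x div 2 ^ h))) \<Longrightarrow>
      T * T \<le> Min (block T h (x div 2 ^ h)) \<and> sample_pred T (Min (block T h (x div 2 ^ h)) - T * T) x"
    and "\<not> x < a (Min (block T h (x div 2 ^ h))) \<Longrightarrow> sample_pred T (Max (block T h (x div 2 ^ h))) x"
proof -
  let ?B = "block T h (x div 2 ^ h)"
  have side: "(\<forall>b\<in>?B. a b \<le> x) \<or> (\<forall>b\<in>?B. x < a b)"
  proof (cases "h = 0")
    case True
    then show ?thesis by (auto simp: block_def)
  next
    case False
    then obtain h' where h': "h = Suc h'" by (cases h) auto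
    have ne': "a b div 2 ^ h' \<noteq> x div 2 ^ h'" if "b \<in> ?B" for b
      using h h' that by (auto simp: block_def)
    have "z div 2 ^ h = z div 2 ^ h' div 2" for z :: nat
      by (simp add: h' div_mult2_eq[symmetric] mult.commute)
    then have half: "a b div 2 ^ h' div 2 = x div 2 ^ h' div 2" if "b \<in> ?B" for b
      using that by (simp add: block_def)
    show ?thesis
    proof (rule ccontr)
      assume "\<not> ?thesis"
      then obtain b b' where b: "b \<in> ?B" "a b > x" "b' \<in> ?B" "a b' \<le> x" by (auto simp: not_le not_less)
      then have "a b' div 2 ^ h' \<le> x div 2 ^ h'" "x div 2 ^ h' \<le> a b div 2 ^ h'" by (auto intro: div_le_mono)
      then show False using ne'[OF b(1)] ne'[OF b(3)] half[OF b(1)] half[OF b(3)] by linarith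
    qed
  qed
  have other: "a q \<le> x \<longleftrightarrow> a q < a b" if "q \<in> samples T" "q \<notin> ?B" "b \<in> ?B" for q b
  proof -
    have "a q div 2 ^ h \<noteq> x div 2 ^ h" "a b div 2 ^ h = x div 2 ^ h" using that by (auto simp: block_def)
    then show ?thesis
      by (metis div_le_mono le_antisym le_cases less_imp_le_nat not_less)
  qed
  show "x < a (Min ?B) \<Longrightarrow> T * T \<le> Min ?B \<and> sample_pred T (Min ?B - T * T) x"
    using sample_pred_from_block(1)[OF ne T side other] .
  show "\<not> x < a (Min ?B) \<Longrightarrow> sample_pred T (Max ?B) x"
    using sample_pred_from_block(2)[OF ne T side other] .
qed

text \<open>Positions less than \<open>b\<close> apart lie in equal or neighbouring blocks of length
  \<open>b\<close>, so nothing outside these blocks can separate them.\<close>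

lemma adjacent_blocks:
  fixes x y z :: nat
  assumes "x < y + b" "y < x + b" "z div b \<noteq> x div b" "z div b \<noteq> y div b"
  shows "z \<le> x \<longleftrightarrow> z \<le> y"
proof -
  have b: "b > 0" using assms(1,2) by simp
  have "x div b \<le> (y + b) div b" "y div b \<le> (x + b) div b"  by (rule div_le_mono, use assms in simp)+
  then have "x div b \<le> y div b + 1" "y div b \<le> x div b + 1" using b by simp_all
  moreover have "z \<le> x \<Longrightarrow> z div b \<le> x div b" "x \<le> z \<Longrightarrow> x div b \<le> z div b"
     "z \<le> y \<Longrightarrow> z div b \<le> y div b" "y \<le> z \<Longrightarrow> y div b \<le> z div b" by (auto intro: div_le_mono)
  ultimately show ?thesis using assms(3,4) by linarith
qed

text \<open>The block of the finger is next to the empty block of \<open>x\<close>. Seen from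
  \<open>x\<close>, it is a nonempty block without any sample in between.\<close>

lemma sample_pred_adjacent:
  assumes T: "T \<ge> 1" and xy: "x < y + 2 ^ T" "y < x + 2 ^ T"
    and emp: "block T T (x div 2 ^ T) = {}" and ne: "block T T (y div 2 ^ T) \<noteq> {}"
  shows "x < a (Min (block T T (y div 2 ^ T))) \<Longrightarrow>
      T * T \<le> Min (block T T (y div 2 ^ T)) \<and> sample_pred T (Min (block T T (y div 2 ^ T)) - T * T) x"
    and "\<not> x < a (Min (block T T (y div 2 ^ T))) \<Longrightarrow> sample_pred T (Max (block T T (y div 2 ^ T))) x"
proof -
  let ?B = "block T T (y div 2 ^ T)"
  have xy': "x div 2 ^ T \<noteq> y div 2 ^ T" using emp ne by auto
  have side: "(\<forall>b\<in>?B. a b \<le> x) \<or> (\<forall>b\<in>?B. x < a b)"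
  proof (cases "x < y")
    case True
    have "x < a b" if "b \<in> ?B" for b
      using that xy' True by (auto simp: block_def)
        (metis div_le_mono le_antisym less_imp_le_nat not_less)
    then show ?thesis by blast
  next
    case False
    have "a b \<le> x" if "b \<in> ?B" for b
      using that xy' False by (auto simp: block_def)
        (metis div_le_mono le_antisym le_cases not_less)
    then show ?thesis by blast
  qed
  have other: "a q \<le> x \<longleftrightarrow> a q < a b" if q: "q \<in> samples T" "q \<notin> ?B" and b: "b \<in> ?B" for q b
  proof -
    have n: "a q div 2 ^ T \<noteq> x div 2 ^ T" "a q div 2 ^ T \<noteq> y div 2 ^ T" "a b div 2 ^ T = y div 2 ^ T"
      using q b emp by (auto simp: block_def)
    have "a q \<le> x \<longleftrightarrow> a q \<le> y" using adjacent_blocks[OF xy n(1,2)] .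
    also have "a q \<le> y \<longleftrightarrow> a q < a b" using n(2,3)
      by (metis div_le_mono le_antisym le_cases less_imp_le_nat not_less)
    finally show ?thesis .
  qed
  show "x < a (Min ?B) \<Longrightarrow> T * T \<le> Min ?B \<and> sample_pred T (Min ?B - T * T) x"
    using sample_pred_from_block(1)[OF ne T side other] .
  show "\<not> x < a (Min ?B) \<Longrightarrow> sample_pred T (Max ?B) x"
    using sample_pred_from_block(2)[OF ne T side other] .
qed

text \<open>No sample separates \<open>x\<close> from \<open>y\<close>, so both have the same
  predecessor among the samples. For \<open>y\<close> it is the finger rounded down to a sampled
  index.\<close>

lemma sample_pred_finger:
  assumes T: "T \<ge> 1" and xy: "x < y + 2 ^ T" "y < x + 2 ^ T"
    and emp: "block T T (x div 2 ^ T) = {}" "block T T (y div 2 ^ T) = {}"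
    and f: "is_pred f y"
  shows "sample_pred T (f div (T * T) * (T * T)) x"
proof -
  let ?G = "T * T"
  let ?q = "f div ?G * ?G"
  have G: "?G > 0" using T by simp
  have same: "a q \<le> x \<longleftrightarrow> a q \<le> y" if "q \<in> samples T" for q
    by (rule adjacent_blocks[OF xy]) (use that emp in \<open>auto simp: block_def\<close>)
  have fk: "f < k" "a f \<le> y" using f by (auto simp: is_pred_def)
  have qf: "?q \<le> f" by simp
  have q: "?q \<in> samples T" using le_less_trans[OF qf] fk by (simp add: samples_def)
  have "a ?q \<le> y" using a_le[OF qf] fk by linarith
  then have 1: "a ?q \<le> x" using same[OF q] by blast
  have "x < a (?q + ?G)" if lt: "?q + ?G < k"
  proof -
    have s: "?q + ?G \<in> samples T" using lt by (simp add: samples_def)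
    have "f = ?q + f mod ?G" by (rule div_mult_mod_eq[symmetric])
    then have fl: "f + 1 \<le> ?q + ?G" using mod_less_divisor[OF G, of f] by linarith
    then have "y < a (f + 1)" using f lt by (simp add: is_pred_def)
    also have "\<dots> \<le> a (?q + ?G)" using a_le[OF fl] lt by simp
    finally show ?thesis using same[OF s] by auto
  qed
  then show ?thesis using 1 q by (simp add: sample_pred_def)
qed

text \<open>This monotonicity is what allows binary search on the number of removed bits.\<close>

lemma block_mono:
  assumes "block T h (x div 2 ^ h) \<noteq> {}" "h \<le> h'"
  shows "block T h' (x div 2 ^ h') \<noteq> {}"
proof -
  obtain q where q: "q \<in> samples T" "a q div 2 ^ h = x div 2 ^ h" using assms by (auto simp: block_def)
  have "z div 2 ^ h' = z div 2 ^ h div 2 ^ (h' - h)" for z :: nat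
    using assms(2) by (simp add: div_mult2_eq[symmetric] power_add[symmetric])
  then have "a q div 2 ^ h' = x div 2 ^ h'" using q by simp
  then show ?thesis using q by (auto simp: block_def)
qed

end

text \<open>The dictionary stores, for every level \<open>T = 2 ^ l\<close>, the prefixes of the samples of that level
  with up to \<open>T\<close> bits removed. With \<open>h \<le> T\<close> the code \<open>2 * T + h\<close> determines \<open>T\<close> and \<open>h\<close>.\<close>

definition key :: "nat \<Rightarrow> nat \<times> nat \<times> nat \<Rightarrow> nat" where
  "key C = (\<lambda>(T, h, v). v * C + (2 * T + h))"

text \<open>The code of a power of two T lies between 2 * T and 3 * T, and these intervals are
  disjoint for different powers of two.\<close>

lemma code_inj:
  fixes l l' h h' :: nat
  assumes "h \<le> 2 ^ l" "h' \<le> 2 ^ l'" "2 * 2 ^ l + h = 2 * 2 ^ l' + h'"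
  shows "l = l'"
proof -
  have "False" if "i < j" "g \<le> 2 ^ i" "2 * 2 ^ i + g = 2 * 2 ^ j + g'" for i j g g' :: nat
  proof -
    have "2 ^ Suc i \<le> (2::nat) ^ j" using that by (intro power_increasing) auto
    moreover have "(0::nat) < 2 ^ i" by simp
    ultimately show False using that unfolding power_Suc by linarith
  qed
  then show ?thesis using assms by (metis nat_neq_iff)
qed

lemma key_inj:
  assumes "\<And>T h v. (T, h, v) \<in> I \<Longrightarrow> (\<exists>l. T = 2 ^ l) \<and> h \<le> T \<and> 2 * T + h < C"
  shows "inj_on (key C) I"
proof
  fix p q assume pq: "p \<in> I" "q \<in> I" "key C p = key C q"
  obtain T h v T' h' v' where p: "p = (T, h, v)" and q: "q = (T', h', v')" by (metis prod.exhaust)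
  have A: "\<exists>l. T = 2 ^ l" "h \<le> T" "2 * T + h < C" "\<exists>l. T' = 2 ^ l" "h' \<le> T'" "2 * T' + h' < C"
    using assms pq p q by blast+
  have e: "v * C + (2 * T + h) = v' * C + (2 * T' + h')" using pq(3) by (simp add: key_def p q)
  have "(v * C + (2 * T + h)) div C = v" "(v * C + (2 * T + h)) mod C = 2 * T + h"
     "(v' * C + (2 * T' + h')) div C = v'" "(v' * C + (2 * T' + h')) mod C = 2 * T' + h'"
    using A by (simp_all add: div_mult_self3)
  then have "v = v'" "2 * T + h = 2 * T' + h'" using e by metis+
  moreover from this have "T = T'" using A code_inj by blast
  ultimately show "p = q" by (simp add: p q)
qed

section \<open>The query program\<close>

abbreviation (input) add_e (infixl "[+]" 65) where "a [+] b \<equiv> Bin Add a b"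
abbreviation (input) sub_e (infixl "[-]" 65) where "a [-] b \<equiv> Bin Sub a b"
abbreviation (input) mul_e (infixl "[*]" 70) where "a [*] b \<equiv> Bin Mul a b"
abbreviation (input) div_e (infixl "[div]" 70) where "a [div] b \<equiv> Bin Div a b"
abbreviation (input) mod_e (infixl "[mod]" 70) where "a [mod] b \<equiv> Bin Mod a b"
abbreviation (input) seq_c (infixr ";;" 60) where "a ;; b \<equiv> Seq a b"

definition arr :: "nat \<Rightarrow> aexp \<Rightarrow> aexp" where
  "arr t e = Get (Get (Lit t) [+] e)"

lemma avars_arr [simp]: "avars (arr t e) = avars e" by (simp add: arr_def)

text \<open>
  Arrays: 0 parameters, 1--5 children, 6--12 trie nodes, 13--17 ancestors, 18--23 dictionary.
  Registers: 3, 4 finger and its position; 5, 6 \<open>T\<close> and \<open>T\<^sup>2\<close>; 7 the position sought; 8, 9 results for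
  \<open>i - 1\<close>; 10 child; 11, 12 truncation and position of a look-up; 15 slot; 16 zero if found;
  20 sample; 23 trie node; 24 prefix fingerprint.
\<close>

definition look_up :: com where
  "look_up =
     Asg 13 (Bin Shr (Var 12) (Var 11) [*] arr 0 (Lit 2) [+] (Lit 2 [*] Var 5 [+] Var 11)) ;;
     Asg 14 ((arr 0 (Lit 3) [*] Var 13) [mod] arr 0 (Lit 1) [mod] arr 0 (Lit 4)) ;;
     Asg 15 (arr 20 (Var 14) [+]
       (arr 18 (Var 14) [*] Var 13) [mod] arr 0 (Lit 1) [mod] arr 19 (Var 14)) ;;
     Asg 16 (Bin Xor (arr 21 (Var 15)) (Var 13))"

definition from_slot :: com where
  "from_slot = If (Var 7) (arr 1 (arr 22 (Var 15)))
     (Asg 20 (arr 22 (Var 15) [-] Var 6)) (Asg 20 (arr 23 (Var 15)))"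

definition prefix_search :: com where
  "prefix_search = While (Var 17) (Var 18)
     (Asg 11 ((Var 17 [+] Var 18) [div] Lit 2) ;; look_up ;;
      If (Var 16) (Lit 1) (Asg 18 (Var 11)) (Asg 17 (Var 11 [+] Lit 1)))"

definition sample_search :: com where
  "sample_search =
     Asg 12 (Var 7) ;; Asg 11 (Var 5) ;; look_up ;;
     If (Var 16) (Lit 1)
       (Asg 17 (Lit 0) ;; Asg 18 (Var 5) ;; prefix_search ;; Asg 11 (Var 18) ;; look_up ;; from_slot)
       (Asg 12 (Var 4) ;; look_up ;;
        If (Var 16) (Lit 1) from_slot (Asg 20 (Var 3 [div] Var 6 [*] Var 6)))"

definition group_search :: com where
  "group_search =
     Asg 17 (Var 20) ;; Asg 18 (Var 20 [+] Var 6) ;;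
     If (arr 0 (Lit 6)) (Var 18) (Asg 18 (arr 0 (Lit 6))) (Asg 16 (Lit 0)) ;;
     While (Var 17 [+] Lit 1) (Var 18)
       (Asg 19 ((Var 17 [+] Var 18) [div] Lit 2) ;;
        If (Var 7) (arr 1 (Var 19)) (Asg 18 (Var 19)) (Asg 17 (Var 19))) ;;
     Asg 10 (Var 17)"

definition prefix_print :: com where
  "prefix_print =
     Asg 21 (Var 7 [-] arr 1 (Var 10)) ;; Asg 22 (arr 2 (Var 10)) ;;
     If (Var 21) (arr 6 (Var 22))
       (Asg 23 (arr 13 (arr 14 (arr 7 (Var 22) [+] arr 15 (arr 8 (Var 22) [-] Var 21)) [-] Var 21)))
       (Asg 23 (arr 16 (arr 9 (Var 22) [+]
          arr 17 (arr 10 (Var 22) [*] arr 0 (Lit 5) [+] (Var 21 [-] arr 6 (Var 22)))))) ;;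
     Asg 24 ((arr 3 (Var 10) [+] arr 4 (Var 10) [*] arr 11 (Var 23)) [mod] arr 0 (Lit 1))"

definition locate :: com where
  "locate = sample_search ;; group_search ;; prefix_print"

text \<open>\<open>Asg 16 (Lit 0)\<close> stands for the missing empty command.\<close>

definition choose_finger :: com where
  "choose_finger =
     Asg 3 (Var 2 [-] Lit 1) ;; Asg 4 (Var 1 [-] Lit 1) ;;
     If (Var 0 [-] Lit 1) (arr 1 (Var 3)) (Asg 16 (Lit 0))
       (If (Var 0 [-] Lit 1) (arr 1 (Var 2)) (Asg 4 (Var 0 [-] Lit 1)) (Asg 16 (Lit 0)))"

text \<open>The positions sought are \<open>i - 1\<close> and \<open>j\<close>, and the finger
  stands for \<open>i - 1\<close> or \<open>j - 1\<close>. The distance is therefore at most D + 1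
  for D = j - i, and blocks must have at least D + 2 positions.\<close>

definition choose_level :: com where
  "choose_level =
     Asg 5 (Lit 1) ;; Asg 6 (Lit 1) ;; Asg 11 (Var 1 [-] Var 0 [+] Lit 2) ;;
     While (Bin Shl (Lit 1) (Var 5)) (Var 11)
       (Asg 5 (Var 5 [*] Lit 2) ;; Asg 6 (Var 6 [*] Lit 4))"

text \<open>A positive flag in the first cell of array 0 announces that the answer is stored in its
  cell 7. Register 9 receives the inverse of \<open>c ^ (i - 1)\<close> as the product of one
  tabulated power for the child and one for the trie node.\<close>

definition query :: com where
  "query = If (Lit 0) (arr 0 (Lit 0)) (Asg 0 (arr 0 (Lit 7)))
     (choose_finger ;; choose_level ;;
      Asg 7 (Var 0 [-] Lit 1) ;; locate ;;
      Asg 8 (Var 24) ;; Asg 9 ((arr 5 (Var 10) [*] arr 12 (Var 23)) [mod] arr 0 (Lit 1)) ;;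
      Asg 7 (Var 1) ;; locate ;;
      Asg 0 ((Var 24 [+] arr 0 (Lit 1) [-] Var 8) [mod] arr 0 (Lit 1) [*] Var 9 [mod] arr 0 (Lit 1)))"

lemmas query_defs = query_def choose_level_def choose_finger_def locate_def prefix_print_def
  group_search_def sample_search_def prefix_search_def from_slot_def look_up_def

lemma cvars_query: "cvars query \<subseteq> {..<50}"
  by (simp add: query_defs)

lemma fingerprint_append:
  "fingerprint c p (x @ y) = (fingerprint c p x + c ^ length x * fingerprint c p y) mod p"
proof -
  let ?f = "\<lambda>x. \<Sum>t = 1..length x. x ! (t - 1) * c ^ t"
  have "?f (x @ y) = ?f x + c ^ length x * ?f y"
  proof -
    have "?f (x @ y) = (\<Sum>t = 1..length x. (x @ y) ! (t - 1) * c ^ t)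
        + (\<Sum>t = length x + 1..length x + length y. (x @ y) ! (t - 1) * c ^ t)"
      using sum.ub_add_nat[of 1 "length x" "\<lambda>t. (x @ y) ! (t - 1) * c ^ t" "length y"] by simp
    also have "(\<Sum>t = 1..length x. (x @ y) ! (t - 1) * c ^ t) = ?f x"
      by (rule sum.cong) (auto simp: nth_append)
    also have "(\<Sum>t = length x + 1..length x + length y. (x @ y) ! (t - 1) * c ^ t)
        = (\<Sum>t = 1..length y. (x @ y) ! (t + length x - 1) * c ^ (t + length x))"
      using sum.shift_bounds_cl_nat_ivl[of "\<lambda>t. (x @ y) ! (t - 1) * c ^ t" 1 "length x" "length y"]
      by (simp add: add.commute)
    also have "\<dots> = (\<Sum>t = 1..length y. c ^ length x * (y ! (t - 1) * c ^ t))"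
      by (rule sum.cong) (auto simp: nth_append power_add algebra_simps)
    also have "\<dots> = c ^ length x * ?f y" by (simp add: sum_distrib_left)
    finally show ?thesis .
  qed
  moreover have "(u + v * t) mod p = (u mod p + v * (t mod p)) mod p" for u v t :: nat
    by (intro mod_add_cong) (simp_all add: mod_mult_right_eq)
  ultimately show ?thesis unfolding fingerprint_def by metis
qed

lemma fingerprint_mod [simp]: "fingerprint c p x mod p = fingerprint c p x"
  by (simp add: fingerprint_def)

lemma xor_eq_0_nat: "semiring_bit_operations_class.xor x y = (0::nat) \<longleftrightarrow> x = y"
  by (auto simp: bit_eq_iff bit_xor_iff)

section \<open>Specification of the memory and correctness of the searches\<close>

context boundaries begin

text \<open>Only levels that a query can reach: it passes to the next level only if the blocks of
  the previous one are shorter than D + 2, hence not longer than the string.\<close>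

definition level :: "nat \<Rightarrow> bool" where
  "level T \<longleftrightarrow> (\<exists>l. T = 2 ^ l \<and> (l = 0 \<or> 2 ^ 2 ^ (l - 1) \<le> a k))"

text \<open>All keys that a query can form are covered, not only the stored ones, since an
  unsuccessful look-up must stay inside the arrays as well.\<close>

definition sample_dictionary ::
  "nat \<Rightarrow> nat \<Rightarrow> nat \<Rightarrow> nat \<Rightarrow> nat list \<Rightarrow> nat list \<Rightarrow> nat list \<Rightarrow> nat list \<Rightarrow> nat list \<Rightarrow> nat list \<Rightarrow> bool" where
  "sample_dictionary C p R h0 as ms bs ks lo hi \<longleftrightarrow> (\<forall>T h v. level T \<longrightarrow> h \<le> T \<longrightarrow> v \<le> a k \<longrightarrow>
     (let x = key C (T, h, v); b = hash p R h0 x; t = bs ! b + hash p (ms ! b) (as ! b) x in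
        x < p \<and> b < length as \<and> b < length ms \<and> b < length bs \<and>
        t < length ks \<and> t < length lo \<and> t < length hi \<and>
        (ks ! t = x \<longleftrightarrow> block T h v \<noteq> {}) \<and>
        (block T h v \<noteq> {} \<longrightarrow> lo ! t = Min (block T h v) \<and> hi ! t = Max (block T h v))))"

lemma level_le: assumes "level T" "a k \<ge> 1" shows "T \<le> 2 * a k"
proof -
  obtain l where l: "T = 2 ^ l" "l = 0 \<or> 2 ^ 2 ^ (l - 1) \<le> a k" using assms unfolding level_def by blast
  show ?thesis
  proof (cases l)
    case 0
    then show ?thesis using l assms(2) by simp
  next
    case (Suc l')
    then have "2 ^ 2 ^ l' \<le> a k" using l by simp
    then have "2 ^ l' \<le> a k" using less_exp[of "2 ^ l'"] by linarith
    then show ?thesis using l Suc by simp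
  qed
qed

end

text \<open>The first 24 cells of \<open>M\<close> are the base addresses of the arrays
  \<open>A t\<close>. \<open>Q\<close> exceeds all entries, and \<open>100 * (Q * Q)\<close> leaves
  room for a product of two entries and a few more terms, so that machine arithmetic agrees with
  that of the natural numbers. \<open>e\<close> is the inverse of \<open>c\<close> modulo
  \<open>p\<close>.\<close>

locale query_memory = boundaries a k for a :: "nat \<Rightarrow> nat" and k +
  fixes w :: nat and M :: "nat list" and A :: "nat \<Rightarrow> nat list" and Q :: nat
    and p C h0 R s c e :: nat and Ls :: "nat list list" and V :: "nat list set"
    and idx md jb ld mb mk :: "nat list \<Rightarrow> nat"
  assumes read: "t < 24 \<Longrightarrow> i < length (A t) \<Longrightarrow>
      t < length M \<and> M ! t + i < length M \<and> M ! (M ! t + i) = A t ! i"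
    and lenM: "length M \<le> 2 ^ w"
    and Q: "t < 24 \<Longrightarrow> i < length (A t) \<Longrightarrow> A t ! i < Q" and w: "100 * (Q * Q) \<le> 2 ^ w"
    and k_eq: "k = length Ls" and a_eq: "\<And>g. a g = length (concat (take g Ls))"
    and params: "A 0 = [0, p, C, h0, R, s, k, 0]"
    and p: "p > 1" and inverse: "c * e mod p = 1"
    and starts: "length (A 1) = k + 1" "\<And>g. g \<le> k \<Longrightarrow> A 1 ! g = a g"
    and child: "\<And>g t. g < k \<Longrightarrow> t \<in> {2..5} \<Longrightarrow> g < length (A t)"
      "\<And>g. g < k \<Longrightarrow> A 2 ! g = idx (Ls ! g)"
      "\<And>g. g < k \<Longrightarrow> A 3 ! g = fingerprint c p (concat (take g Ls))"
      "\<And>g. g < k \<Longrightarrow> A 4 ! g = c ^ a g mod p"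
      "\<And>g. g < k \<Longrightarrow> A 5 ! g = e ^ a g mod p"
      "\<And>g. g < k \<Longrightarrow> Ls ! g \<in> V"
    and take_V: "\<And>v l. v \<in> V \<Longrightarrow> take l v \<in> V"
    and node: "\<And>v t. v \<in> V \<Longrightarrow> t \<in> {6..12} \<Longrightarrow> idx v < length (A t)"
      "\<And>v. v \<in> V \<Longrightarrow> A 6 ! idx v = md v" "\<And>v. v \<in> V \<Longrightarrow> A 7 ! idx v = jb v"
      "\<And>v. v \<in> V \<Longrightarrow> A 8 ! idx v = ld v" "\<And>v. v \<in> V \<Longrightarrow> A 9 ! idx v = mb v"
      "\<And>v. v \<in> V \<Longrightarrow> A 10 ! idx v = mk v" "\<And>v. v \<in> V \<Longrightarrow> A 11 ! idx v = fingerprint c p v"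
      "\<And>v. v \<in> V \<Longrightarrow> A 12 ! idx v = e ^ length v mod p"
    and tables: "ancestor_tables V idx md s jb ld mb mk (A 13) (A 14) (A 15) (A 16) (A 17)"
    and dict: "sample_dictionary C p R h0 (A 18) (A 19) (A 20) (A 21) (A 22) (A 23)"
begin

abbreviation "ev \<equiv> val w M"
abbreviation "ok \<equiv> tot w M"

lemma Qs: "p < Q" "C < Q" "h0 < Q" "R < Q" "s < Q" "k < Q" "Q > 0" "a k < Q"
  using Q[of 0 1] Q[of 0 2] Q[of 0 3] Q[of 0 4] Q[of 0 5] Q[of 0 6] Q[of 1 k] starts
  by (simp_all add: params)

lemma QQ: "x < Q \<Longrightarrow> y < Q \<Longrightarrow> x * y \<le> Q * Q" by (intro mult_mono) auto
lemma Q1: "Q \<le> Q * Q" using Qs by simp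

lemma bound: "x < Q \<Longrightarrow> y < Q \<Longrightarrow> z \<le> 40 * (Q * Q) \<Longrightarrow> x * y + z < 2 ^ w"
proof -
  assume H: "x < Q" "y < Q" "z \<le> 40 * (Q * Q)"
  have "Q * Q > 0" using Qs by simp
  then show "x * y + z < 2 ^ w" using QQ[OF H(1,2)] H(3) w by linarith
qed

lemma bound_less: "x \<le> 80 * (Q * Q) \<Longrightarrow> x < 2 ^ w"
proof -
  assume H: "x \<le> 80 * (Q * Q)"
  have "Q * Q > 0" using Qs by simp
  then show "x < 2 ^ w" using H w by linarith
qed

lemma w_pos [simp]: "0 < w"
proof (rule ccontr)
  assume "\<not> 0 < w"
  then have "100 * (Q * Q) \<le> 1" using w by simp
  then show False using Q1 Qs(7) by linarith
qed

lemma sub_mod: "(y::nat) \<le> x \<Longrightarrow> x < 2 ^ w \<Longrightarrow> (x + 2 ^ w - y) mod 2 ^ w = x - y"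
proof -
  assume "y \<le> x" "x < 2 ^ w"
  then have "(x + 2 ^ w - y) mod 2 ^ w = (x - y + 2 ^ w) mod 2 ^ w" by (simp add: Nat.add_diff_assoc2)
  then show ?thesis using \<open>x < 2 ^ w\<close> by simp
qed

lemma lit: "(i::nat) < 80 \<Longrightarrow> i mod 2 ^ w = i"
proof -
  assume "i < 80"
  moreover have "Q * Q > 0" using Qs by simp
  ultimately have "i \<le> 80 * (Q * Q)" by linarith
  then show ?thesis using bound_less by simp
qed

lemma lits: "0 mod 2 ^ w = (0::nat)" "1 mod 2 ^ w = (1::nat)" "Suc 0 mod 2 ^ w = Suc 0"
  "numeral n mod 2 ^ w = (if numeral n < (80::nat) then numeral n else numeral n mod 2 ^ w :: nat)"
  using lit by simp_all

lemma val_arr: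
  assumes "ev rs x = Some i" "t < 24" "i < length (A t)"
  shows "ev rs (arr t x) = Some (A t ! i)"
  using read[OF assms(2,3)] lenM assms by (simp add: arr_def)

lemma look_up_correct:
  assumes T: "level T" "h \<le> T" and z: "z \<le> a k"
    and rs: "rs 5 = T" "rs 11 = h" "rs 12 = z"
  shows "ok n look_up rs (\<lambda>rs'. rs' 15 < length (A 22) \<and> rs' 15 < length (A 23) \<and>
     (rs' 16 = 0 \<longleftrightarrow> block T h (z div 2 ^ h) \<noteq> {}) \<and>
     (block T h (z div 2 ^ h) \<noteq> {} \<longrightarrow> A 22 ! rs' 15 = Min (block T h (z div 2 ^ h)) \<and>
        A 23 ! rs' 15 = Max (block T h (z div 2 ^ h))))"
proof -
  define v where "v = z div 2 ^ h"
  define x where "x = key C (T, h, v)"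
  define b where "b = hash p R h0 x"
  define t where "t = A 20 ! b + hash p (A 19 ! b) (A 18 ! b) x"
  have v: "v \<le> a k" using z by (simp add: v_def) (meson div_le_dividend order_trans)
  from dict[unfolded sample_dictionary_def, rule_format, OF T v] have d: "x < p" "b < length (A 18)" "b < length (A 19)" "b < length (A 20)"
        "t < length (A 21)" "t < length (A 22)" "t < length (A 23)"
        "A 21 ! t = x \<longleftrightarrow> block T h v \<noteq> {}"
        "block T h v \<noteq> {} \<longrightarrow> A 22 ! t = Min (block T h v) \<and> A 23 ! t = Max (block T h v)"
    unfolding Let_def x_def[symmetric] b_def[symmetric] t_def[symmetric] by blast+
  have xQ: "x < Q" using d(1) Qs by simp
  have xw: "x < 2 ^ w" using bound_less[of x] xQ Q1 by simp
  have x: "v * C + (2 * T + h) = x" by (simp add: x_def key_def)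
  have parts: "v * C < 2 ^ w" "2 * T + h < 2 ^ w" "2 * T < 2 ^ w" using x xw by linarith+
  have e1: "ev rs (Bin Shr (Var 12) (Var 11) [*] arr 0 (Lit 2) [+] (Lit 2 [*] Var 5 [+] Var 11)) = Some x"
    using parts xw x by (simp add: val_arr lits params rs drop_bit_eq_div v_def[symmetric])
  have m1: "h0 * x < 2 ^ w" using bound[OF Qs(3) xQ, of 0] by simp
  have e2: "ev (rs(13 := x)) ((arr 0 (Lit 3) [*] Var 13) [mod] arr 0 (Lit 1) [mod] arr 0 (Lit 4)) = Some b"
    using m1 by (simp add: val_arr lits params b_def hash_def)
  have A18: "A 18 ! b < Q" and A20: "A 20 ! b < Q" using Q[of 18 b] Q[of 20 b] d by auto
  have m2: "A 18 ! b * x < 2 ^ w" using bound[OF A18 xQ, of 0] by simp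
  have tp: "A 18 ! b * x mod p mod A 19 ! b < Q"
    using p Qs by (meson le_less_trans mod_less_divisor mod_less_eq_dividend less_trans zero_less_one)
  have t: "t = A 20 ! b + A 18 ! b * x mod p mod A 19 ! b" by (simp add: t_def hash_def)
  have tw: "A 20 ! b + A 18 ! b * x mod p mod A 19 ! b < 2 ^ w"
    using bound_less[of "A 20 ! b + A 18 ! b * x mod p mod A 19 ! b"] A20 tp Q1 by linarith
  have e3: "ev (rs(13 := x, 14 := b)) (arr 20 (Var 14) [+]
       (arr 18 (Var 14) [*] Var 13) [mod] arr 0 (Lit 1) [mod] arr 19 (Var 14)) = Some t"
    using m2 tw d by (simp add: val_arr lits params t)
  have e4: "ev (rs(13 := x, 14 := b, 15 := t)) (Bin Xor (arr 21 (Var 15)) (Var 13)) =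
      Some (semiring_bit_operations_class.xor (A 21 ! t) x)"
    using d by (simp add: val_arr)
  show ?thesis unfolding look_up_def v_def[symmetric]
    by (rule tot_Seq, rule tot_Asg[OF e1], rule tot_Seq, rule tot_Asg[OF e2], rule tot_Seq,
        rule tot_Asg[OF e3], rule tot_Asg[OF e4]) (use d xor_eq_0_nat in simp)
qed

lemma from_slot_correct:
  assumes B: "B \<noteq> {}" "finite B" "B \<subseteq> samples T" and rs: "rs 7 = x" "rs 6 = T * T"
    "rs 15 < length (A 22)" "rs 15 < length (A 23)" "A 22 ! rs 15 = Min B" "A 23 ! rs 15 = Max B"
    and sp: "x < a (Min B) \<Longrightarrow> T * T \<le> Min B \<and> sample_pred T (Min B - T * T) x"
      "\<not> x < a (Min B) \<Longrightarrow> sample_pred T (Max B) x"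
  shows "ok n from_slot rs (\<lambda>rs'. sample_pred T (rs' 20) x)"
proof -
  have "Min B \<in> B" using B by simp
  then have "Min B \<in> samples T" using B by blast
  then have l: "Min B < k" by (simp add: samples_def)
  then have lw: "Min B < 2 ^ w" using Qs Q1 bound_less[of "Min B"] by linarith
  have e1: "ev rs (Var 7) = Some x" by (simp add: rs)
  have e2: "ev rs (arr 1 (arr 22 (Var 15))) = Some (a (Min B))"
    using l rs starts by (simp add: val_arr)
  have e3: "ev rs (arr 22 (Var 15) [-] Var 6) = Some (Min B - T * T)" if "x < a (Min B)"
    using rs sp(1)[OF that] lw by (simp add: val_arr sub_mod)
  have e4: "ev rs (arr 23 (Var 15)) = Some (Max B)"
    using rs by (simp add: val_arr)
  show ?thesis unfolding from_slot_def
    by (rule tot_If[OF e1 e2], rule tot_Asg[OF e3], simp, use sp in simp, rule tot_Asg[OF e4], use sp in simp)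
qed

text \<open>Squaring \<open>2 ^ 2 ^ (l - 1) \<le> a k\<close> bounds \<open>2 ^ T\<close>, so that
  the shift in \<open>choose_level\<close> does not overflow.\<close>

lemma level_bound: assumes "level T" shows "T \<ge> 1" "T \<le> 2 * a k" "T * T \<le> 4 * (Q * Q)" "2 ^ T \<le> 4 * (Q * Q)"
proof -
  obtain l where l: "T = 2 ^ l" "l = 0 \<or> 2 ^ 2 ^ (l - 1) \<le> a k" using assms by (auto simp: level_def)
  have ak: "a k \<ge> 1" using a_mono[of 0 k] k by simp
  show "T \<ge> 1" using l by simp
  show T: "T \<le> 2 * a k" using level_le[OF assms ak] .
  have aQ: "a k * a k \<le> Q * Q" using Qs QQ by blast
  have "T * T \<le> (2 * a k) * (2 * a k)" using T by (intro mult_mono) auto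
  then show "T * T \<le> 4 * (Q * Q)" using aQ by simp
  show "2 ^ T \<le> 4 * (Q * Q)"
  proof (cases l)
    case 0
    then show ?thesis using l Qs by simp
  next
    case (Suc l')
    then have h: "2 ^ 2 ^ l' \<le> a k" using l by simp
    have "(2::nat) ^ T = 2 ^ 2 ^ l' * 2 ^ 2 ^ l'" using l Suc by (simp add: power_add[symmetric])
    also have "\<dots> \<le> a k * a k" using h by (intro mult_mono) auto
    finally show ?thesis using aQ by linarith
  qed
qed

lemma prefix_search_correct:
  assumes T: "level T" and l: "T = 2 ^ l" "l + 1 \<le> n" and x: "x \<le> a k"
    and rs: "rs 5 = T" "rs 12 = x" "rs 17 = 0" "rs 18 = T"
    and ne: "block T T (x div 2 ^ T) \<noteq> {}"
  shows "ok n prefix_search rs (\<lambda>rs'. rs' 18 \<le> T \<and> block T (rs' 18) (x div 2 ^ rs' 18) \<noteq> {} \<and>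
    (rs' 18 = 0 \<or> block T (rs' 18 - 1) (x div 2 ^ (rs' 18 - 1)) = {}))"
proof -
  let ?br = "If (Var 16) (Lit 1) (Asg 18 (Var 11)) (Asg 17 (Var 11 [+] Lit 1))"
  let ?body = "Asg 11 ((Var 17 [+] Var 18) [div] Lit 2) ;; look_up ;; ?br"
  define P where "P h = (block T h (x div 2 ^ h) \<noteq> {})" for h
  \<comment> \<open>The least truncation with a nonempty block lies between registers 17 and 18.
    Their distance starts at \<open>T = 2 ^ l < 2 ^ (l + 1)\<close> and is halved in each round,
    hence \<open>l + 1\<close> rounds.\<close>
  define I where "I j ts \<longleftrightarrow> ts 5 = T \<and> ts 12 = x \<and> ts 17 \<le> ts 18 \<and> ts 18 \<le> T \<and> P (ts 18) \<and>
     (ts 17 = 0 \<or> \<not> P (ts 17 - 1)) \<and> ts 18 - ts 17 < 2 ^ j" for j and ts :: "nat \<Rightarrow> nat"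
  have TQ: "T \<le> 2 * Q" using level_bound(2)[OF T] Qs by linarith
  have mono: "P h \<Longrightarrow> h \<le> h' \<Longrightarrow> P h'" for h h' using block_mono unfolding P_def by blast
  have I0: "I (l + 1) rs" using rs ne l by (simp add: I_def P_def)
  show ?thesis unfolding prefix_search_def
  proof (rule tot_While[where I = I and k = "l + 1"])
    show "I (l + 1) rs" by fact
    show "l + 1 \<le> n" by fact
    fix j ts assume I: "I j ts"
    have v: "ev ts (Var 17) = Some (ts 17)" "ev ts (Var 18) = Some (ts 18)" by simp_all
    let ?m = "(ts 17 + ts 18) div 2"
    have step: "\<exists>j'. j = Suc j' \<and> ok 0
        ?body ts (I j')" if lt: "ts 17 < ts 18"
    proof -
      obtain j' where j': "j = Suc j'" using I lt by (cases j) (auto simp: I_def)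
      have m: "ts 17 \<le> ?m" "?m < ts 18" using lt by auto
      have mT: "?m \<le> T" using m I by (simp add: I_def)
      have "ts 17 + ts 18 \<le> 4 * Q" using I lt TQ unfolding I_def by linarith
      then have sw: "ts 17 + ts 18 < 2 ^ w" using Q1 bound_less[of "ts 17 + ts 18"] by linarith
      have e1: "ev ts ((Var 17 [+] Var 18) [div] Lit 2) = Some ?m"
        using sw by (simp add: lits)
      have br: "ok 0 ?br ts' (I j')"
        if ts': "ts' 16 = 0 \<longleftrightarrow> P ?m" "\<And>r. r \<notin> writes look_up \<Longrightarrow> ts' r = (ts(11 := ?m)) r" for ts'
      proof -
        have r: "ts' 5 = T" "ts' 12 = x" "ts' 17 = ts 17" "ts' 18 = ts 18" "ts' 11 = ?m"
          using I ts'(2) by (auto simp: look_up_def I_def)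
        have v1: "ev ts' (Var 16) = Some (ts' 16)" "ev ts' (Lit 1) = Some 1" "ev ts' (Var 11) = Some ?m"
          using r by (simp_all add: lits)
        have "?m + 1 < 2 ^ w" using m(2) sw by linarith
        then have v2: "ev ts' (Var 11 [+] Lit 1) = Some (?m + 1)"
          using r by (simp add: lits)
        show ?thesis
        proof (rule tot_If[OF v1(1,2)])
          assume "ts' 16 < 1"
          then have "P ?m" using ts' by simp
          then have "I j' (ts'(18 := ?m))"
            using I r m mT j' by (auto simp: I_def)
          then show "ok 0 (Asg 18 (Var 11)) ts' (I j')" by (rule tot_Asg[OF v1(3)])
        next
          assume "\<not> ts' 16 < 1"
          then have "\<not> P ?m" using ts' by simp
          then have "I j' (ts'(17 := ?m + 1))"
            using I r m mT j' by (auto simp: I_def)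
          then show "ok 0 (Asg 17 (Var 11 [+] Lit 1)) ts' (I j')" by (rule tot_Asg[OF v2])
        qed
      qed
      have lk: "ok 0 look_up (ts(11 := ?m)) (\<lambda>ts'. ts' 16 = 0 \<longleftrightarrow> P ?m)"
        by (rule tot_conseq[OF look_up_correct[OF T mT x]]) (use I in \<open>simp_all add: I_def P_def\<close>)
      have "ok 0 look_up (ts(11 := ?m)) (\<lambda>ts'. ok 0
          ?br ts' (I j'))"
        by (rule tot_conseq[OF lk]) (rule br)
      then have seq: "ok 0 (look_up ;; ?br)
          (ts(11 := ?m)) (I j')" by (rule tot_Seq)
      have "ok 0 ?body ts (I j')"
        by (rule tot_Seq, rule tot_Asg[OF e1], rule seq)
      then show ?thesis using j' by blast
    qed
    have stop: "ts 18 \<le> T \<and> block T (ts 18) (x div 2 ^ ts 18) \<noteq> {} \<and>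
        (ts 18 = 0 \<or> block T (ts 18 - 1) (x div 2 ^ (ts 18 - 1)) = {})" if "\<not> ts 17 < ts 18"
      using that I by (auto simp: I_def P_def)
    show "\<exists>xa y. ev ts (Var 17) = Some xa \<and> ev ts (Var 18) = Some y \<and>
      (xa < y \<longrightarrow> (\<exists>k'. j = Suc k' \<and> ok 0
        ?body ts (I k'))) \<and>
      (\<not> xa < y \<longrightarrow> ts 18 \<le> T \<and> block T (ts 18) (x div 2 ^ ts 18) \<noteq> {} \<and>
        (ts 18 = 0 \<or> block T (ts 18 - 1) (x div 2 ^ (ts 18 - 1)) = {}))"
      using v step stop by blast
  qed
qed

lemma writes_simps:
  "writes look_up = {13, 14, 15, 16}" "writes prefix_search = {11, 13, 14, 15, 16, 17, 18}"
  "writes from_slot = {20}" "writes sample_search = {11, 12, 13, 14, 15, 16, 17, 18, 20}"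
  "writes group_search = {10, 16, 17, 18, 19}" "writes prefix_print = {21, 22, 23, 24}"
  "writes locate = {10, 11, 12, 13, 14, 15, 16, 17, 18, 19, 20, 21, 22, 23, 24}"
  "writes choose_finger = {3, 4, 16}" "writes choose_level = {5, 6, 11}"
  by (auto simp: query_defs)

lemma sample_search_correct:
  assumes T: "level T" and l: "T = 2 ^ l" "l + 1 \<le> n"
    and x: "x \<le> a k" "y \<le> a k" "x < y + 2 ^ T" "y < x + 2 ^ T" and f: "is_pred f y"
    and rs: "rs 3 = f" "rs 4 = y" "rs 5 = T" "rs 6 = T * T" "rs 7 = x"
  shows "ok n sample_search rs (\<lambda>rs'. sample_pred T (rs' 20) x)"
proof -
  let ?P = "\<lambda>rs'. sample_pred T (rs' 20) x"
  let ?fin = "Asg 11 (Var 18) ;; look_up ;; from_slot"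
  let ?own = "Asg 17 (Lit 0) ;; Asg 18 (Var 5) ;; prefix_search ;; ?fin"
  let ?adj = "If (Var 16) (Lit 1) from_slot (Asg 20 (Var 3 [div] Var 6 [*] Var 6))"
  let ?other = "Asg 12 (Var 4) ;; look_up ;; ?adj"
  let ?br = "If (Var 16) (Lit 1) ?own ?other"
  have T1: "T \<ge> 1" using level_bound[OF T] by simp
  define found where "found h z ts \<longleftrightarrow> ts 15 < length (A 22) \<and> ts 15 < length (A 23) \<and>
     A 22 ! ts 15 = Min (block T h (z div 2 ^ h)) \<and> A 23 ! ts 15 = Max (block T h (z div 2 ^ h))"
    for h z and ts :: "nat \<Rightarrow> nat"
  define regs where "regs ts \<longleftrightarrow> ts 3 = f \<and> ts 4 = y \<and> ts 5 = T \<and> ts 6 = T * T \<and> ts 7 = x"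
    for ts :: "nat \<Rightarrow> nat"
  have lk: "ok n look_up ts (\<lambda>ts'. regs ts' \<and> ts' 11 = h \<and> ts' 12 = z \<and>
      (ts' 16 = 0 \<longleftrightarrow> block T h (z div 2 ^ h) \<noteq> {}) \<and> (block T h (z div 2 ^ h) \<noteq> {} \<longrightarrow> found h z ts'))"
    if "regs ts" "ts 11 = h" "ts 12 = z" "h \<le> T" "z \<le> a k" for ts h z
    by (rule tot_conseq[OF look_up_correct[OF T that(4,5)]])
      (use that in \<open>simp_all add: regs_def found_def writes_simps\<close>)
  have slot: "ok n from_slot ts ?P"
    if "regs ts" "found h z ts" "block T h (z div 2 ^ h) \<noteq> {}"
      "x < a (Min (block T h (z div 2 ^ h))) \<Longrightarrow>
        T * T \<le> Min (block T h (z div 2 ^ h)) \<and> sample_pred T (Min (block T h (z div 2 ^ h)) - T * T) x"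
      "\<not> x < a (Min (block T h (z div 2 ^ h))) \<Longrightarrow> sample_pred T (Max (block T h (z div 2 ^ h))) x" for ts h z
    by (rule from_slot_correct[where B = "block T h (z div 2 ^ h)", OF that(3) finite_block _ _ _ _ _ _ _ that(4,5)])
      (use that(1,2) in \<open>auto simp: regs_def found_def block_def\<close>)
  have own: "ok n ?own ts
      ?P"
    if ts: "regs ts" "ts 12 = x" and ne: "block T T (x div 2 ^ T) \<noteq> {}" for ts
  proof -
    let ?ts = "ts(17 := 0, 18 := T)"
    have fin: "ok n ?fin ts' ?P"
      if h: "ts' 18 \<le> T \<and> block T (ts' 18) (x div 2 ^ ts' 18) \<noteq> {} \<and>
         (ts' 18 = 0 \<or> block T (ts' 18 - 1) (x div 2 ^ (ts' 18 - 1)) = {})"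
        and fr: "\<And>r. r \<notin> writes prefix_search \<Longrightarrow> ts' r = ?ts r" for ts'
    proof -
      have r: "regs ts'" "ts' 12 = x" using fr ts by (simp_all add: regs_def writes_simps)
      have 1: "ok n look_up (ts'(11 := ts' 18)) (\<lambda>ts''. ok n from_slot ts'' ?P)"
      proof (rule tot_conseq[OF lk[of _ "ts' 18" x]])
        show "regs (ts'(11 := ts' 18))" using r by (simp add: regs_def)
      next
        fix ts''
        assume "regs ts'' \<and> ts'' 11 = ts' 18 \<and> ts'' 12 = x \<and>
          (ts'' 16 = 0 \<longleftrightarrow> block T (ts' 18) (x div 2 ^ ts' 18) \<noteq> {}) \<and>
          (block T (ts' 18) (x div 2 ^ ts' 18) \<noteq> {} \<longrightarrow> found (ts' 18) x ts'')"
        then show "ok n from_slot ts'' ?P"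
          using h sample_pred_deepest[OF T1, of "ts' 18" x] by (intro slot[of _ "ts' 18" x]) blast+
      qed (use r h x in auto)
      show ?thesis by (rule tot_Seq, rule tot_Asg[where v = "ts' 18"], simp, rule tot_Seq, rule 1)
    qed
    have "ok n prefix_search ?ts (\<lambda>ts'. ok n ?fin ts'
        ?P)"
    proof (rule tot_conseq[OF prefix_search_correct[OF T l x(1) _ _ _ _ ne]])
      show "?ts 5 = T" "?ts 12 = x" "?ts 17 = 0" "?ts 18 = T" using ts by (simp_all add: regs_def)
    qed (rule fin)
    then show ?thesis
      by (intro tot_Seq tot_Asg[where v = 0] tot_Asg[where v = T]) (use ts in \<open>simp_all add: regs_def lits\<close>)
  qed
  have other: "ok n ?other ts ?P"
    if ts: "regs ts" "ts 11 = T" and emp: "block T T (x div 2 ^ T) = {}" for ts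
  proof -
    have br: "ok n ?adj ts'
        ?P"
      if ts': "regs ts' \<and> ts' 11 = T \<and> ts' 12 = y \<and>
      (ts' 16 = 0 \<longleftrightarrow> block T T (y div 2 ^ T) \<noteq> {}) \<and> (block T T (y div 2 ^ T) \<noteq> {} \<longrightarrow> found T y ts')" for ts'
    proof -
      have v: "ev ts' (Var 16) = Some (ts' 16)" "ev ts' (Lit 1) = Some 1" by (simp_all add: lits)
      have "f < Q" using f Qs by (simp add: is_pred_def)
      moreover have "f div (T * T) * (T * T) \<le> f" by simp
      ultimately have fw: "f div (T * T) * (T * T) < 2 ^ w"
        using bound_less[of "f div (T * T) * (T * T)"] Q1 by linarith
      have v2: "ev ts' (Var 3 [div] Var 6 [*] Var 6) = Some (f div (T * T) * (T * T))"
        using ts' fw by (simp add: regs_def)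
      show ?thesis
      proof (rule tot_If[OF v])
        assume "ts' 16 < 1"
        then have ne: "block T T (y div 2 ^ T) \<noteq> {}" using ts' by simp
        show "ok n from_slot ts' ?P"
          using ts' ne sample_pred_adjacent[OF T1 x(3,4) emp ne] by (intro slot[of _ T y]) blast+
      next
        assume "\<not> ts' 16 < 1"
        then have "block T T (y div 2 ^ T) = {}" using ts' by simp
        then show "ok n (Asg 20 (Var 3 [div] Var 6 [*] Var 6)) ts' ?P"
          using sample_pred_finger[OF T1 x(3,4) emp _ f] by (intro tot_Asg[OF v2]) simp
      qed
    qed
    have "ok n look_up (ts(12 := y)) (\<lambda>ts'. ok n
       ?adj ts' ?P)"
      by (rule tot_conseq[OF lk[of _ T y]]) (use ts x br in \<open>auto simp: regs_def\<close>)
    then show ?thesis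
      by (intro tot_Seq tot_Asg[where v = y]) (use ts in \<open>simp_all add: regs_def\<close>)
  qed
  have br: "ok n ?br ts ?P"
    if ts: "regs ts \<and> ts 11 = T \<and> ts 12 = x \<and>
      (ts 16 = 0 \<longleftrightarrow> block T T (x div 2 ^ T) \<noteq> {}) \<and> (block T T (x div 2 ^ T) \<noteq> {} \<longrightarrow> found T x ts)" for ts
  proof (rule tot_If)
    show "ev ts (Var 16) = Some (ts 16)" "ev ts (Lit 1) = Some 1" by (simp_all add: lits)
  qed (use ts own other in auto)
  have "ok n look_up (rs(12 := x, 11 := T)) (\<lambda>ts. ok n ?br ts ?P)"
  proof (rule tot_conseq[OF lk[of _ T x]])
    show "regs (rs(12 := x, 11 := T))" using rs by (simp add: regs_def)
  qed (use x br in auto)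
  then show ?thesis unfolding sample_search_def
    by (intro tot_Seq tot_Asg[where v = x] tot_Asg[where v = T]) (use rs in simp_all)
qed

text \<open>A group has at most \<open>T * T = 2 ^ (2 * l)\<close> boundaries. Squaring the sampling
  distance thus only doubles the number of rounds.\<close>

lemma group_search_correct:
  assumes T: "level T" "T = 2 ^ l" and n: "2 * l \<le> n" and sp: "sample_pred T q x" and x: "x \<le> a k"
    and rs: "rs 6 = T * T" "rs 7 = x" "rs 20 = q"
  shows "ok n group_search rs (\<lambda>rs'. is_pred (rs' 10) x)"
proof -
  have q: "q < k" "a q \<le> x" "q + T * T < k \<Longrightarrow> x < a (q + T * T)"
    using sp by (auto simp: sample_pred_def samples_def)
  have G: "T * T = 2 ^ (2 * l)" by (simp add: T power_mult power2_eq_square flip: power_mult_distrib)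
  have G1: "T * T \<ge> 1" by (simp add: G)
  \<comment> \<open>The last group is cut off at \<open>k\<close>, where the invariant imposes no
    upper limit on \<open>x\<close>; so \<open>x = a k\<close> ends up in the last child.\<close>
  define hi where "hi = min k (q + T * T)"
  define I where "I j ts \<longleftrightarrow> ts 7 = x \<and> ts 17 < ts 18 \<and> ts 18 \<le> k \<and> a (ts 17) \<le> x \<and>
     (ts 18 < k \<longrightarrow> x < a (ts 18)) \<and> ts 18 - ts 17 \<le> 2 ^ j" for j and ts :: "nat \<Rightarrow> nat"
  let ?body = "Asg 19 ((Var 17 [+] Var 18) [div] Lit 2) ;;
        If (Var 7) (arr 1 (Var 19)) (Asg 18 (Var 19)) (Asg 17 (Var 19))"
  have loop: "ok n (While (Var 17 [+] Lit 1) (Var 18) ?body) ts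
       (\<lambda>ts'. ok n (Asg 10 (Var 17)) ts' (\<lambda>rs'. is_pred (rs' 10) x))" if I0: "I (2 * l) ts" for ts
  proof (rule tot_While[where I = I and k = "2 * l"])
    show "I (2 * l) ts" "2 * l \<le> n" by fact+
    fix j ts assume I: "I j ts"
    let ?m = "(ts 17 + ts 18) div 2"
    have kk: "ts 17 < Q" "ts 18 < Q" using I Qs by (auto simp: I_def)
    then have sw: "ts 17 + ts 18 < 2 ^ w" "ts 17 + 1 < 2 ^ w"
      using Q1 bound_less[of "ts 17 + ts 18"] bound_less[of "ts 17 + 1"] by linarith+
    have v: "ev ts (Var 17 [+] Lit 1) = Some (ts 17 + 1)" "ev ts (Var 18) = Some (ts 18)"
      using sw by (simp_all add: lits)
    have step: "\<exists>j'. j = Suc j' \<and> ok 0 ?body ts (I j')" if lt: "ts 17 + 1 < ts 18"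
    proof -
      obtain j' where j': "j = Suc j'" using I lt by (cases j) (auto simp: I_def)
      have m: "ts 17 < ?m" "?m < ts 18" using lt by auto
      have d: "ts 18 - ?m \<le> 2 ^ j'" "?m - ts 17 \<le> 2 ^ j'" using I j' by (auto simp: I_def)
      have mk': "?m < k" using m I by (simp add: I_def)
      have e1: "ev ts ((Var 17 [+] Var 18) [div] Lit 2) = Some ?m"
        using sw by (simp add: lits)
      let ?ts = "ts(19 := ?m)"
      have e2: "ev ?ts (Var 7) = Some x" "ev ?ts (arr 1 (Var 19)) = Some (a ?m)"
         "ev ?ts (Var 19) = Some ?m"
        using I mk' starts by (simp_all add: val_arr I_def)
      have "ok 0 ?body ts (I j')"
      proof (rule tot_Seq, rule tot_Asg[OF e1], rule tot_If[OF e2(1,2)])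
        assume "x < a ?m"
        then have "I j' (?ts(18 := ?m))" using I m d by (auto simp: I_def)
        then show "ok 0 (Asg 18 (Var 19)) ?ts (I j')" by (rule tot_Asg[OF e2(3)])
      next
        assume "\<not> x < a ?m"
        then have "I j' (?ts(17 := ?m))" using I m d by (auto simp: I_def)
        then show "ok 0 (Asg 17 (Var 19)) ?ts (I j')" by (rule tot_Asg[OF e2(3)])
      qed
      then show ?thesis using j' by blast
    qed
    have stop: "ok n (Asg 10 (Var 17)) ts (\<lambda>rs'. is_pred (rs' 10) x)" if "\<not> ts 17 + 1 < ts 18"
    proof -
      have "ts 18 = ts 17 + 1" using that I by (auto simp: I_def)
      then have "is_pred (ts 17) x" using I by (auto simp: I_def is_pred_def)
      then show ?thesis by (intro tot_Asg[where v = "ts 17"]) simp_all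
    qed
    show "\<exists>xa y. ev ts (Var 17 [+] Lit 1) = Some xa \<and> ev ts (Var 18) = Some y \<and>
      (xa < y \<longrightarrow> (\<exists>k'. j = Suc k' \<and> ok 0 ?body ts (I k'))) \<and>
      (\<not> xa < y \<longrightarrow> ok n (Asg 10 (Var 17)) ts (\<lambda>rs'. is_pred (rs' 10) x))"
      using v step stop by blast
  qed
  have I0: "I (2 * l) ts" if "ts 7 = x" "ts 17 = q" "ts 18 = hi" for ts
    using that q G1 unfolding I_def hi_def G[symmetric] by (auto simp: min_def)
  have sw: "q + T * T < 2 ^ w"
    using level_bound(3)[OF T(1)] q Qs Q1 bound_less[of "q + T * T"] by linarith
  let ?rs = "rs(17 := q, 18 := q + T * T)"
  have e1: "ev rs (Var 20) = Some q" using rs by simp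
  have e2: "ev (rs(17 := q)) (Var 20 [+] Var 6) = Some (q + T * T)" using rs sw by simp
  have e3: "ev ?rs (arr 0 (Lit 6)) = Some k" "ev ?rs (Var 18) = Some (q + T * T)"
    "ev ?rs (Lit 0) = Some 0" by (simp_all add: val_arr lits params)
  have rest: "ok n (While (Var 17 [+] Lit 1) (Var 18) ?body ;; Asg 10 (Var 17)) ts (\<lambda>rs'. is_pred (rs' 10) x)"
    if "ts 7 = x" "ts 17 = q" "ts 18 = hi" for ts
    by (rule tot_Seq, rule loop, rule I0) (use that in auto)
  have "ok n (If (arr 0 (Lit 6)) (Var 18) (Asg 18 (arr 0 (Lit 6))) (Asg 16 (Lit 0))) ?rs
      (\<lambda>ts. ok n (While (Var 17 [+] Lit 1) (Var 18) ?body ;; Asg 10 (Var 17)) ts (\<lambda>rs'. is_pred (rs' 10) x))"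
    (is "tot _ _ _ _ _ ?R")
  proof (rule tot_If[OF e3(1,2)])
    assume "k < q + T * T"
    then show "ok n (Asg 18 (arr 0 (Lit 6))) ?rs ?R"
      by (intro tot_Asg[OF e3(1)] rest) (use rs in \<open>simp_all add: hi_def\<close>)
  next
    assume "\<not> k < q + T * T"
    then show "ok n (Asg 16 (Lit 0)) ?rs ?R"
      by (intro tot_Asg[OF e3(3)] rest) (use rs in \<open>simp_all add: hi_def\<close>)
  qed
  then show ?thesis unfolding group_search_def
    by (intro tot_Seq tot_Asg[OF e1] tot_Asg[OF e2])
qed

end

section \<open>Prefix fingerprints and the complete query\<close>

definition level_of :: "nat \<Rightarrow> nat" where
  "level_of D = (LEAST l. D + 2 \<le> 2 ^ 2 ^ l)"

lemma level_of: "D + 2 \<le> 2 ^ 2 ^ level_of D"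
proof -
  have "D + 2 \<le> 2 ^ 2 ^ (D + 2)"
    using less_exp[of "D + 2"] less_exp[of "2 ^ (D + 2)"] by linarith
  then show ?thesis unfolding level_of_def by (rule LeastI)
qed

lemma level_of_less: "l < level_of D \<Longrightarrow> 2 ^ 2 ^ l \<le> D + 1"
  using not_less_Least[of l "\<lambda>l. D + 2 \<le> 2 ^ 2 ^ l"] by (simp add: level_of_def)

context query_memory begin

definition S where "S = concat Ls"

lemma ak: "a k = length S" by (simp add: a_eq k_eq S_def)

lemma concat_split: "g < k \<Longrightarrow> S = concat (take g Ls) @ Ls ! g @ concat (drop (Suc g) Ls)"
  unfolding S_def k_eq by (metis append_take_drop_id concat.simps(2) concat_append Cons_nth_drop_Suc)

lemma a_Suc: "g < k \<Longrightarrow> a (Suc g) = a g + length (Ls ! g)"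
  by (simp add: a_eq k_eq take_Suc_conv_app_nth)

text \<open>The prefix of length \<open>x\<close> consists of the first \<open>g\<close> children
  and a prefix \<open>u\<close> of the next one, and its fingerprint is composed from their stored
  ones. The number of \<open>u\<close> stays in register 23, from where the query reads its inverse
  power.\<close>

lemma prefix_print_correct:
  assumes g: "is_pred g x" and x: "x \<le> a k" and rs: "rs 7 = x" "rs 10 = g"
  shows "ok n prefix_print rs (\<lambda>rs'. rs' 10 = g \<and> rs' 24 = fingerprint c p (take x S) \<and>
     rs' 23 < length (A 12) \<and> A 12 ! rs' 23 = e ^ (x - a g) mod p)"
proof -
  have gk: "g < k" "a g \<le> x" and up: "x \<le> a (Suc g)"
    using g x by (cases "Suc g < k", auto simp: is_pred_def) (metis Suc_lessI)
  define v where "v = Ls ! g"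
  define l where "l = x - a g"
  define u where "u = take l v"
  have v: "v \<in> V" using child(6)[OF gk(1)] by (simp add: v_def)
  have u: "u \<in> V" using take_V[OF v] by (simp add: u_def)
  have lv: "l \<le> length v" using up gk a_Suc[OF gk(1)] by (simp add: l_def v_def)
  have lu: "length u = l" using lv by (simp add: u_def)
  have xQ: "x < Q" using x Qs by simp
  have lw: "l < 2 ^ w" using bound_less[of l] xQ Q1 unfolding l_def by linarith
  note ch = child(1)[OF gk(1)]
  have len: "g < length (A 2)" "g < length (A 3)" "g < length (A 4)" "g < length (A 5)"
    using ch by simp_all
  have nd: "idx z < length (A 6)" "idx z < length (A 7)" "idx z < length (A 8)" "idx z < length (A 9)"
     "idx z < length (A 10)" "idx z < length (A 11)" "idx z < length (A 12)" if "z \<in> V" for z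
    using node(1)[OF that] by simp_all
  have lt2: "x < 2 ^ w" using bound_less[of x] xQ Q1 by simp
  have e1: "ev rs (Var 7 [-] arr 1 (Var 10)) = Some l"
    using gk starts lt2 by (simp add: val_arr rs sub_mod l_def)
  have e2: "ev (rs(21 := l)) (arr 2 (Var 10)) = Some (idx v)"
    using gk len child(2) by (simp add: val_arr rs v_def)
  let ?rs = "rs(21 := l, 22 := idx v)"
  have e3: "ev ?rs (Var 21) = Some l" "ev ?rs (arr 6 (Var 22)) = Some (md v)"
    using nd[OF v] node(2)[OF v] by (simp_all add: val_arr)
  have e4: "ev ?rs (arr 13 (arr 14 (arr 7 (Var 22) [+] arr 15 (arr 8 (Var 22) [-] Var 21)) [-] Var 21)) = Some (idx u)"
    if lt: "l < md v"
  proof -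
    note m = tables[unfolded ancestor_tables_def, rule_format, OF v lv, unfolded if_P[OF lt]]
    have ld: "ld v < Q" using Q[of 8 "idx v"] nd[OF v] node(4)[OF v] by simp
    then have ldw: "ld v < 2 ^ w" using bound_less[of "ld v"] Q1 by simp
    have jb: "jb v < Q" using Q[of 7 "idx v"] nd[OF v] node(3)[OF v] by simp
    have "A 15 ! (ld v - l) < Q" using Q[of 15] m by simp
    then have s1: "jb v + A 15 ! (ld v - l) < 2 ^ w"
      using jb bound_less[of "jb v + A 15 ! (ld v - l)"] Q1 by linarith
    have "A 14 ! (jb v + A 15 ! (ld v - l)) < Q" using Q[of 14] m by simp
    then have s2: "A 14 ! (jb v + A 15 ! (ld v - l)) < 2 ^ w"
      using bound_less[of "A 14 ! (jb v + A 15 ! (ld v - l))"] Q1 by simp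
    have "ev ?rs (arr 8 (Var 22) [-] Var 21) = Some (ld v - l)"
      using nd[OF v] node(4)[OF v] m ldw by (simp add: val_arr sub_mod)
    from val_arr[OF this, of 15] have "ev ?rs (arr 15 (arr 8 (Var 22) [-] Var 21)) = Some (A 15 ! (ld v - l))"
      using m by simp
    then have "ev ?rs (arr 7 (Var 22) [+] arr 15 (arr 8 (Var 22) [-] Var 21)) = Some (jb v + A 15 ! (ld v - l))"
      using nd[OF v] node(3)[OF v] s1 by (simp add: val_arr)
    from val_arr[OF this, of 14]
    have "ev ?rs (arr 14 (arr 7 (Var 22) [+] arr 15 (arr 8 (Var 22) [-] Var 21)) [-] Var 21)
        = Some (A 14 ! (jb v + A 15 ! (ld v - l)) - l)"
      using m s2 by (simp add: sub_mod)
    from val_arr[OF this, of 13] show ?thesis using m by (simp add: u_def)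
  qed
  have e5: "ev ?rs (arr 16 (arr 9 (Var 22) [+]
          arr 17 (arr 10 (Var 22) [*] arr 0 (Lit 5) [+] (Var 21 [-] arr 6 (Var 22))))) = Some (idx u)"
    if ge: "\<not> l < md v"
  proof -
    have ge': "md v \<le> l" using ge by simp
    note m = tables[unfolded ancestor_tables_def, rule_format, OF v lv, unfolded if_not_P[OF ge]]
    have mk: "mk v < Q" using Q[of 10 "idx v"] nd[OF v] node(6)[OF v] by simp
    have "l - md v \<le> 40 * (Q * Q)" using xQ Q1 unfolding l_def by linarith
    then have s1: "mk v * s + (l - md v) < 2 ^ w" using bound[OF mk Qs(5)] by blast
    then have s0: "mk v * s < 2 ^ w" "l - md v < 2 ^ w" by linarith+
    have mb: "mb v < Q" using Q[of 9 "idx v"] nd[OF v] node(5)[OF v] by simp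
    have "A 17 ! (mk v * s + (l - md v)) < Q" using Q[of 17] m by simp
    then have s2: "mb v + A 17 ! (mk v * s + (l - md v)) < 2 ^ w"
      using mb Q1 bound_less[of "mb v + A 17 ! (mk v * s + (l - md v))"] by linarith
    have "ev ?rs (arr 10 (Var 22) [*] arr 0 (Lit 5) [+] (Var 21 [-] arr 6 (Var 22))) = Some (mk v * s + (l - md v))"
      using nd[OF v] node(2,6)[OF v] s1 s0 ge' lw by (simp add: val_arr sub_mod lits params)
    from val_arr[OF this, of 17]
    have "ev ?rs (arr 9 (Var 22) [+] arr 17 (arr 10 (Var 22) [*] arr 0 (Lit 5) [+] (Var 21 [-] arr 6 (Var 22))))
        = Some (mb v + A 17 ! (mk v * s + (l - md v)))"
      using m nd[OF v] node(5)[OF v] s2 by (simp add: val_arr)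
    from val_arr[OF this, of 16] show ?thesis using m by (simp add: u_def)
  qed
  let ?ts = "?rs(23 := idx u)"
  let ?F = "(fingerprint c p (concat (take g Ls)) + (c ^ a g mod p) * fingerprint c p u) mod p"
  have e6: "ev ?ts ((arr 3 (Var 10) [+] arr 4 (Var 10) [*] arr 11 (Var 23)) [mod] arr 0 (Lit 1)) = Some ?F"
  proof -
    have "A 4 ! g < Q" "A 11 ! idx u < Q" "A 3 ! g < Q" using Q[of 4 g] Q[of 11 "idx u"] Q[of 3 g] len nd[OF u] by simp_all
    then have "A 4 ! g * A 11 ! idx u + A 3 ! g < 2 ^ w" using Q1 by (intro bound) linarith+
    then have "A 3 ! g + (c ^ a g mod p) * fingerprint c p u < 2 ^ w" "(c ^ a g mod p) * fingerprint c p u < 2 ^ w"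
      using child(4)[OF gk(1)] node(7)[OF u] by (simp_all add: add.commute)
    then show ?thesis
      using len nd[OF u] child(3,4)[OF gk(1)] node(7)[OF u] by (simp add: val_arr rs lits params)
  qed
  have "take x S = concat (take g Ls) @ u"
    unfolding concat_split[OF gk(1)] using gk lv by (simp add: a_eq u_def v_def l_def)
  then have F: "?F = fingerprint c p (take x S)"
    by (simp add: fingerprint_append a_eq[symmetric]) (metis mod_add_right_eq mod_mult_left_eq)
  have fin: "ok n (Asg 24 ((arr 3 (Var 10) [+] arr 4 (Var 10) [*] arr 11 (Var 23)) [mod] arr 0 (Lit 1))) ?ts
    (\<lambda>rs'. rs' 10 = g \<and> rs' 24 = fingerprint c p (take x S) \<and>
     rs' 23 < length (A 12) \<and> A 12 ! rs' 23 = e ^ (x - a g) mod p)"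
    by (rule tot_Asg[OF e6]) (use nd[OF u] node(8)[OF u] lu F in \<open>simp add: l_def rs\<close>)
  show ?thesis unfolding prefix_print_def
    by (rule tot_Seq, rule tot_Asg[OF e1], rule tot_Seq, rule tot_Asg[OF e2], rule tot_Seq,
        rule tot_If[OF e3], rule tot_Asg[OF e4], assumption, rule fin, rule tot_Asg[OF e5], assumption, rule fin)
qed

lemma locate_correct:
  assumes T: "level T" and l: "T = 2 ^ l" "2 * l + 1 \<le> n"
    and x: "x \<le> a k" "y \<le> a k" "x < y + 2 ^ T" "y < x + 2 ^ T" and f: "is_pred f y"
    and rs: "rs 3 = f" "rs 4 = y" "rs 5 = T" "rs 6 = T * T" "rs 7 = x"
  shows "ok n locate rs (\<lambda>rs'. rs' 24 = fingerprint c p (take x S) \<and> rs' 10 < k \<and> a (rs' 10) \<le> x \<and>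
     rs' 23 < length (A 12) \<and> A 12 ! rs' 23 = e ^ (x - a (rs' 10)) mod p)"
proof -
  let ?P = "\<lambda>rs'. rs' 24 = fingerprint c p (take x S) \<and> rs' 10 < k \<and> a (rs' 10) \<le> x \<and>
     rs' 23 < length (A 12) \<and> A 12 ! rs' 23 = e ^ (x - a (rs' 10)) mod p"
  have 3: "ok n prefix_print ts ?P" if "is_pred (ts 10) x" "ts 7 = x" for ts
    by (rule tot_conseq[OF prefix_print_correct[OF that(1) x(1) that(2) refl]])
      (use that in \<open>auto simp: is_pred_def\<close>)
  have 2: "ok n (group_search ;; prefix_print) ts ?P"
    if "sample_pred T (ts 20) x" "ts 6 = T * T" "ts 7 = x" for ts
  proof (rule tot_Seq, rule tot_conseq[OF group_search_correct[OF T l(1) _ that(1) x(1) that(2,3) refl]])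
    show "2 * l \<le> n" using l by simp
  qed (rule 3, use that in \<open>simp_all add: writes_simps\<close>)
  show ?thesis unfolding locate_def
  proof (rule tot_Seq, rule tot_conseq[OF sample_search_correct[OF T l(1) _ x f rs]])
    show "l + 1 \<le> n" using l by simp
  qed (rule 2, use rs in \<open>simp_all add: writes_simps\<close>)
qed

text \<open>For a finger of position \<open>j\<close> the search starts from \<open>j - 1\<close> and not from \<open>j\<close>, because the
  children are delimited by the half-open intervals \<open>{a g..<a (g + 1)}\<close>.\<close>

lemma choose_finger_correct:
  assumes rs: "rs 0 = i" "rs 1 = j" "rs 2 = f" and ij: "1 \<le> i" "i \<le> j" "j \<le> a k"
    and f: "1 \<le> f" "f \<le> k" "(a (f - 1) < i \<and> i \<le> a f) \<or> (a (f - 1) < j \<and> j \<le> a f)"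
  shows "ok n choose_finger rs (\<lambda>rs'. rs' 3 = f - 1 \<and> is_pred (f - 1) (rs' 4) \<and> (rs' 4 = i - 1 \<or> rs' 4 = j - 1))"
    (is "tot _ _ _ _ _ ?P")
proof -
  have w1: "i < 2 ^ w" "j < 2 ^ w" "f < 2 ^ w"
    using ij f Qs Q1 bound_less[of i] bound_less[of j] bound_less[of f] by linarith+
  have e1: "ev rs (Var 2 [-] Lit 1) = Some (f - 1)" using rs w1 f by (simp add: lits sub_mod)
  have e2: "ev (rs(3 := f - 1)) (Var 1 [-] Lit 1) = Some (j - 1)" using rs w1 ij by (simp add: lits sub_mod)
  let ?rs = "rs(3 := f - 1, 4 := j - 1)"
  have e3: "ev ?rs (Var 0 [-] Lit 1) = Some (i - 1)" using rs w1 ij by (simp add: lits sub_mod)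
  have e4: "ev ?rs (arr 1 (Var 3)) = Some (a (f - 1))" "ev ?rs (arr 1 (Var 2)) = Some (a f)"
    "ev ?rs (Lit 0) = Some 0"
    using rs f starts by (simp_all add: val_arr lits)
  have ip: "is_pred (f - 1) z" if "a (f - 1) \<le> z" "z < a f" for z using that f by (simp add: is_pred_def)
  \<comment> \<open>If \<open>i - 1\<close> lies in the child, it can serve as the position of the
    finger whichever end was meant. Otherwise the finger must be one for \<open>j\<close>.\<close>
  have I: "i - 1 < a (f - 1) \<Longrightarrow> is_pred (f - 1) (j - 1)" "\<not> i - 1 < a f \<Longrightarrow> is_pred (f - 1) (j - 1)"
    "\<not> i - 1 < a (f - 1) \<Longrightarrow> i - 1 < a f \<Longrightarrow> is_pred (f - 1) (i - 1)"
    by (rule ip; use ij f(3) in auto)+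
  have "ok n (If (Var 0 [-] Lit 1) (arr 1 (Var 3)) (Asg 16 (Lit 0))
       (If (Var 0 [-] Lit 1) (arr 1 (Var 2)) (Asg 4 (Var 0 [-] Lit 1)) (Asg 16 (Lit 0)))) ?rs ?P"
  proof (rule tot_If[OF e3 e4(1)])
    assume "i - 1 < a (f - 1)"
    then show "ok n (Asg 16 (Lit 0)) ?rs ?P" using I by (intro tot_Asg[OF e4(3)]) simp
  next
    assume ge: "\<not> i - 1 < a (f - 1)"
    show "ok n (If (Var 0 [-] Lit 1) (arr 1 (Var 2)) (Asg 4 (Var 0 [-] Lit 1)) (Asg 16 (Lit 0))) ?rs ?P"
    proof (rule tot_If[OF e3 e4(2)])
      assume "i - 1 < a f"
      then show "ok n (Asg 4 (Var 0 [-] Lit 1)) ?rs ?P" using I ge by (intro tot_Asg[OF e3]) simp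
    next
      assume "\<not> i - 1 < a f"
      then show "ok n (Asg 16 (Lit 0)) ?rs ?P" using I by (intro tot_Asg[OF e4(3)]) simp
    qed
  qed
  then show ?thesis unfolding choose_finger_def
    by (intro tot_Seq tot_Asg[OF e1] tot_Asg[OF e2])
qed

lemma level_level_of: "l \<le> level_of D \<Longrightarrow> D + 1 \<le> a k \<Longrightarrow> level (2 ^ l)"
  unfolding level_def using level_of_less[of "l - 1" D] by (intro exI[of _ l]) (cases l, auto)

lemma choose_level_correct:
  assumes rs: "rs 0 = i" "rs 1 = j" and ij: "1 \<le> i" "i \<le> j" "j \<le> a k" and n: "level_of (j - i) \<le> n"
  shows "ok n choose_level rs (\<lambda>rs'. rs' 5 = 2 ^ level_of (j - i) \<and> rs' 6 = rs' 5 * rs' 5)" (is "tot _ _ _ _ _ ?P")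
proof -
  let ?D = "j - i"
  have D: "?D + 1 \<le> a k" using ij by linarith
  define I where "I r ts \<longleftrightarrow> r \<le> level_of ?D \<and> ts 5 = 2 ^ (level_of ?D - r) \<and> ts 6 = ts 5 * ts 5 \<and> ts 11 = ?D + 2"
    for r and ts :: "nat \<Rightarrow> nat"
  let ?body = "Asg 5 (Var 5 [*] Lit 2) ;; Asg 6 (Var 6 [*] Lit 4)"
  have loop: "ok n (While (Bin Shl (Lit 1) (Var 5)) (Var 11) ?body) ts ?P"
    if I0: "I (level_of ?D) ts" for ts
  proof (rule tot_While[where I = I and k = "level_of ?D"])
    show "I (level_of ?D) ts" "level_of ?D \<le> n" by fact+
    fix r ts assume I: "I r ts"
    define l where "l = level_of ?D - r"
    have t: "ts 5 = 2 ^ l" "ts 6 = 2 ^ l * 2 ^ l" "ts 11 = ?D + 2" using I by (simp_all add: I_def l_def)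
    have lev: "level (2 ^ l)" by (rule level_level_of[OF _ D]) (simp add: l_def)
    note lb = level_bound[OF lev]
    have p: "(2::nat) ^ 2 ^ l < 2 ^ w" using bound_less lb(4) by simp
    have v: "ev ts (Bin Shl (Lit 1) (Var 5)) = Some (2 ^ 2 ^ l)" "ev ts (Var 11) = Some (?D + 2)"
      using t p by (simp_all add: lits push_bit_eq_mult)
    have T1: "(2::nat) ^ l \<le> 2 ^ l * 2 ^ l" by simp
    have bd: "2 ^ l * 2 < (2::nat) ^ w" "2 ^ l * 2 ^ l * 4 < (2::nat) ^ w"
      using bound_less[of "2 ^ l * 2"] bound_less[of "2 ^ l * 2 ^ l * 4"] lb(3) T1 by linarith+
    have step: "\<exists>r'. r = Suc r' \<and> ok 0 ?body ts (I r')" if lt: "2 ^ 2 ^ l < ?D + 2"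
    proof -
      have "r \<noteq> 0"
      proof
        assume "r = 0"
        then have "l = level_of ?D" by (simp add: l_def)
        then show False using lt level_of[of ?D] by simp
      qed
      then obtain r' where r: "r = Suc r'" by (cases r) auto
      then have l': "level_of ?D - r' = Suc l" using I unfolding I_def l_def by linarith
      have e1: "ev ts (Var 5 [*] Lit 2) = Some (2 ^ l * 2)" using t bd by (simp add: lits)
      have e2: "ev (ts(5 := 2 ^ l * 2)) (Var 6 [*] Lit 4) = Some (2 ^ l * 2 ^ l * 4)"
        using t bd by (simp add: lits)
      have "I r' (ts(5 := 2 ^ l * 2, 6 := 2 ^ l * 2 ^ l * 4))"
        using I t r l' by (simp add: I_def)
      then have "ok 0 ?body ts (I r')" by (intro tot_Seq tot_Asg[OF e1] tot_Asg[OF e2])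
      then show ?thesis using r by blast
    qed
    have stop: "?P ts" if "\<not> 2 ^ 2 ^ l < ?D + 2"
    proof -
      have "r = 0"
      proof (rule ccontr)
        assume "r \<noteq> 0"
        then have "l < level_of ?D" using I by (auto simp: l_def I_def)
        then show False using level_of_less[of l ?D] that by simp
      qed
      then show ?thesis using t by (simp add: l_def)
    qed
    show "\<exists>x y. ev ts (Bin Shl (Lit 1) (Var 5)) = Some x \<and> ev ts (Var 11) = Some y \<and>
      (x < y \<longrightarrow> (\<exists>k'. r = Suc k' \<and> ok 0 ?body ts (I k'))) \<and> (\<not> x < y \<longrightarrow> ?P ts)"
      using v step stop by blast
  qed
  have jw: "j < 2 ^ w" "?D + 2 < 2 ^ w" "?D < 2 ^ w"
    using ij Qs Q1 bound_less[of j] bound_less[of "?D + 2"] bound_less[of ?D] by linarith+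
  have e1: "ev rs (Lit 1) = Some 1" "ev (rs(5 := 1)) (Lit 1) = Some 1" by (simp_all add: lits)
  have e2: "ev (rs(5 := 1, 6 := 1)) (Var 1 [-] Var 0 [+] Lit 2) = Some (?D + 2)"
    using rs jw ij by (simp add: sub_mod lits)
  have I0: "I (level_of ?D) (rs(5 := 1, 6 := 1, 11 := ?D + 2))" by (simp add: I_def)
  show ?thesis unfolding choose_level_def
    by (rule tot_Seq, rule tot_Asg[OF e1(1)], rule tot_Seq, rule tot_Asg[OF e1(2)], rule tot_Seq,
        rule tot_Asg[OF e2], rule loop, rule I0)
qed

lemma power_inverse: "c ^ t * e ^ t mod p = 1"
proof -
  have "c ^ t * e ^ t mod p = (c * e mod p) ^ t mod p"
    by (simp add: power_mult_distrib power_mod)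
  then show ?thesis using inverse p by simp
qed

lemma fingerprint_quotient:
  assumes "1 \<le> i" "i \<le> j" "j \<le> length S"
  shows "(fingerprint c p (take j S) + p - fingerprint c p (take (i - 1) S)) mod p * (e ^ (i - 1) mod p) mod p
    = fingerprint c p (substring S i j)"
proof -
  let ?x = "take (i - 1) S" and ?y = "substring S i j"
  let ?X = "fingerprint c p ?x" and ?Y = "fingerprint c p ?y"
  have "take j S = ?x @ take (j - (i - 1)) (drop (i - 1) S)"
    using assms take_add[of "i - 1" "j - (i - 1)" S] by simp
  then have "take j S = ?x @ ?y" using assms by (simp add: substring_def Suc_diff_le)
  then have F: "fingerprint c p (take j S) = (?X + c ^ (i - 1) * ?Y) mod p"
    using assms by (simp add: fingerprint_append)
  have Xp: "?X < p" using p by (simp add: fingerprint_def)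
  \<comment> \<open>The summand \<open>p\<close> keeps the truncated subtraction exact.\<close>
  have "((?X + c ^ (i - 1) * ?Y) mod p + p - ?X) mod p = ((?X + c ^ (i - 1) * ?Y) mod p + (p - ?X)) mod p"
    using Xp by simp
  also have "\<dots> = (?X + c ^ (i - 1) * ?Y + (p - ?X)) mod p" by (rule mod_add_left_eq)
  also have "?X + c ^ (i - 1) * ?Y + (p - ?X) = c ^ (i - 1) * ?Y + p" using Xp by simp
  finally have "(fingerprint c p (take j S) + p - ?X) mod p * (e ^ (i - 1) mod p) mod p =
      (c ^ (i - 1) * ?Y) * e ^ (i - 1) mod p"
    unfolding F by (simp add: mod_mult_eq)
  also have "(c ^ (i - 1) * ?Y) * e ^ (i - 1) = (c ^ (i - 1) * e ^ (i - 1)) * ?Y" by (simp only: mult_ac)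
  also have "\<dots> mod p = (c ^ (i - 1) * e ^ (i - 1) mod p) * ?Y mod p" by (rule mod_mult_left_eq[symmetric])
  also have "\<dots> = ?Y" unfolding power_inverse by simp
  finally show ?thesis .
qed

text \<open>The bound \<open>n\<close> covers all loops: for level \<open>l\<close>, there are
  \<open>l\<close> rounds for choosing it, \<open>l + 1\<close> for the prefix search and
  \<open>2 * l\<close> inside a group.\<close>

lemma query_correct:
  assumes rs: "rs 0 = i" "rs 1 = j" "rs 2 = f" and ij: "1 \<le> i" "i \<le> j" "j \<le> a k"
    and f: "1 \<le> f" "f \<le> k" "(a (f - 1) < i \<and> i \<le> a f) \<or> (a (f - 1) < j \<and> j \<le> a f)"
    and n: "2 * level_of (j - i) + 1 \<le> n"
  shows "ok n query rs (\<lambda>rs'. rs' 0 = fingerprint c p (substring S i j))" (is "tot _ _ _ _ _ ?P")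
proof -
  let ?l = "level_of (j - i)"
  let ?T = "2 ^ ?l :: nat"
  let ?tail = "Asg 0 ((Var 24 [+] arr 0 (Lit 1) [-] Var 8) [mod] arr 0 (Lit 1) [*] Var 9 [mod] arr 0 (Lit 1))"
  let ?mid = "Asg 8 (Var 24) ;; Asg 9 ((arr 5 (Var 10) [*] arr 12 (Var 23)) [mod] arr 0 (Lit 1)) ;;
      Asg 7 (Var 1) ;; locate ;; ?tail"
  have D: "j - i + 1 \<le> a k" using ij by linarith
  have T: "level ?T" using level_level_of[OF order_refl D] .
  have TD: "j - i + 1 < 2 ^ ?T" using level_of[of "j - i"] by simp
  have w1: "i < 2 ^ w" "j < 2 ^ w" using ij Qs Q1 bound_less[of i] bound_less[of j] by linarith+
  define base where "base ts \<longleftrightarrow> ts 0 = i \<and> ts 1 = j \<and> ts 3 = f - 1 \<and> is_pred (f - 1) (ts 4) \<and>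
    (ts 4 = i - 1 \<or> ts 4 = j - 1) \<and> ts 5 = ?T \<and> ts 6 = ?T * ?T" for ts :: "nat \<Rightarrow> nat"
  have loc: "ok n locate ts (\<lambda>rs'. base rs' \<and> rs' 8 = ts 8 \<and> rs' 9 = ts 9 \<and>
      rs' 24 = fingerprint c p (take x S) \<and> rs' 10 < k \<and> a (rs' 10) \<le> x \<and>
     rs' 23 < length (A 12) \<and> A 12 ! rs' 23 = e ^ (x - a (rs' 10)) mod p)"
    if b: "base ts" "ts 7 = x" and x: "x = i - 1 \<or> x = j" for ts x
  proof (rule tot_conseq[OF locate_correct[OF T refl n, where x = x and y = "ts 4" and f = "f - 1" and rs = ts]])
    have "ts 4 = i - 1 \<or> ts 4 = j - 1" using b by (simp add: base_def)
    then show "x \<le> a k" "ts 4 \<le> a k" "x < ts 4 + 2 ^ ?T" "ts 4 < x + 2 ^ ?T"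
      using x ij TD by auto
  qed (use b in \<open>simp_all add: base_def writes_simps\<close>)
  have fp: "fingerprint c p z < p" for z using p by (simp add: fingerprint_def)
  have tail: "ok n ?tail ts ?P"
    if t: "ts 8 = fingerprint c p (take (i - 1) S)" "ts 9 = e ^ (i - 1) mod p"
      "ts 24 = fingerprint c p (take j S)" for ts
  proof -
    let ?u = "fingerprint c p (take j S)" and ?v = "fingerprint c p (take (i - 1) S)"
    have s1: "?u + p < 2 ^ w" using fp[of "take j S"] Qs Q1 bound_less[of "?u + p"] by linarith
    have s2: "?v \<le> ?u + p" using fp[of "take (i - 1) S"] by linarith
    have q: "(?u + p - ?v) mod p < Q" "e ^ (i - 1) mod p < Q" using p Qs by (meson less_trans mod_less_divisor zero_less_one)+
    have s3: "(?u + p - ?v) mod p * (e ^ (i - 1) mod p) < 2 ^ w" using bound[OF q, of 0] by simp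
    have "ev ts ((Var 24 [+] arr 0 (Lit 1) [-] Var 8) [mod] arr 0 (Lit 1) [*] Var 9 [mod] arr 0 (Lit 1))
        = Some ((?u + p - ?v) mod p * (e ^ (i - 1) mod p) mod p)"
      using t s1 s2 s3 by (simp add: val_arr lits params sub_mod)
    then show ?thesis
      by (rule tot_Asg) (use fingerprint_quotient ij ak in simp)
  qed
  have mid: "ok n ?mid ts ?P"
    if t: "base ts" "ts 24 = fingerprint c p (take (i - 1) S)" "ts 10 < k" "a (ts 10) \<le> i - 1"
     "ts 23 < length (A 12)" "A 12 ! ts 23 = e ^ (i - 1 - a (ts 10)) mod p" for ts
  proof -
    let ?ts1 = "ts(8 := fingerprint c p (take (i - 1) S))"
    have e1: "ev ts (Var 24) = Some (fingerprint c p (take (i - 1) S))" using t by simp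
    have g5: "ts 10 < length (A 5)" using child(1)[OF t(3), of 5] by simp
    have "A 5 ! ts 10 < Q" "A 12 ! ts 23 < Q" using Q[of 5 "ts 10"] Q[of 12 "ts 23"] g5 t by simp_all
    then have s: "A 5 ! ts 10 * A 12 ! ts 23 < 2 ^ w" using bound[of _ _ 0] by simp
    have "A 5 ! ts 10 * A 12 ! ts 23 mod p = e ^ a (ts 10) * e ^ (i - 1 - a (ts 10)) mod p"
      using child(5)[OF t(3)] t(6) by (simp add: mod_mult_eq)
    also have "\<dots> = e ^ (i - 1) mod p" using t(4) by (metis power_add le_add_diff_inverse)
    finally have e2: "ev ?ts1 ((arr 5 (Var 10) [*] arr 12 (Var 23)) [mod] arr 0 (Lit 1)) = Some (e ^ (i - 1) mod p)"
      using s g5 t by (simp add: val_arr lits params)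
    let ?ts2 = "?ts1(9 := e ^ (i - 1) mod p)"
    have e3: "ev ?ts2 (Var 1) = Some j" using t by (simp add: base_def)
    have "ok n locate (?ts2(7 := j)) (\<lambda>ts. ok n ?tail ts ?P)"
      by (rule tot_conseq[OF loc[where x = j]]) (use t tail in \<open>simp_all add: base_def\<close>)
    then show ?thesis
      by (intro tot_Seq tot_Asg[OF e1] tot_Asg[OF e2] tot_Asg[OF e3])
  qed
  have main: "ok n (Asg 7 (Var 0 [-] Lit 1) ;; locate ;; ?mid) ts ?P" if b: "base ts" for ts
  proof -
    have e1: "ev ts (Var 0 [-] Lit 1) = Some (i - 1)" using b w1 ij by (simp add: base_def lits sub_mod)
    have "ok n locate (ts(7 := i - 1)) (\<lambda>ts. ok n ?mid ts ?P)"
      by (rule tot_conseq[OF loc[where x = "i - 1"]]) (use b mid in \<open>simp_all add: base_def\<close>)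
    then show ?thesis by (intro tot_Seq tot_Asg[OF e1])
  qed
  have lev: "ok n (choose_level ;; Asg 7 (Var 0 [-] Lit 1) ;; locate ;; ?mid) ts ?P"
    if "ts 0 = i" "ts 1 = j" "ts 3 = f - 1 \<and> is_pred (f - 1) (ts 4) \<and> (ts 4 = i - 1 \<or> ts 4 = j - 1)" for ts
  proof (rule tot_Seq, rule tot_conseq[OF choose_level_correct[OF that(1,2) ij]])
    show "?l \<le> n" using n by simp
  qed (rule main, use that in \<open>simp_all add: base_def writes_simps\<close>)
  have all: "ok n (choose_finger ;; choose_level ;; Asg 7 (Var 0 [-] Lit 1) ;; locate ;; ?mid) rs ?P"
    by (rule tot_Seq, rule tot_conseq[OF choose_finger_correct[OF rs ij f]], rule lev)
      (use rs in \<open>simp_all add: writes_simps\<close>)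
  have e0: "ev rs (Lit 0) = Some 0" "ev rs (arr 0 (Lit 0)) = Some 0"
    by (simp_all add: val_arr lits params)
  show ?thesis unfolding query_def by (rule tot_If[OF e0]) (use all in simp_all)
qed

end

section \<open>The data structure\<close>

lemma sum_div_power_2: "(\<Sum>l<n. k div 2 ^ l) \<le> 2 * (k::nat)"
proof (induction n arbitrary: k)
  case (Suc n)
  have "(\<Sum>l<Suc n. k div 2 ^ l) = k + (\<Sum>l<n. (k div 2) div 2 ^ l)"
    by (simp add: sum.lessThan_Suc_shift div_mult2_eq del: sum.lessThan_Suc)
  also have "\<dots> \<le> k + 2 * (k div 2)" using Suc by simp
  finally show ?case by linarith
qed simp

context boundaries begin

definition keys :: "(nat \<times> nat \<times> nat) set" where
  "keys = {(T, h, v). level T \<and> h \<le> T \<and> block T h v \<noteq> {}}"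

lemma card_samples: "card (samples (2 ^ l)) \<le> k div 4 ^ l + 1"
proof -
  have "(2::nat) ^ l * 2 ^ l = 4 ^ l" by (simp flip: power_mult_distrib)
  then have "samples (2 ^ l) \<subseteq> (\<lambda>q. 4 ^ l * q) ` {..k div 4 ^ l}"
    by (auto simp: samples_def div_le_mono elim!: dvdE intro!: imageI)
      (metis div_le_mono less_imp_le_nat nonzero_mult_div_cancel_left power_not_zero zero_neq_numeral)
  then have "card (samples (2 ^ l)) \<le> card ((\<lambda>q. 4 ^ l * q) ` {..k div 4 ^ l})"
    by (intro card_mono) auto
  also have "\<dots> \<le> k div 4 ^ l + 1" by (rule order_trans[OF card_image_le]) auto
  finally show ?thesis .
qed

text \<open>Level \<open>2 ^ l\<close> has \<open>2 ^ l + 1\<close> truncations of at most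
  \<open>k div 4 ^ l + 1\<close> samples. The quotients contribute \<open>2 * (k div 2 ^ l)\<close>
  per level, \<open>4 * k\<close> in total. The \<open>+ 1\<close>, due to sample 0, contributes a
  geometric sum dominated by the highest level, which is linear in \<open>B\<close>.\<close>

lemma card_keys:
  assumes B: "a k \<le> 2 ^ B" "B \<ge> 1"
  shows "finite keys" "card keys \<le> 4 * k + 16 * B"
proof -
  \<comment> \<open>\<open>2 ^ L\<close> is \<open>B\<close> up to a factor of 2, and every level
    \<open>2 ^ l\<close> satisfies \<open>l - 1 \<le> L\<close>.\<close>
  define L where "L = (LEAST l. B \<le> 2 ^ l)"
  have "B \<le> 2 ^ B" using less_exp[of B] by simp
  then have L: "B \<le> 2 ^ L" unfolding L_def by (rule LeastI)
  have L2: "2 ^ L \<le> 2 * B"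
  proof (cases L)
    case 0
    then show ?thesis using B by simp
  next
    case (Suc l)
    then have "\<not> B \<le> 2 ^ l" using not_less_Least[of l "\<lambda>l. B \<le> 2 ^ l"] L_def by simp
    then show ?thesis using Suc by simp
  qed
  have lev: "\<exists>l<L + 2. T = 2 ^ l" if lv: "level T" for T
  proof -
    obtain l where l: "T = 2 ^ l" "l = 0 \<or> 2 ^ 2 ^ (l - 1) \<le> a k" using lv unfolding level_def by blast
    have "l < L + 2"
    proof (rule ccontr)
      assume n: "\<not> l < L + 2"
      then have "2 ^ 2 ^ (l - 1) \<le> a k" using l by auto
      then have "2 ^ 2 ^ (l - 1) \<le> (2::nat) ^ B" using B(1) by (rule order_trans)
      then have "2 ^ (l - 1) \<le> B" by (rule power_le_imp_le_exp[rotated]) simp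
      also have "B \<le> 2 ^ L" by (rule L)
      finally have "l - 1 \<le> L" by simp
      then show False using n by simp
    qed
    then show ?thesis using l by blast
  qed
  define J :: "(nat \<times> nat \<times> nat) set" where "J = (SIGMA l:{..<L + 2}. {..2 ^ l} \<times> samples (2 ^ l))"
  have finS: "finite (samples T)" for T by (simp add: samples_def)
  have finJ: "finite J" unfolding J_def using finS by (intro finite_SigmaI finite_cartesian_product) auto
  have sub: "keys \<subseteq> (\<lambda>(l, h, q). (2 ^ l, h, a q div 2 ^ h)) ` J"
  proof
    fix z assume "z \<in> keys"
    then obtain T h v where z: "z = (T, h, v)" "level T" "h \<le> T" "block T h v \<noteq> {}" by (auto simp: keys_def)
    obtain q where q: "q \<in> samples T" "a q div 2 ^ h = v" using z(4) by (auto simp: block_def)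
    obtain l where l: "l < L + 2" "T = 2 ^ l" using lev[OF z(2)] by auto
    have "(l, h, q) \<in> J" using l z q by (simp add: J_def)
    then show "z \<in> (\<lambda>(l, h, q). (2 ^ l, h, a q div 2 ^ h)) ` J"
      using z q l by (intro image_eqI[of _ _ "(l, h, q)"]) auto
  qed
  show "finite keys" using finite_subset[OF sub] finJ by blast
  have "card keys \<le> card J" by (rule order_trans[OF card_mono[OF _ sub] card_image_le]) (use finJ in auto)
  also have "card J = (\<Sum>l<L + 2. (2 ^ l + 1) * card (samples (2 ^ l)))"
    unfolding J_def by (subst card_SigmaI) (auto simp: finS card_cartesian_product)
  also have "\<dots> \<le> (\<Sum>l<L + 2. 2 * (k div 2 ^ l) + 2 * 2 ^ l)"
  proof (rule sum_mono)
    fix l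
    have "(2 ^ l + 1) * card (samples (2 ^ l)) \<le> (2 * 2 ^ l) * (k div 4 ^ l + 1)"
      using card_samples[of l] by (intro mult_mono) auto
    moreover have "2 ^ l * (k div 4 ^ l) \<le> k div 2 ^ l"
    proof -
      have "(4::nat) ^ l = 2 ^ l * 2 ^ l" by (simp flip: power_mult_distrib)
      then have "2 ^ l * (k div 4 ^ l) = (k div 2 ^ l) div 2 ^ l * 2 ^ l" by (simp add: div_mult2_eq)
      then show ?thesis by simp
    qed
    ultimately show "(2 ^ l + 1) * card (samples (2 ^ l)) \<le> 2 * (k div 2 ^ l) + 2 * 2 ^ l"
      by (simp add: distrib_left)
  qed
  also have "\<dots> = 2 * (\<Sum>l<L + 2. k div 2 ^ l) + 2 * (\<Sum>l<L + 2. 2 ^ l)"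
    by (simp only: sum.distrib sum_distrib_left)
  also have "(\<Sum>l<L + 2. (2::nat) ^ l) = 2 ^ (L + 2) - 1"
    by (induction L) auto
  also have "2 * (\<Sum>l<L + 2. k div 2 ^ l) + 2 * (2 ^ (L + 2) - 1) \<le> 2 * (2 * k) + 2 * (4 * (2 * B))"
    using sum_div_power_2[of k "L + 2"] L2 by (intro add_mono mult_left_mono) auto
  finally show "card keys \<le> 4 * k + 16 * B" by simp
qed

text \<open>The code is at most \<open>3 * T \<le> 6 * a k\<close>, so \<open>8 * a k\<close> is a
  valid base. The key is then below \<open>16 * a k ^ 2\<close>, and \<open>8 \<le> a k ^ 3\<close>
  leads to the exponent 5.\<close>

lemma key_less:
  assumes T: "level T" "h \<le> T" and v: "v \<le> a k" and N: "a k \<ge> 2" "2 * a k ^ 5 \<le> p"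
  shows "2 * T + h < 8 * a k" "0 < key (8 * a k) (T, h, v)" "key (8 * a k) (T, h, v) < p"
proof -
  let ?N = "a k"
  have T1: "T \<ge> 1" using T by (auto simp: level_def)
  have Tl: "T \<le> 2 * ?N" using level_le[OF T(1)] N by simp
  show c: "2 * T + h < 8 * ?N" using Tl T(2) N by linarith
  show "0 < key (8 * ?N) (T, h, v)" using T1 by (simp add: key_def)
  have "v * (8 * ?N) \<le> ?N * (8 * ?N)" using v by (intro mult_right_mono) auto
  moreover have "?N * (8 * ?N) = 8 * (?N * ?N)" by simp
  ultimately have "key (8 * ?N) (T, h, v) < 8 * (?N * ?N) + 8 * ?N"
    using c unfolding key_def prod.case by linarith
  also have "8 * ?N \<le> 8 * (?N * ?N)" using N by simp
  also have "8 * (?N * ?N) + 8 * (?N * ?N) = 2 * (2 * 2 * 2 * (?N * ?N))" by simp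
  also have "2 * 2 * 2 * (?N * ?N) \<le> ?N * ?N * ?N * (?N * ?N)"
    using N by (intro mult_mono) auto
  also have "2 * (?N * ?N * ?N * (?N * ?N)) = 2 * ?N ^ 5" by (simp add: eval_nat_numeral)
  finally show "key (8 * ?N) (T, h, v) < p" using N by linarith
qed

lemma dictionary_exists:
  assumes p: "prime p" and N: "a k \<ge> 2" "2 * a k ^ 5 \<le> p" and B: "a k \<le> 2 ^ B" "B \<ge> 1"
  shows "\<exists>h0 as ms bs ks lo hi R. h0 < p \<and> R \<le> 4 * k + 16 * B \<and>
     length as = R \<and> length ms = R \<and> length bs = R \<and> length ks \<le> 7 * R \<and>
     length lo = length ks \<and> length hi = length ks \<and>
     set as \<subseteq> {..<p} \<and> set ms \<subseteq> {..7 * R} \<and> set bs \<subseteq> {..7 * R} \<and> set ks \<subseteq> {..<p} \<and>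
     set lo \<subseteq> {..k} \<and> set hi \<subseteq> {..k} \<and>
     sample_dictionary (8 * a k) p R h0 as ms bs ks lo hi"
proof -
  let ?C = "8 * a k"
  define I where "I = {(T, h, v :: nat). level T \<and> h \<le> T \<and> v \<le> a k}"
  have inj: "inj_on (key ?C) I"
    by (rule key_inj) (use key_less(1)[OF _ _ _ N] in \<open>auto simp: I_def level_def\<close>)
  have vle: "v \<le> a k" if ne: "block T h v \<noteq> {}" for T h v
  proof -
    obtain q where "q < k" "v = a q div 2 ^ h" using ne by (auto simp: block_def samples_def)
    then show ?thesis using a_le[of q k] by (meson div_le_dividend le_trans less_imp_le_nat order_refl)
  qed
  have sub: "keys \<subseteq> I" using vle by (auto simp: keys_def I_def)
  define X where "X = key ?C ` keys"
  have cX: "card X = card keys" unfolding X_def by (rule card_image[OF inj_on_subset[OF inj sub]])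
  have XI: "key ?C z \<in> X \<longleftrightarrow> z \<in> keys" if "z \<in> I" for z
    unfolding X_def using inj_on_image_mem_iff[OF inj that sub] .
  have Xp: "X \<subseteq> {0<..<p}"
  proof
    fix x assume "x \<in> X"
    then obtain T h v where x: "x = key ?C (T, h, v)" and K: "level T" "h \<le> T" "block T h v \<noteq> {}"
      by (auto simp: X_def keys_def)
    show "x \<in> {0<..<p}" using key_less(2,3)[OF K(1,2) vle[OF K(3)] N] x by simp
  qed
  \<comment> \<open>Sample 0 of the lowest level ensures that there is a key at all, as
    \<open>static_dictionary\<close> demands.\<close>
  have "0 \<in> block 1 0 0" using a0 k by (simp add: block_def samples_def)
  then have "(1, 0, 0) \<in> keys" by (auto simp: keys_def level_def intro: exI[of _ 0])
  then have X0: "X \<noteq> {}" by (auto simp: X_def)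
  define R where "R = card X"
  obtain h0 as ms bs ks where d: "h0 < p" "length as = R" "length ms = R" "length bs = R" "length ks \<le> 7 * R"
     "set as \<subseteq> {..<p}" "set ms \<subseteq> {..7 * R}" "set bs \<subseteq> {..7 * R}" "set ks \<subseteq> insert 0 X"
     and D: "\<forall>x\<in>{0<..<p}. let h = hash p R h0 x; t = bs ! h + hash p (ms ! h) (as ! h) x in
        h < R \<and> t < length ks \<and> (ks ! t = x \<longleftrightarrow> x \<in> X)"
    using static_dictionary[OF p Xp X0] unfolding R_def[symmetric] by blast
  \<comment> \<open>Keys determine their blocks, so the ends of the block can be stored in arrays
    parallel to \<open>ks\<close>.\<close>
  define blk where "blk x = (case inv_into I (key ?C) x of (T, h, v) \<Rightarrow> block T h v)" for x
  have blk: "blk (key ?C (T, h, v)) = block T h v" if "(T, h, v) \<in> I" for T h v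
    using inj that by (simp add: blk_def)
  define lo where "lo = map (\<lambda>x. if x \<in> X then Min (blk x) else 0) ks"
  define hi where "hi = map (\<lambda>x. if x \<in> X then Max (blk x) else 0) ks"
  have blkX: "Min (blk x) \<le> k \<and> Max (blk x) \<le> k" if xX: "x \<in> X" for x
  proof -
    obtain T h v where x: "x = key ?C (T, h, v)" "(T, h, v) \<in> keys" using xX by (auto simp: X_def)
    then have "blk x = block T h v" using blk sub by blast
    moreover have "block T h v \<noteq> {}" using x by (simp add: keys_def)
    ultimately have "Min (blk x) \<in> block T h v" "Max (blk x) \<in> block T h v" using finite_block by auto
    then show ?thesis by (auto simp: block_def samples_def)
  qed
  have lh: "set lo \<subseteq> {..k}" "set hi \<subseteq> {..k}" "length lo = length ks" "length hi = length ks"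
    using blkX by (auto simp: lo_def hi_def)
  have ksp: "set ks \<subseteq> {..<p}" using d(9) Xp prime_gt_0_nat[OF p] by auto
  have Rb: "R \<le> 4 * k + 16 * B" using card_keys[OF B] by (simp add: R_def cX)
  have main: "let x = key ?C (T, h, v); b = hash p R h0 x; t = bs ! b + hash p (ms ! b) (as ! b) x in
        x < p \<and> b < length as \<and> b < length ms \<and> b < length bs \<and>
        t < length ks \<and> t < length lo \<and> t < length hi \<and>
        (ks ! t = x \<longleftrightarrow> block T h v \<noteq> {}) \<and>
        (block T h v \<noteq> {} \<longrightarrow> lo ! t = Min (block T h v) \<and> hi ! t = Max (block T h v))"
    if T: "level T" "h \<le> T" "v \<le> a k" for T h v
  proof -
    define x where "x = key ?C (T, h, v)"
    define b where "b = hash p R h0 x"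
    define t where "t = bs ! b + hash p (ms ! b) (as ! b) x"
    have zI: "(T, h, v) \<in> I" using T by (simp add: I_def)
    have xp: "x \<in> {0<..<p}" using key_less(2,3)[OF T N] by (simp add: x_def)
    have Dx: "b < R" "t < length ks" "ks ! t = x \<longleftrightarrow> x \<in> X"
      using D[rule_format, OF xp] unfolding Let_def b_def[symmetric] t_def[symmetric] by blast+
    have m: "x \<in> X \<longleftrightarrow> block T h v \<noteq> {}" using XI[OF zI] T by (simp add: x_def keys_def)
    have "lo ! t = Min (block T h v) \<and> hi ! t = Max (block T h v)" if "block T h v \<noteq> {}"
      using Dx m that blk[OF zI] by (simp add: lo_def hi_def x_def[symmetric])
    then show ?thesis
      unfolding Let_def x_def[symmetric] b_def[symmetric] t_def[symmetric]
      using Dx m d xp by (simp add: lo_def hi_def)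
  qed
  show ?thesis
    by (intro exI[of _ h0] exI[of _ as] exI[of _ ms] exI[of _ bs] exI[of _ ks] exI[of _ lo] exI[of _ hi]
        exI[of _ R] conjI) (unfold sample_dictionary_def, intro allI impI main | rule d lh ksp Rb)+
qed

end

section \<open>Packing of the arrays and numerical bounds\<close>

text \<open>The arrays are preceded by a directory of their base addresses, because the fixed
  program cannot contain addresses that depend on the string.\<close>

definition pack :: "nat list list \<Rightarrow> nat list" where
  "pack As = map (\<lambda>t. length As + length (concat (take t As))) [0..<length As] @ concat As"

lemma length_pack: "length (pack As) = length As + length (concat As)"
  by (simp add: pack_def)

lemma nth_concat_take:
  "t < length As \<Longrightarrow> i < length (As ! t) \<Longrightarrow>
     length (concat (take t As)) + i < length (concat As) \<and>
     concat As ! (length (concat (take t As)) + i) = As ! t ! i"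
proof -
  assume t: "t < length As" and i: "i < length (As ! t)"
  have c: "concat As = concat (take t As) @ As ! t @ concat (drop (Suc t) As)"
    using t by (metis append_take_drop_id concat.simps(2) concat_append Cons_nth_drop_Suc)
  show ?thesis
    unfolding arg_cong[OF c, of length] arg_cong[OF c, of nth] using i by (simp add: nth_append)
qed

lemma pack_nth:
  assumes "t < length As" "i < length (As ! t)"
  shows "t < length (pack As) \<and> pack As ! t + i < length (pack As) \<and> pack As ! (pack As ! t + i) = As ! t ! i"
proof -
  have b: "pack As ! t = length As + length (concat (take t As))"
    using assms by (simp add: pack_def nth_append)
  show ?thesis unfolding b using nth_concat_take[OF assms] assms
    by (simp add: length_pack) (simp add: pack_def nth_append)
qed

lemma set_pack: "x \<in> set (pack As) \<Longrightarrow> x \<le> length (pack As) \<or> (\<exists>xs\<in>set As. x \<in> set xs)"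
proof -
  assume "x \<in> set (pack As)"
  then consider t where "t < length As" "x = length As + length (concat (take t As))" | "\<exists>xs\<in>set As. x \<in> set xs"
    by (auto simp: pack_def)
  then show ?thesis
  proof cases
    case 1
    have "length (concat As) = length (concat (take t As)) + length (concat (drop t As))"
      by (metis append_take_drop_id concat_append length_append)
    then show ?thesis using 1 by (simp add: length_pack)
  qed simp
qed

text \<open>If l + 1 is the least sufficient level, then 2 ^ 2 ^ l is at most D + 1 and hence at
  most E ^ 2 for \<open>E = max 4 D\<close>. Two logarithms give l \<le> 1 + loglog D, and the
  constants are absorbed since loglog D is at least 1.\<close>

lemma level_of_le_loglog: "real (level_of D) \<le> 3 * loglog (real D)"
proof -
  define E where "E = max 4 (real D)"
  have E: "E \<ge> 4" by (simp add: E_def)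
  have "log 2 4 \<le> log 2 E" using E by (intro log_mono) auto
  then have l4: "log 2 E \<ge> 2" using log_powr_cancel[of 2 2] by simp
  have ll: "loglog (real D) = log 2 (log 2 E)" by (simp add: loglog_def E_def)
  have "log 2 2 \<le> log 2 (log 2 E)" using l4 by (intro log_mono) auto
  then have l1: "log 2 (log 2 E) \<ge> 1" by simp
  show ?thesis
  proof (cases "level_of D")
    case 0
    then show ?thesis using ll l1 by simp
  next
    case (Suc l)
    have "2 ^ 2 ^ l \<le> D + 1" using level_of_less[of l D] Suc by simp
    then have "real (2 ^ 2 ^ l) \<le> real (D + 1)" by (rule of_nat_mono)
    then have "2 ^ 2 ^ l \<le> real D + 1" by simp
    also have "\<dots> \<le> E + E" using E by (simp add: E_def)
    also have "\<dots> \<le> E * E" using E mult_right_mono[of 2 E E] by simp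
    finally have "log 2 (2 ^ 2 ^ l) \<le> log 2 (E * E)" using E by (intro log_mono) auto
    then have "2 ^ l \<le> 2 * log 2 E" using E by (simp add: log_mult log_nat_power)
    then have "log 2 (2 ^ l) \<le> log 2 (2 * log 2 E)" using l4 by (intro log_mono) auto
    then have "real l \<le> 1 + log 2 (log 2 E)" using l4 by (simp add: log_mult log_nat_power)
    then show ?thesis using Suc l1 ll by simp
  qed
qed

lemma word_size_bound: "(N + 1) ^ b \<le> 2 ^ word_size b N"
proof -
  let ?l = "nat \<lceil>log 2 (real N + 1)\<rceil>"
  have "real (N + 1) = 2 powr (log 2 (real N + 1))" by simp
  also have "\<dots> \<le> 2 powr (real ?l)" by (intro powr_mono) (auto simp: real_nat_ceiling_ge)
  also have "\<dots> = 2 ^ ?l" by (rule powr_realpow) simp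
  finally have "real (N + 1) \<le> real (2 ^ ?l)" by simp
  then have "N + 1 \<le> 2 ^ ?l" by (rule of_nat_le_iff[THEN iffD1])
  then have "(N + 1) ^ b \<le> (2 ^ ?l) ^ b" by (rule power_mono) simp
  then show ?thesis by (simp add: word_size_def power_mult[symmetric] mult.commute)
qed

lemma length_concat_le:
  "(\<And>xs. xs \<in> set Ls \<Longrightarrow> length xs \<le> m) \<Longrightarrow> length (concat Ls) \<le> length Ls * m"
proof (induction Ls)
  case (Cons x xs)
  have "length (concat xs) \<le> length xs * m" using Cons by auto
  moreover have "length x \<le> m" using Cons.prems by simp
  ultimately show ?case by simp
qed simp

lemma exists_inverse:
  assumes "prime p" "0 < c" "c < p"
  shows "\<exists>e. c * e mod p = (1::nat)"
proof -
  have "\<not> p dvd c" using assms by (auto dest: dvd_imp_le)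
  then have "coprime c p" using prime_imp_coprime[OF assms(1)] by (simp add: coprime_commute)
  then have g: "gcd c p = 1" by simp
  obtain x y where "c * x = p * y + gcd c p" using bezout_nat[of c p] assms(2) by blast
  then have "c * x mod p = (p * y + 1) mod p" by (simp add: g)
  also have "\<dots> = 1 mod p" by (rule mod_mult_self4)
  finally have "c * x mod p = 1 mod p" .
  then show ?thesis using prime_gt_1_nat[OF assms(1)] by auto
qed

text \<open>For \<open>N \<ge> 2\<close> the prime exceeds \<open>2 ^ c\<close> and therefore
  \<open>c\<close>. For N = 1 it is 2 or 3 and may divide \<open>c\<close>, which is why that case
  is treated separately.\<close>

lemma inverse_exists:
  assumes p: "prime p" "2 * N ^ (c + 4) \<le> p" and c: "c \<ge> 1" and N: "N \<ge> (2::nat)"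
  shows "\<exists>e. c * e mod p = 1"
proof -
  have "c < 2 ^ c" by (rule less_exp)
  also have "(2::nat) ^ c \<le> N ^ (c + 4)"
    using N by (intro order_trans[OF power_mono[of 2 N c] power_increasing]) auto
  finally show ?thesis using p c by (intro exists_inverse) auto
qed

section \<open>The trie of prefixes and its size\<close>

definition prefixes :: "'a list list \<Rightarrow> 'a list set" where
  "prefixes Ls = (\<Union>xs\<in>set Ls. (\<lambda>l. take l xs) ` {..length xs})"

lemma take_in_prefixes: "v \<in> prefixes Ls \<Longrightarrow> take l v \<in> prefixes Ls"
proof -
  assume "v \<in> prefixes Ls"
  then obtain xs n where "xs \<in> set Ls" "n \<le> length xs" "v = take n xs" by (auto simp: prefixes_def)
  then have "take l v = take (min l n) xs" "min l n \<le> length xs" by auto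
  then show ?thesis using \<open>xs \<in> set Ls\<close> by (auto simp: prefixes_def)
qed

lemma in_prefixes: "xs \<in> set Ls \<Longrightarrow> xs \<in> prefixes Ls"
  unfolding prefixes_def by (intro UN_I image_eqI[of _ _ "length xs"]) auto

lemma finite_prefixes: "finite (prefixes Ls)" by (simp add: prefixes_def)

text \<open>This bound in terms of N only limits the magnitude of the entries; the space bound comes
  from \<open>card_prefixes_slp\<close>.\<close>

lemma card_prefixes: "card (prefixes Ls) \<le> length (concat Ls) + 1"
proof -
  have "card (\<Union>xs\<in>set Ls. (\<lambda>l. take l xs) ` {1..length xs}) \<le> length (concat Ls)"
  proof (induction Ls)
    case (Cons x Ls)
    have "card ((\<lambda>l. take l x) ` {1..length x}) \<le> length x"
      by (rule order_trans[OF card_image_le]) auto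
    then show ?case using Cons by (simp del: One_nat_def) (rule order_trans[OF card_Un_le], linarith)
  qed simp
  moreover have "prefixes Ls \<subseteq> insert [] (\<Union>xs\<in>set Ls. (\<lambda>l. take l xs) ` {1..length xs})"
  proof
    fix v assume "v \<in> prefixes Ls"
    then obtain xs n where xs: "xs \<in> set Ls" "n \<le> length xs" "v = take n xs" by (auto simp: prefixes_def)
    show "v \<in> insert [] (\<Union>xs\<in>set Ls. (\<lambda>l. take l xs) ` {1..length xs})"
    proof (cases "n = 0")
      case False
      then have "n \<in> {1..length xs}" using xs by simp
      then show ?thesis using xs by blast
    qed (use xs in simp)
  qed
  then have "card (prefixes Ls) \<le> card (insert [] (\<Union>xs\<in>set Ls. (\<lambda>l. take l xs) ` {1..length xs}))"
    by (intro card_mono) auto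
  moreover have "card (insert [] (\<Union>xs\<in>set Ls. (\<lambda>l. take l xs) ` {1..length xs}))
      \<le> card (\<Union>xs\<in>set Ls. (\<lambda>l. take l xs) ` {1..length xs}) + 1"
    by (simp add: card_insert_if)
  ultimately show ?thesis by linarith
qed

text \<open>\<open>s\<close> is about half the binary logarithm of \<open>m\<close>: a selection
  table of \<open>2 ^ s * s\<close> cells has at most \<open>4 ^ s \<le> 4 * m\<close>, while
  \<open>2 * s\<close> pointers still reach over all depths.\<close>

lemma half_log_exists: "m \<ge> 1 \<Longrightarrow> \<exists>s\<ge>1. m < 4 ^ s \<and> 4 ^ s \<le> 4 * (m::nat)"
proof -
  assume m: "m \<ge> 1"
  define s where "s = (LEAST s. m < 4 ^ s)"
  have "m < 2 ^ m" by (rule less_exp)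
  also have "(2::nat) ^ m \<le> 4 ^ m" by (rule power_mono) auto
  finally have 1: "m < 4 ^ s" unfolding s_def by (rule LeastI)
  have s1: "s \<ge> 1" using 1 m by (cases s) auto
  then have "\<not> m < 4 ^ (s - 1)" using not_less_Least[of "s - 1" "\<lambda>s. m < 4 ^ s"] s_def by simp
  then have "4 ^ s \<le> 4 * m" using s1 by (cases s) auto
  then show ?thesis using 1 s1 by blast
qed

lemma produces_nonempty: "produces G v x \<Longrightarrow> x \<noteq> []"
  by (induction rule: produces.induct) auto

lemma string_of_eq: "produces G v x \<Longrightarrow> string_of G v = x"
  unfolding string_of_def by (rule the_equality) (auto dest: produces_unique)

text \<open>In a linear SLP every nonempty prefix of a produced string is itself produced by a node:
  cutting off the last character of \<open>S(v)\<close> gives \<open>S(left(v))\<close>.\<close>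

lemma prefix_produced:
  assumes "produces G v x" "linear_slp G" "v \<in> nodes G" "1 \<le> n" "n \<le> length x"
  shows "\<exists>u\<in>nodes G. produces G u (take n x)"
  using assms
proof (induction rule: produces.induct)
  case (leaf v a)
  then show ?case by (auto intro: produces.leaf)
next
  case (node v l r x y)
  obtain b where "label G r = Leaf b" using node.hyps(1) node.prems unfolding linear_slp_def by blast
  then have y: "y = [b]" using node.hyps(3) by (meson produces.leaf produces_unique)
  have "(v, l) \<in> edges G" using node by (auto simp: edges_def)
  then have l: "l \<in> nodes G" using node.prems by (auto simp: linear_slp_def)
  show ?case
  proof (cases "n \<le> length x")
    case True
    then show ?thesis using node.IH(1)[OF node.prems(1) l] node.prems by simp
  next
    case False
    then have "take n (x @ y) = x @ y" using node.prems y by simp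
    then show ?thesis using node produces.node by metis
  qed
qed

text \<open>Linearity of the SLP enters here: the trie is no larger than the grammar, up to the
  empty word.\<close>

lemma card_prefixes_slp:
  assumes "linear_slp G"
  shows "card (prefixes (map (string_of G) (children G))) \<le> card (nodes G) + 1"
proof -
  have fin: "finite (nodes G)" using assms by (simp add: linear_slp_def)
  have "prefixes (map (string_of G) (children G)) \<subseteq> insert [] (string_of G ` nodes G)"
  proof
    fix v assume "v \<in> prefixes (map (string_of G) (children G))"
    then obtain r n where r: "r \<in> set (children G)" "n \<le> length (string_of G r)" "v = take n (string_of G r)"
      by (auto simp: prefixes_def)
    have rn: "r \<in> nodes G" using r assms by (auto simp: linear_slp_def)
    show "v \<in> insert [] (string_of G ` nodes G)"
    proof (cases "n = 0")
      case False
      then obtain u where "u \<in> nodes G" "produces G u v"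
        using prefix_produced[OF produces_string_of[OF assms rn] assms rn, of n] r by auto
      then show ?thesis using string_of_eq by blast
    qed (use r in simp)
  qed
  then have "card (prefixes (map (string_of G) (children G))) \<le> card (insert [] (string_of G ` nodes G))"
    using fin by (intro card_mono) auto
  also have "\<dots> \<le> card (string_of G ` nodes G) + 1" using fin by (simp add: card_insert_if)
  also have "\<dots> \<le> card (nodes G) + 1" using card_image_le[OF fin] by simp
  finally show ?thesis .
qed

section \<open>Assembly of the memory\<close>

text \<open>In the bound on the entries, \<open>p\<close> covers residues and keys, and
  \<open>1000 * (N + 1)\<close> covers sizes, offsets and indices.\<close>

lemma memory_exists:
  fixes Ls :: "nat list list" and c p w :: nat
  defines "k \<equiv> length Ls" and "N \<equiv> length (concat Ls)" and "m \<equiv> card (prefixes Ls)"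
  assumes ne: "Ls \<noteq> []" "[] \<notin> set Ls" and N: "N \<ge> 2" and c: "c \<ge> 1"
    and p: "prime p" "2 * N ^ (c + 4) \<le> p"
    and w: "100 * ((p + 1000 * (N + 1)) * (p + 1000 * (N + 1))) \<le> 2 ^ w"
  shows "\<exists>M A h0 R s e idx md jb ld mb mk. length M \<le> 540 * (k + m) \<and> (\<forall>x\<in>set M. x < 2 ^ w) \<and>
    query_memory (\<lambda>g. length (concat (take g Ls))) k w M A (p + 1000 * (N + 1)) p (8 * N) h0 R s c e Ls
      (prefixes Ls) idx md jb ld mb mk"
proof -
  define a where "a g = length (concat (take g Ls))" for g
  define V where "V = prefixes Ls"
  define Q where "Q = p + 1000 * (N + 1)"
  have k1: "k \<ge> 1" using ne by (simp add: k_def Suc_leI)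
  have ak: "a k = N" by (simp add: a_def k_def N_def)
  have a_Suc: "a (Suc g) = a g + length (Ls ! g)" if "g < k" for g
    using that by (simp add: a_def k_def take_Suc_conv_app_nth)
  have a_less: "a g < a (Suc g)" if "g < k" for g
  proof -
    have "Ls ! g \<noteq> []" using ne(2) that k_def nth_mem by metis
    then show ?thesis using a_Suc[OF that] by simp
  qed
  have a_mono: "i < j \<Longrightarrow> j \<le> k \<Longrightarrow> a i < a j" for i j
  proof (induction j)
    case (Suc j)
    then show ?case using a_less[of j] by (cases "i = j") auto
  qed simp
  interpret boundaries a k
    by unfold_locales (use k1 a_mono in \<open>auto simp: a_def\<close>)
  have aN: "a g \<le> N" if "g \<le> k" for g using a_le[OF that order_refl] ak by simp
  have finV: "finite V" by (simp add: V_def finite_prefixes)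
  have LV: "Ls ! g \<in> V" if "g < k" for g using that by (simp add: V_def in_prefixes k_def)
  have takeV: "take l v \<in> V" if "v \<in> V" for v l using that take_in_prefixes by (simp add: V_def)
  have m: "m = card V" by (simp add: m_def V_def)
  have mN: "m \<le> N + 1" using card_prefixes[of Ls] by (simp add: m_def N_def)
  have kN: "k \<le> N"
  proof -
    have "g \<le> k \<Longrightarrow> g \<le> a g" for g
    proof (induction g)
      case (Suc g)
      then show ?case using a_less[of g] by linarith
    qed simp
    then show ?thesis using ak by force
  qed
  have "card V = card {..<m}" by (simp add: m)
  then obtain idx where idx: "bij_betw idx V {..<m}"
    using finite_same_card_bij[OF finV finite_lessThan] by blast
  have VN: "V \<noteq> {}" using LV[of 0] k1 by auto
  interpret prefix_tree V idx m
    by unfold_locales (use idx takeV VN in auto)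
  obtain s where ss: "s \<ge> 1" "m < 4 ^ s" "4 ^ s \<le> 4 * m" using half_log_exists[OF m_pos] by blast
  interpret micro_macro V idx m s
    by unfold_locales (use ss in auto)
  obtain jb ld mb mk lad jmp lg mic sel where la: "length lad = 2 * m" "set lad \<subseteq> {..<m}"
     "length jmp \<le> 3 * m" "set jmp \<subseteq> {..3 * m}" "length lg = m" "set lg \<subseteq> {..2 * s}"
     "length mic \<le> m" "set mic \<subseteq> {..<m}" "length sel = 2 ^ s * s" "set sel \<subseteq> {..<s}"
     and LA: "\<forall>v\<in>V. jb v \<le> 3 * m \<and> ld v \<le> m \<and> mb v \<le> m \<and> mk v < 2 ^ s"
     and tables: "ancestor_tables V idx md s jb ld mb mk lad jmp lg mic sel"
    using level_ancestor by blast
  \<comment> \<open>\<open>B\<close> takes the place of log N: every child has length below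
    \<open>m\<close>, so \<open>N \<le> k * m \<le> 2 ^ (k + m)\<close>, and the dictionary stays
    linear in \<open>k + m\<close>.\<close>
  define B where "B = k + m"
  have B1: "B \<ge> 1" using k1 by (simp add: B_def)
  have "N \<le> k * m"
    unfolding N_def k_def
  proof (rule length_concat_le)
    fix xs assume "xs \<in> set Ls"
    then have "xs \<in> V" by (simp add: V_def in_prefixes)
    then show "length xs \<le> m" using length_less by fastforce
  qed
  also have "k * m \<le> 2 ^ k * 2 ^ m" using less_exp[of k] less_exp[of m] by (intro mult_mono) auto
  finally have N2: "a k \<le> 2 ^ B" by (simp add: ak B_def power_add)
  have "2 * N ^ 5 \<le> 2 * N ^ (c + 4)" using N c by (intro mult_left_mono power_increasing) auto
  then have Np: "2 * a k ^ 5 \<le> p" using p ak by simp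
  have N': "a k \<ge> 2" using N ak by simp
  obtain h0 as ms bs ks lo hi R where d: "h0 < p" "R \<le> 4 * k + 16 * B"
     "length as = R" "length ms = R" "length bs = R" "length ks \<le> 7 * R"
     "length lo = length ks" "length hi = length ks"
     "set as \<subseteq> {..<p}" "set ms \<subseteq> {..7 * R}" "set bs \<subseteq> {..7 * R}" "set ks \<subseteq> {..<p}"
     "set lo \<subseteq> {..k}" "set hi \<subseteq> {..k}"
     and D: "sample_dictionary (8 * a k) p R h0 as ms bs ks lo hi"
    using dictionary_exists[OF p(1) N' Np N2 B1] by (elim exE conjE) (rule that)
  obtain e where e: "c * e mod p = 1" using inverse_exists[OF p c N] by blast
  have p0: "p > 0" "p > 1" using prime_gt_1_nat[OF p(1)] by auto
  define nd where "nd = inv_into V idx"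
  have nd: "nd (idx v) = v" if "v \<in> V" for v using idx_inj that by (simp add: nd_def)
  have ndV: "nd i \<in> V" if "i < m" for i
    using idx that unfolding nd_def bij_betw_def by (metis inv_into_into lessThan_iff)
  define As where "As = [[0, p, 8 * N, h0, R, s, k, 0], map a [0..<k + 1], map (\<lambda>g. idx (Ls ! g)) [0..<k],
     map (\<lambda>g. fingerprint c p (concat (take g Ls))) [0..<k], map (\<lambda>g. c ^ a g mod p) [0..<k],
     map (\<lambda>g. e ^ a g mod p) [0..<k],
     map (\<lambda>i. md (nd i)) [0..<m], map (\<lambda>i. jb (nd i)) [0..<m], map (\<lambda>i. ld (nd i)) [0..<m],
     map (\<lambda>i. mb (nd i)) [0..<m], map (\<lambda>i. mk (nd i)) [0..<m],
     map (\<lambda>i. fingerprint c p (nd i)) [0..<m], map (\<lambda>i. e ^ length (nd i) mod p) [0..<m],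
     lad, jmp, lg, mic, sel, as, ms, bs, ks, lo, hi]"
  define A where "A t = As ! t" for t
  have lenAs: "length As = 24" by (simp add: As_def)
  note A = A_def As_def
  have s4: "2 ^ s * s \<le> 4 * m" "s \<le> 4 * m" "2 ^ s \<le> 4 * m"
  proof -
    have f: "(4::nat) ^ s = 2 ^ s * 2 ^ s" by (simp flip: power_mult_distrib)
    have "s < 2 ^ s" by (rule less_exp)
    then have "2 ^ s * s \<le> 2 ^ s * 2 ^ s" by simp
    then show 1: "2 ^ s * s \<le> 4 * m" using ss(3) f by linarith
    have "s \<le> 2 ^ s * s" "2 ^ s \<le> 2 ^ s * s" using ss(1) by simp_all
    then show "s \<le> 4 * m" "2 ^ s \<le> 4 * m" using 1 by linarith+
  qed
  have RQ: "R \<le> 20 * (k + m)" using d(2) by (simp add: B_def)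
  \<comment> \<open>9 for the parameters and the extra boundary, \<open>5 * k\<close> for the arrays
    of children; \<open>7 * m\<close> for the trie nodes and \<open>11 * m\<close> for the ancestor
    tables; \<open>3 * R\<close> for the buckets and \<open>21 * R\<close> for the slots. With
    \<open>R \<le> 20 * (k + m)\<close> and the directory this is below
    \<open>540 * (k + m)\<close>.\<close>
  have le: "length (concat As) \<le> 9 + 5 * k + 18 * m + 24 * R"
    using la d s4 by (simp add: As_def del: upt_Suc)
  then have lenM: "length (pack As) \<le> 540 * (k + m)"
    using RQ k1 by (simp add: length_pack lenAs)
  have km: "k + m \<le> 2 * N + 1" using kN mN by simp
  have Qbig: "p < Q" "7 * R < Q" "8 * N < Q" "8 * m < Q" "N + 1 < Q"
  proof -
    have "7 * R \<le> 7 * (20 * (k + m))" using RQ by (rule mult_left_mono) simp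
    also have "\<dots> \<le> 7 * (20 * (2 * N + 1))" using km by (intro mult_left_mono) simp_all
    finally have "7 * R \<le> 140 * (2 * N + 1)" by simp
    then show "7 * R < Q" by (simp add: Q_def)
    show "8 * m < Q" using mN by (simp add: Q_def)
  qed (simp_all add: Q_def)
  have mdm: "md v \<le> m" if "v \<in> V" for v using md_le[of v] length_less[OF that] by simp
  have ent: "x < Q" if "xs \<in> set As" "x \<in> set xs" for xs x
  proof -
    have pQ: "x < Q" if "x < p" for x using that Qbig by simp
    have "\<forall>xs\<in>set As. \<forall>x\<in>set xs. x < Q"
      unfolding As_def list.set ball_simps
    proof (intro conjI)
      show "0 < Q" "p < Q" "8 * N < Q" "R < Q" "s < Q" "k < Q" "h0 < Q"
        using Qbig s4 kN d(1) by linarith+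
      show "\<forall>x\<in>set (map a [0..<k + 1]). x < Q"
      proof
        fix x assume "x \<in> set (map a [0..<k + 1])"
        then obtain g where "g \<le> k" "x = a g" by (auto simp: less_Suc_eq_le simp del: upt_Suc)
        then show "x < Q" using aN[of g] Qbig by linarith
      qed
      show "\<forall>x\<in>set (map (\<lambda>g. idx (Ls ! g)) [0..<k]). x < Q" using idx_less LV Qbig by fastforce
      show "\<forall>x\<in>set (map (\<lambda>g. fingerprint c p (concat (take g Ls))) [0..<k]). x < Q"
        using p0 by (auto intro!: pQ simp: fingerprint_def)
      show "\<forall>x\<in>set (map (\<lambda>g. c ^ a g mod p) [0..<k]). x < Q" "\<forall>x\<in>set (map (\<lambda>g. e ^ a g mod p) [0..<k]). x < Q"
        using p0 by (auto intro!: pQ)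
      show "\<forall>x\<in>set (map (\<lambda>i. md (nd i)) [0..<m]). x < Q" using mdm ndV Qbig by fastforce
      show "\<forall>x\<in>set (map (\<lambda>i. jb (nd i)) [0..<m]). x < Q" using LA ndV Qbig by fastforce
      show "\<forall>x\<in>set (map (\<lambda>i. ld (nd i)) [0..<m]). x < Q" using LA ndV Qbig by fastforce
      show "\<forall>x\<in>set (map (\<lambda>i. mb (nd i)) [0..<m]). x < Q" using LA ndV Qbig by fastforce
      show "\<forall>x\<in>set (map (\<lambda>i. mk (nd i)) [0..<m]). x < Q" using LA ndV Qbig s4 by fastforce
      show "\<forall>x\<in>set (map (\<lambda>i. fingerprint c p (nd i)) [0..<m]). x < Q"
        using p0 by (auto intro!: pQ simp: fingerprint_def)
      show "\<forall>x\<in>set (map (\<lambda>i. e ^ length (nd i) mod p) [0..<m]). x < Q" using p0 by (auto intro!: pQ)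
      show "\<forall>x\<in>set lad. x < Q" "\<forall>x\<in>set jmp. x < Q" "\<forall>x\<in>set mic. x < Q" using la Qbig by fastforce+
      show "\<forall>x\<in>set lg. x < Q" "\<forall>x\<in>set sel. x < Q" using la Qbig s4 by fastforce+
      show "\<forall>x\<in>set as. x < Q" "\<forall>x\<in>set ms. x < Q" "\<forall>x\<in>set bs. x < Q" "\<forall>x\<in>set ks. x < Q"
        using d Qbig by fastforce+
      show "\<forall>x\<in>set lo. x < Q" "\<forall>x\<in>set hi. x < Q" using d Qbig kN by fastforce+
    qed (use Qbig in simp_all)
    then show ?thesis using that by blast
  qed
  have MQ: "length (pack As) < 2 ^ w"
  proof -
    have "540 * (k + m) \<le> 540 * (2 * N + 1)" using km by simp
    also have "\<dots> < 100 * Q" by (simp add: Q_def)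
    also have "100 * Q \<le> 100 * (Q * Q)" using Qbig by simp
    also have "\<dots> \<le> 2 ^ w" using w by (simp add: Q_def)
    finally show ?thesis using lenM by linarith
  qed
  have Qw: "Q < 2 ^ w"
  proof -
    have "Q < 100 * Q" using Qbig by simp
    also have "100 * Q \<le> 100 * (Q * Q)" using Qbig by simp
    also have "\<dots> \<le> 2 ^ w" using w by (simp add: Q_def)
    finally show ?thesis .
  qed
  have Mw: "\<forall>x\<in>set (pack As). x < 2 ^ w"
    using set_pack[of _ As] ent MQ Qw by (meson le_less_trans less_trans)
  have "query_memory a k w (pack As) A Q p (8 * N) h0 R s c e Ls V idx md jb ld mb mk"
  proof
    show "100 * (Q * Q) \<le> 2 ^ w" using w by (simp add: Q_def)
    show "length (pack As) \<le> 2 ^ w" using MQ by simp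
    show "k = length Ls" "\<And>g. a g = length (concat (take g Ls))" by (simp_all add: k_def a_def)
    show "A 0 = [0, p, 8 * N, h0, R, s, k, 0]" "length (A 1) = k + 1" "\<And>g. g \<le> k \<Longrightarrow> A 1 ! g = a g"
      by (simp_all add: A less_Suc_eq_le del: upt_Suc)
    show "p > 1" "c * e mod p = 1" by fact+
    fix t i assume t: "t < 24" "i < length (A t)"
    then show "t < length (pack As) \<and> pack As ! t + i < length (pack As) \<and> pack As ! (pack As ! t + i) = A t ! i"
      using pack_nth[of t As i] lenAs by (simp add: A_def)
    show "A t ! i < Q" using ent[of "A t" "A t ! i"] t lenAs by (simp add: A_def)
  next
    fix g t assume g: "g < k" "t \<in> {2..5::nat}"
    then have "t = 2 \<or> t = 3 \<or> t = 4 \<or> t = 5" by auto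
    then show "g < length (A t)" using g by (auto simp: A)
  next
    fix v t assume v: "v \<in> V" "t \<in> {6..12::nat}"
    then have "t = 6 \<or> t = 7 \<or> t = 8 \<or> t = 9 \<or> t = 10 \<or> t = 11 \<or> t = 12" by auto
    then show "idx v < length (A t)" using idx_less[OF v(1)] by (auto simp: A)
  next
    show "ancestor_tables V idx md s jb ld mb mk (A 13) (A 14) (A 15) (A 16) (A 17)"
      using tables by (simp add: A)
  next
    show "sample_dictionary (8 * N) p R h0 (A 18) (A 19) (A 20) (A 21) (A 22) (A 23)"
      using D by (simp add: A ak)
  qed (use LV takeV idx_less nd in \<open>simp_all add: A\<close>)
  then show ?thesis using lenM Mw unfolding V_def Q_def a_def[abs_def] by blast
qed

text \<open>The memory for N = 1: a directory cell with the base address 1, then array 0 with its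
  flag set and the only possible answer \<open>r\<close> in its cell 7.\<close>

lemma small_query:
  assumes "r < 2 ^ w" "8 \<le> w"
  shows "tot w [1, 1, 0, 0, 0, 0, 0, 0, r] 0 query rs (\<lambda>rs'. rs' 0 = r)"
proof -
  have "(2::nat) ^ 8 \<le> 2 ^ w" using assms(2) by (intro power_increasing) auto
  then have w: "256 \<le> (2::nat) ^ w" by simp
  have lit: "x mod 2 ^ w = x" if "x < 256" for x :: nat using that w by simp
  let ?M = "[1, 1, 0, 0, 0, 0, 0, 0, r] :: nat list"
  have e: "val w ?M rs (Lit 0) = Some 0" "val w ?M rs (arr 0 (Lit 0)) = Some 1"
    "val w ?M rs (arr 0 (Lit 7)) = Some r"
    using lit by (simp_all add: arr_def lit)
  show ?thesis unfolding query_def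
    by (rule tot_If[OF e(1,2)], rule tot_Asg[OF e(3)]) simp_all
qed

theorem theorem2:
  fixes c :: nat
  assumes "c \<ge> 1"
  shows "\<exists>(b::nat) (K::nat) (P::program). b \<ge> 1 \<and>
    (\<forall>(G::slp) (S::nat list) (N::nat) (n::nat) (p::nat).
      linear_slp G \<and> S = slp_string G \<and> N = length S \<and> n = slp_size G \<and>
      prime p \<and> 2 * N ^ (c + 4) \<le> p \<and> p \<le> 4 * N ^ (c + 4) \<longrightarrow>
      (\<exists>M::nat list.
         length M \<le> K * n \<and> (\<forall>x\<in>set M. x < 2 ^ word_size b N) \<and>
         (\<forall>i j f. 1 \<le> i \<and> i \<le> j \<and> j \<le> N \<and> (is_finger G i f \<or> is_finger G j f) \<longrightarrow>
            (\<exists>t. real t \<le> K * loglog \<bar>real i - real j\<bar> \<and>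
                 answers_query (word_size b N) P M [i, j, f] t
                   (fingerprint c p (substring S i j))))))"
proof -
  \<comment> \<open>Two values below Q, which is of order \<open>(N + 1) ^ (c + 4)\<close>, must be
    multiplied without overflow. This takes \<open>(N + 1) ^ (2 * c + 35)\<close>; the rest is
    slack.\<close>
  define b where "b = 2 * c + 100"
  \<comment> \<open>Space: \<open>540 * (k + m)\<close> with \<open>k\<close> and \<open>m\<close>
    at most \<open>n\<close>. Time: \<open>clen query * (2 * l + 2)\<close> with \<open>l\<close> at
    most \<open>3 * loglog D\<close> and 2 at most \<open>2 * loglog D\<close>.\<close>
  define K where "K = 1080 + 8 * clen query"
  define P where "P = comp 0 query @ [Halt]"
  have log1: "loglog D \<ge> 1" for D
  proof -
    have "log 2 4 \<le> log 2 (max 4 D)" by (intro log_mono) auto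
    moreover have "log 2 4 = (2::real)" using log_powr_cancel[of 2 2] by simp
    ultimately have "log 2 (max 4 D) \<ge> 2" by linarith
    then have "log 2 2 \<le> log 2 (log 2 (max 4 D))" by (intro log_mono) auto
    then show ?thesis by (simp add: loglog_def)
  qed
  have main: "\<exists>M. length M \<le> K * n \<and> (\<forall>x\<in>set M. x < 2 ^ word_size b N) \<and>
         (\<forall>i j f. 1 \<le> i \<and> i \<le> j \<and> j \<le> N \<and> (is_finger G i f \<or> is_finger G j f) \<longrightarrow>
            (\<exists>t. real t \<le> K * loglog \<bar>real i - real j\<bar> \<and>
                 answers_query (word_size b N) P M [i, j, f] t (fingerprint c p (substring S i j))))"
    if G: "linear_slp G" and S: "S = slp_string G" "N = length S" and n: "n = slp_size G"
      and p: "prime p" "2 * N ^ (c + 4) \<le> p" "p \<le> 4 * N ^ (c + 4)" for G S N n p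
  proof -
    define Ls where "Ls = map (string_of G) (children G)"
    let ?w = "word_size b N"
    have SL: "S = concat Ls" by (simp add: S slp_string_def Ls_def)
    have sub: "set (children G) \<subseteq> nodes G" "children G \<noteq> []" using G by (simp_all add: linear_slp_def)
    have nz: "string_of G v \<noteq> []" if "v \<in> nodes G" for v
      using produces_nonempty[OF produces_string_of[OF G that]] .
    have ne: "Ls \<noteq> []" "[] \<notin> set Ls"
      using sub nz unfolding Ls_def by fastforce+
    have N1: "N \<ge> 1"
    proof -
      have "concat Ls \<noteq> []" using ne by (cases Ls) auto
      then have "length (concat Ls) \<ge> 1" by (cases "concat Ls") auto
      then show ?thesis using S(2) SL by metis
    qed
    have wb: "(N + 1) ^ b \<le> 2 ^ ?w" by (rule word_size_bound)
    have n1: "n \<ge> 1" by (simp add: n slp_size_def)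
    show ?thesis
    proof (cases "N \<ge> 2")
      case False
      then have N: "N = 1" using N1 by simp
      then have "N + 1 = 2" by simp
      then have w2b: "2 ^ b \<le> (2::nat) ^ ?w" using wb by metis
      have pw: "p < 2 ^ ?w"
      proof -
        have "p < 2 ^ 3" using p N by simp
        also have "(2::nat) ^ 3 \<le> 2 ^ b" by (intro power_increasing) (auto simp: b_def)
        also have "\<dots> \<le> 2 ^ ?w" by (rule w2b)
        finally show ?thesis .
      qed
      have "(2::nat) ^ 8 \<le> 2 ^ b" by (intro power_increasing) (auto simp: b_def)
      also have "\<dots> \<le> 2 ^ ?w" by (rule w2b)
      finally have w8: "8 \<le> ?w" by (rule power_le_imp_le_exp[rotated]) simp
      then have "(2::nat) ^ 8 \<le> 2 ^ ?w" by (intro power_increasing) auto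
      then have w2: "1 < (2::nat) ^ ?w" by simp
      define r where "r = fingerprint c p (substring S 1 1)"
      have "p > 0" using p(1) prime_gt_0_nat by blast
      then have "r < p" by (simp add: r_def fingerprint_def)
      then have rw: "r < 2 ^ ?w" using pw by simp
      show ?thesis
      proof (intro exI[of _ "[1, 1, 0, 0, 0, 0, 0, 0, r]"] conjI allI impI)
        have "9 * 1 \<le> K * n" using n1 by (intro mult_mono) (simp_all add: K_def)
        then show "length [1, 1, 0, 0, 0, 0, 0, 0, r] \<le> K * n" by simp
        show "\<forall>x\<in>set [1, 1, 0, 0, 0, 0, 0, 0, r]. x < 2 ^ ?w" using rw w2 by simp
        fix i j f assume "1 \<le> i \<and> i \<le> j \<and> j \<le> N \<and> (is_finger G i f \<or> is_finger G j f)"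
        then have ij: "i = 1" "j = 1" using N by auto
        obtain t where t: "t \<le> clen query * (0 + 1)"
            "answers_query ?w P [1, 1, 0, 0, 0, 0, 0, 0, r] [i, j, f] t r"
          using tot_answers_query[OF small_query[OF rw w8] cvars_query] unfolding P_def by blast
        have "real t \<le> real K * 1" using t(1) by (simp add: K_def)
        also have "\<dots> \<le> K * loglog \<bar>real i - real j\<bar>" using log1 by (intro mult_left_mono) auto
        finally show "\<exists>t. real t \<le> K * loglog \<bar>real i - real j\<bar> \<and>
            answers_query ?w P [1, 1, 0, 0, 0, 0, 0, 0, r] [i, j, f] t (fingerprint c p (substring S i j))"
          using t(2) ij by (auto simp: r_def)
      qed
    next
      case N: True
      have NL: "N = length (concat Ls)" using S(2) SL by metis
      let ?k = "length Ls" and ?m = "card (prefixes Ls)"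
      have "?k \<le> n" "?m \<le> n"
        using card_prefixes_slp[OF G] unfolding n slp_size_def by (simp_all add: Ls_def le_max_iff_disj)
      then have km: "?k + ?m \<le> 2 * n" by simp
      let ?Q = "p + 1000 * (N + 1)"
      have "100 * (?Q * ?Q) \<le> 2 ^ ?w"
      proof -
        have "4 * N ^ (c + 4) \<le> 4 * (N + 1) ^ (c + 4)" by (intro mult_left_mono power_mono) auto
        then have "p \<le> 4 * (N + 1) ^ (c + 4)" using p(3) by (rule order_trans[rotated])
        moreover have "1000 * (N + 1) \<le> 1000 * (N + 1) ^ (c + 4)" using self_le_power[of "N + 1" "c + 4"] by simp
        ultimately have "?Q \<le> 4 * (N + 1) ^ (c + 4) + 1000 * (N + 1) ^ (c + 4)" by (rule add_mono)
        also have "\<dots> = 1004 * (N + 1) ^ (c + 4)" by simp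
        also have "\<dots> \<le> 2 ^ 10 * (N + 1) ^ (c + 4)" by (intro mult_right_mono) simp_all
        finally have "?Q \<le> 2 ^ 10 * (N + 1) ^ (c + 4)" .
        then have "100 * (?Q * ?Q) \<le> 2 ^ 7 * ((2 ^ 10 * (N + 1) ^ (c + 4)) * (2 ^ 10 * (N + 1) ^ (c + 4)))"
          by (intro mult_mono) auto
        also have "\<dots> = 2 ^ 27 * (N + 1) ^ (2 * c + 8)"
          by (simp add: power_add[symmetric] mult_2[symmetric])
        also have "\<dots> \<le> (N + 1) ^ 27 * (N + 1) ^ (2 * c + 8)"
          using N by (intro mult_right_mono power_mono) auto
        also have "\<dots> = (N + 1) ^ (2 * c + 35)" by (simp add: power_add[symmetric] add.commute)
        also have "\<dots> \<le> (N + 1) ^ b" by (intro power_increasing) (auto simp: b_def)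
        finally show ?thesis using wb by linarith
      qed
      then obtain M A h0 R s e idx md jb ld mb mk where M: "length M \<le> 540 * (?k + ?m)"
        "\<forall>x\<in>set M. x < 2 ^ ?w" and qm: "query_memory (\<lambda>g. length (concat (take g Ls))) ?k ?w M A ?Q p (8 * N) h0 R s c e
          Ls (prefixes Ls) idx md jb ld mb mk"
        using memory_exists[OF ne, of c p ?w] N assms p NL by auto
      interpret query_memory "\<lambda>g. length (concat (take g Ls))" ?k ?w M A ?Q p "8 * N" h0 R s c e
          Ls "prefixes Ls" idx md jb ld mb mk by (rule qm)
      have fing: "1 \<le> f \<and> f \<le> ?k \<and> length (concat (take (f - 1) Ls)) < x \<and> x \<le> length (concat (take f Ls))"
        if "is_finger G x f" for x f
        using that by (simp add: is_finger_def Ls_def take_map)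
      show ?thesis
      proof (intro exI[of _ M] conjI allI impI)
        have "540 * (?k + ?m) \<le> 1080 * n" using km by simp
        also have "\<dots> \<le> K * n" by (intro mult_right_mono) (auto simp: K_def)
        finally show "length M \<le> K * n" using M(1) by linarith
        show "\<forall>x\<in>set M. x < 2 ^ ?w" by (rule M(2))
        fix i j f assume q: "1 \<le> i \<and> i \<le> j \<and> j \<le> N \<and> (is_finger G i f \<or> is_finger G j f)"
        let ?l = "level_of (j - i)"
        let ?rs = "\<lambda>d. if d < length [i, j, f] then [i, j, f] ! d else 0"
        have f: "1 \<le> f" "f \<le> ?k"
            "(length (concat (take (f - 1) Ls)) < i \<and> i \<le> length (concat (take f Ls))) \<or>
             (length (concat (take (f - 1) Ls)) < j \<and> j \<le> length (concat (take f Ls)))"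
          using q fing by blast+
        have "tot ?w M (2 * ?l + 1) query ?rs (\<lambda>rs'. rs' 0 = fingerprint c p (substring S i j))"
          unfolding SL by (rule query_correct[unfolded S_def]) (use q f NL in simp_all)
        then obtain t where t: "t \<le> clen query * (2 * ?l + 1 + 1)"
            "answers_query ?w P M [i, j, f] t (fingerprint c p (substring S i j))"
          using tot_answers_query[OF _ cvars_query] unfolding P_def by blast
        have D: "\<bar>real i - real j\<bar> = real (j - i)" using q by simp
        have "real t \<le> real (clen query * (2 * ?l + 1 + 1))" using t(1) by (rule of_nat_mono)
        also have "\<dots> = real (clen query) * (2 * real ?l + 2)" by (simp add: distrib_left)
        also have "\<dots> \<le> real (clen query) * (8 * loglog (real (j - i)))"
          using level_of_le_loglog[of "j - i"] log1[of "real (j - i)"] by (intro mult_left_mono) auto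
        also have "\<dots> = real (8 * clen query) * loglog (real (j - i))" by simp
        also have "\<dots> \<le> K * loglog (real (j - i))"
          using log1[of "real (j - i)"] by (intro mult_right_mono) (auto simp: K_def)
        finally show "\<exists>t. real t \<le> K * loglog \<bar>real i - real j\<bar> \<and>
            answers_query ?w P M [i, j, f] t (fingerprint c p (substring S i j))"
          using t(2) D by auto
      qed
    qed
  qed
  show ?thesis
    by (rule exI[of _ b], rule exI[of _ K], rule exI[of _ P]) (use main in \<open>auto simp: b_def\<close>)
qed

end
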